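(* Let $0 \neq \phi \in L^2(\mathbb{R}^d)$, let $\Lambda \subseteq \mathbb{R}^d$ be a lattice and $S \in \mathrm{Sp}_{2d}(\mathbb{R})$. Let $\{c_\lambda\}_{\lambda\in\Lambda} \in \ell^2(\Lambda)$ be such that $f = \sum_{\lambda\in\Lambda} c_\lambda T_\lambda^S\phi$ converges in $L^2(\mathbb{R}^d)$, and put $f_\times = \sum_{\lambda\in\Lambda} \overline{c_\lambda} T_\lambda^S\phi$. Then: (1) If $\{c_\lambda \} \in c_{00}(\Lambda)$, then $f \nsim f_\times$ if and only if $\{ c_\lambda \} \in \ell^2_\mathcal{O}(\Lambda)$. (2) If there exist constants $0<A\le B<\infty$ such that $A \leq \mathfrak{p}_{\Lambda^*}[\mu(S)^{-1}\phi](t) \leq B$ for almost every $t \in \mathcal{P}(\Lambda^* )$, then $f \nsim f_\times$ if and only if $\{ c_\lambda \} \in \ell^2_\mathcal{O}(\Lambda)$.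
   Context: $T_\lambda h(t)=h(t-\lambda)$. $\mathrm{Sp}_{2d}(\mathbb{R})=\{S:S^T\mathcal{J}S=\mathcal{J}\}$, $\mathcal{J}=\begin{pmatrix}0&-I_d\\ I_d&0\end{pmatrix}$. $\mu(S)$ is the metaplectic operator associated to $S$ (unitary on $L^2(\mathbb{R}^d)$, determined up to sign), and $T_\lambda^S=\mu(S)T_\lambda\mu(S)^{-1}$. $f\sim h$ means $f=\nu h$ for some $\nu\in\mathbb{C}$ with $|\nu|=1$; $f\nsim h$ means this fails. $c_{00}(\Lambda)$ is the set of finitely supported sequences on $\Lambda$. $\ell^2_\mathcal{O}(\Lambda)=\{\{c_\lambda\}\in\ell^2(\Lambda):$ there is no $\alpha\in\mathbb{R}$ with $c_\lambda\in e^{i\alpha}\mathbb{R}$ for all $\lambda\in\Lambda\}$. For $\Lambda=M\mathbb{Z}^d$: $\Lambda^*=M^{-T}\mathbb{Z}^d$, $\mathcal{P}(\Lambda^* )=M^{-T}[0,1]^d$, and $\mathfrak{p}_{\Lambda^*}[\psi](t)=\sum_{\gamma\in\Lambda^*}|\mathcal{F}\psi(t+\gamma)|^2$ with $\mathcal{F}h(\omega)=\int h(t)e^{-2\pi i\omega\cdot t}dt$. *)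

theory Defs
  imports "HOL-Analysis.Analysis"
begin

definition L2 :: "((real, 'd::finite) vec \<Rightarrow> complex) set" where
  "L2 = {f. f \<in> borel_measurable lborel \<and> integrable lborel (\<lambda>t. (cmod (f t))\<^sup>2)}"

definition l2norm :: "((real, 'd::finite) vec \<Rightarrow> complex) \<Rightarrow> real" where
  "l2norm f = sqrt (\<integral>t. (cmod (f t))\<^sup>2 \<partial>lborel)"

definition ae_eq :: "((real, 'd::finite) vec \<Rightarrow> complex) \<Rightarrow> ((real, 'd) vec \<Rightarrow> complex) \<Rightarrow> bool" where
  "ae_eq f g \<longleftrightarrow> (AE t in lborel. f t = g t)"

definition phase_equiv :: "((real, 'd::finite) vec \<Rightarrow> complex) \<Rightarrow> ((real, 'd) vec \<Rightarrow> complex) \<Rightarrow> bool" where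
  "phase_equiv f h \<longleftrightarrow> (\<exists>\<nu>. cmod \<nu> = 1 \<and> ae_eq f (\<lambda>t. \<nu> * h t))"

definition l2_has_sum ::
  "('i \<Rightarrow> (real, 'd::finite) vec \<Rightarrow> complex) \<Rightarrow> 'i set \<Rightarrow> ((real, 'd) vec \<Rightarrow> complex) \<Rightarrow> bool" where
  "l2_has_sum g I f \<longleftrightarrow> f \<in> L2 \<and>
     (\<forall>\<epsilon>>0. \<exists>F0. finite F0 \<and> F0 \<subseteq> I \<and>
        (\<forall>F. finite F \<and> F0 \<subseteq> F \<and> F \<subseteq> I \<longrightarrow> l2norm (\<lambda>t. f t - (\<Sum>l\<in>F. g l t)) < \<epsilon>))"

definition transl :: "(real, 'd::finite) vec \<Rightarrow> ((real, 'd) vec \<Rightarrow> complex) \<Rightarrow> (real, 'd) vec \<Rightarrow> complex" where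
  "transl l h = (\<lambda>t. h (t - l))"

definition xpart :: "(real, 'd::finite + 'd) vec \<Rightarrow> (real, 'd) vec" where
  "xpart z = (\<chi> i. z $ Inl i)"

definition wpart :: "(real, 'd::finite + 'd) vec \<Rightarrow> (real, 'd) vec" where
  "wpart z = (\<chi> i. z $ Inr i)"

definition tfshift :: "(real, 'd::finite + 'd) vec \<Rightarrow> ((real, 'd) vec \<Rightarrow> complex) \<Rightarrow> (real, 'd) vec \<Rightarrow> complex" where
  "tfshift z f = (\<lambda>t. cis (- pi * (xpart z \<bullet> wpart z)) * cis (2 * pi * (wpart z \<bullet> t)) * f (t - xpart z))"

definition Jmat :: "((real, 'd::finite + 'd) vec, 'd + 'd) vec" where
  "Jmat = (\<chi> i j. case (i, j) of
             (Inl a, Inr b) \<Rightarrow> (if a = b then -1 else 0)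
           | (Inr a, Inl b) \<Rightarrow> (if a = b then 1 else 0)
           | _ \<Rightarrow> 0)"

definition symplectic :: "((real, 'd::finite + 'd) vec, 'd + 'd) vec \<Rightarrow> bool" where
  "symplectic S \<longleftrightarrow> transpose S ** Jmat ** S = Jmat"

text \<open>U is a metaplectic operator associated with S: a unitary operator on L^2
  with U rho(z) U^{-1} = rho(S z) for all z (this determines U up to a unimodular constant).\<close>
definition metaplectic_op ::
  "((real, 'd::finite + 'd) vec, 'd + 'd) vec \<Rightarrow> (((real, 'd) vec \<Rightarrow> complex) \<Rightarrow> ((real, 'd) vec \<Rightarrow> complex)) \<Rightarrow> bool" where
  "metaplectic_op S U \<longleftrightarrow>
     (\<forall>f\<in>L2. U f \<in> L2 \<and> l2norm (U f) = l2norm f) \<and>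
     (\<forall>f\<in>L2. \<forall>g\<in>L2. ae_eq f g \<longrightarrow> ae_eq (U f) (U g)) \<and>
     (\<forall>f\<in>L2. \<forall>g\<in>L2. \<forall>a b. ae_eq (U (\<lambda>t. a * f t + b * g t)) (\<lambda>t. a * U f t + b * U g t)) \<and>
     (\<forall>g\<in>L2. \<exists>f\<in>L2. ae_eq (U f) g) \<and>
     (\<forall>z. \<forall>f\<in>L2. ae_eq (U (tfshift z f)) (tfshift (S *v z) (U f)))"

definition ft_trunc :: "((real, 'd::finite) vec \<Rightarrow> complex) \<Rightarrow> real \<Rightarrow> (real, 'd) vec \<Rightarrow> complex" where
  "ft_trunc \<psi> r \<omega> = (\<integral>t. indicator (ball 0 r) t * \<psi> t * cis (- 2 * pi * (\<omega> \<bullet> t)) \<partial>lborel)"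

definition is_L2_fourier :: "((real, 'd::finite) vec \<Rightarrow> complex) \<Rightarrow> ((real, 'd) vec \<Rightarrow> complex) \<Rightarrow> bool" where
  "is_L2_fourier \<psi> g \<longleftrightarrow> g \<in> L2 \<and>
     ((\<lambda>n. l2norm (\<lambda>\<omega>. g \<omega> - ft_trunc \<psi> (real n) \<omega>)) \<longlonglongrightarrow> 0)"

definition intvecs :: "(real, 'd::finite) vec set" where
  "intvecs = {k. \<forall>i. k $ i \<in> \<int>}"

definition lattice_of :: "((real, 'd::finite) vec, 'd) vec \<Rightarrow> (real, 'd) vec set" where
  "lattice_of M = (\<lambda>k. M *v k) ` intvecs"

definition dual_lattice :: "((real, 'd::finite) vec, 'd) vec \<Rightarrow> (real, 'd) vec set" where
  "dual_lattice M = lattice_of (matrix_inv (transpose M))"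

definition dual_cell :: "((real, 'd::finite) vec, 'd) vec \<Rightarrow> (real, 'd) vec set" where
  "dual_cell M = (\<lambda>s. matrix_inv (transpose M) *v s) ` {s. \<forall>i. 0 \<le> s $ i \<and> s $ i \<le> 1}"

text \<open>p_{Lambda*}[psi](t) = sum over gamma in Lambda* of |F psi (t + gamma)|^2, with g = F psi.\<close>
definition periodization :: "((real, 'd::finite) vec, 'd) vec \<Rightarrow> ((real, 'd) vec \<Rightarrow> complex) \<Rightarrow> (real, 'd) vec \<Rightarrow> real" where
  "periodization M g t = (\<Sum>\<^sub>\<infinity>\<gamma>\<in>dual_lattice M. (cmod (g (t + \<gamma>)))\<^sup>2)"

definition l2seq :: "(real, 'd::finite) vec set \<Rightarrow> ((real, 'd) vec \<Rightarrow> complex) \<Rightarrow> bool" where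
  "l2seq \<Lambda> c \<longleftrightarrow> (\<lambda>l. (cmod (c l))\<^sup>2) summable_on \<Lambda>"

definition c00 :: "(real, 'd::finite) vec set \<Rightarrow> ((real, 'd) vec \<Rightarrow> complex) \<Rightarrow> bool" where
  "c00 \<Lambda> c \<longleftrightarrow> finite {l\<in>\<Lambda>. c l \<noteq> 0}"

definition l2_O :: "(real, 'd::finite) vec set \<Rightarrow> ((real, 'd) vec \<Rightarrow> complex) \<Rightarrow> bool" where
  "l2_O \<Lambda> c \<longleftrightarrow> l2seq \<Lambda> c \<and> \<not> (\<exists>\<alpha>::real. \<forall>l\<in>\<Lambda>. \<exists>r::real. c l = cis \<alpha> * complex_of_real r)"

end

theory Submission
  imports Defs "HOL-Probability.Characteristic_Functions" "HOL-Complex_Analysis.Conformal_Mappings"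
begin

text \<open>
  Since \<open>U\<close> is a linear isometry, everything reduces to translates of \<open>\<psi>\<close>. Expanding
  \<open>f - \<nu> f\<^sub>\<times>\<close> gives the coefficients \<open>c\<^sub>\<lambda> - \<nu> cnj c\<^sub>\<lambda>\<close>, so if the translates are independent (for the
  coefficient sequences at hand) then \<open>f \<sim> f\<^sub>\<times>\<close> means \<open>c\<^sub>\<lambda> = \<nu> cnj c\<^sub>\<lambda>\<close> for one unimodular \<open>\<nu>\<close>, i.e. all
  \<open>c\<^sub>\<lambda>\<close> lie on one real line \<open>cis \<alpha> \<real>\<close> with \<open>\<nu> = cis (2 \<alpha>)\<close>.

  By Plancherel, the norm of \<open>\<Sum> a\<^sub>\<lambda> T\<^sub>\<lambda> \<psi>\<close> is the norm of \<open>P g\<close>, where \<open>g\<close> is the Fourier transform of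
  \<open>\<psi>\<close> and \<open>P\<close> the trigonometric polynomial with coefficients \<open>a\<close>. A nonzero \<open>P\<close> vanishes only on a null
  set, which gives independence of finitely many translates. Folding the integral of \<open>|P g|\<^sup>2\<close> onto
  a cell of the dual lattice turns bounds on the periodization into Riesz bounds, which give both
  convergence of the conjugated series and independence for infinite sums.

  Plancherel itself is obtained by Gaussian regularisation of the autocorrelation, first for
  continuous functions of bounded support and then by density.
\<close>

section \<open>The space of square-integrable functions\<close>

text \<open>Elements of L2 are plain functions, so equalities, including the linearity of
  \<open>U\<close>, hold only almost everywhere; they are therefore handled through
  \<open>l2norm\<close>, and \<open>nn_integral\<close> is preferred since it needs no prior
  integrability. Plancherel would be Fourier inversion at 0 for the autocorrelation, whose transform
  is the squared modulus of \<open>ft h\<close> and whose value at 0 is the squared norm of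
  \<open>h\<close>. Integrability of that squared modulus is not known beforehand; the Gaussian
  factor supplies it and is then removed by a limit. Fatou gives only one inequality; the converse
  needs the autocorrelation to be continuous at 0, hence the passage through continuous functions.
  The two cases call for different kinds of independence. For an arbitrary nonzero \<psi> only
  finite sums of translates are controlled, which says nothing about infinite sums; the lower Riesz
  bound estimates each single coefficient by the norm of any finite sum containing it. Convergence
  of the conjugated series is not given in advance: it is trivial for finite support and otherwise
  rests on the upper bound.\<close>

lemma L2_measurable: "f \<in> L2 \<Longrightarrow> f \<in> borel_measurable borel"
  by (simp add: L2_def)

lemma L2_integrable: "f \<in> L2 \<Longrightarrow> integrable lborel (\<lambda>t. (cmod (f t))\<^sup>2)"
  by (simp add: L2_def)

lemma L2_iff_nn_integral:
  "f \<in> L2 \<longleftrightarrow> f \<in> borel_measurable borel \<and> (\<integral>\<^sup>+t. ennreal ((cmod (f t))\<^sup>2) \<partial>lborel) < \<infinity>"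
  by (auto simp: L2_def integrable_iff_bounded)

lemma l2norm_nonneg [simp]: "0 \<le> l2norm f"
  by (simp add: l2norm_def)

lemma l2norm_power2: "(l2norm f)\<^sup>2 = (\<integral>t. (cmod (f t))\<^sup>2 \<partial>lborel)"
  by (simp add: l2norm_def)

lemma nn_integral_L2:
  "f \<in> L2 \<Longrightarrow> (\<integral>\<^sup>+t. ennreal ((cmod (f t))\<^sup>2) \<partial>lborel) = ennreal ((l2norm f)\<^sup>2)"
  by (simp add: l2norm_power2 nn_integral_eq_integral L2_integrable)

text \<open>A bound on the nonnegative integral yields integrability and the norm estimate together,
  so limits obtained from Fatou need no separate membership proof.\<close>

lemma L2_nn_integralI:
  assumes "f \<in> borel_measurable borel" "(\<integral>\<^sup>+t. ennreal ((cmod (f t))\<^sup>2) \<partial>lborel) \<le> ennreal (r\<^sup>2)" "0 \<le> r"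
  shows "f \<in> L2" and "l2norm f \<le> r"
proof -
  show L: "f \<in> L2"
    using assms le_less_trans[OF assms(2) ennreal_less_top] by (simp add: L2_iff_nn_integral)
  have "(l2norm f)\<^sup>2 \<le> r\<^sup>2"
    using assms(2) nn_integral_L2[OF L] by simp
  then show "l2norm f \<le> r"
    using assms(3) by (rule power2_le_imp_le)
qed

lemma L2_nn_integral_eqI:
  assumes "f \<in> borel_measurable borel" "(\<integral>\<^sup>+t. ennreal ((cmod (f t))\<^sup>2) \<partial>lborel) = ennreal (r\<^sup>2)" "0 \<le> r"
  shows "f \<in> L2" and "l2norm f = r"
proof -
  show L: "f \<in> L2"
    using assms L2_nn_integralI[of f r] by auto
  have "(l2norm f)\<^sup>2 = r\<^sup>2"
    using assms(2) nn_integral_L2[OF L] by simp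
  then show "l2norm f = r"
    using assms(3) by simp
qed

lemma l2norm_ae_cong:
  assumes "f \<in> L2" "g \<in> L2" "ae_eq f g"
  shows "l2norm f = l2norm g"
proof -
  note [measurable] = assms(1,2)[THEN L2_measurable]
  show ?thesis
    unfolding l2norm_def using assms(3)
    by (intro arg_cong[of _ _ sqrt] integral_cong_AE) (auto simp: ae_eq_def)
qed

lemma l2norm_eq_0_iff:
  assumes "f \<in> L2"
  shows "l2norm f = 0 \<longleftrightarrow> ae_eq f (\<lambda>_. 0)"
proof -
  have "l2norm f = 0 \<longleftrightarrow> (\<integral>t. (cmod (f t))\<^sup>2 \<partial>lborel) = 0"
    by (simp add: l2norm_def)
  also have "\<dots> \<longleftrightarrow> (AE t in lborel. (cmod (f t))\<^sup>2 = 0)"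
    by (rule integral_nonneg_eq_0_iff_AE) (use assms in \<open>auto simp: L2_integrable\<close>)
  finally show ?thesis
    by (simp add: ae_eq_def)
qed

lemma L2_zero: "(\<lambda>_. 0) \<in> L2"
  by (simp add: L2_def)

lemma L2_scale: "f \<in> L2 \<Longrightarrow> (\<lambda>t. a * f t) \<in> L2"
  by (auto simp: L2_def norm_mult power_mult_distrib)

lemma l2norm_scale: "l2norm (\<lambda>t. a * f t) = cmod a * l2norm f"
  by (simp add: l2norm_def norm_mult power_mult_distrib real_sqrt_mult)

lemma L2_add:
  assumes "f \<in> L2" "g \<in> L2"
  shows "(\<lambda>t. f t + g t) \<in> L2"
proof -
  note [measurable] = assms[THEN L2_measurable]
  have "integrable lborel (\<lambda>t. (cmod (f t + g t))\<^sup>2)"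
  proof (rule Bochner_Integration.integrable_bound)
    show "integrable lborel (\<lambda>t. 2 * (cmod (f t))\<^sup>2 + 2 * (cmod (g t))\<^sup>2)"
      using assms by (simp add: L2_integrable)
    have "(cmod (f t + g t))\<^sup>2 \<le> 2 * (cmod (f t))\<^sup>2 + 2 * (cmod (g t))\<^sup>2" for t
    proof -
      have "(cmod (f t + g t))\<^sup>2 \<le> (cmod (f t) + cmod (g t))\<^sup>2"
        by (intro power_mono norm_triangle_ineq) auto
      then show ?thesis
        using sum_squares_bound[of "cmod (f t)" "cmod (g t)"] by (simp add: power2_sum)
    qed
    then show "AE t in lborel. norm ((cmod (f t + g t))\<^sup>2) \<le> norm (2 * (cmod (f t))\<^sup>2 + 2 * (cmod (g t))\<^sup>2)"
      by (intro AE_I2) (simp add: abs_of_nonneg)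
  qed simp
  then show ?thesis
    by (simp add: L2_def)
qed

lemma L2_diff: "f \<in> L2 \<Longrightarrow> g \<in> L2 \<Longrightarrow> (\<lambda>t. f t - g t) \<in> L2"
  using L2_add[of f "\<lambda>t. -1 * g t"] L2_scale[of g "-1"] by simp

lemma L2_sum: "(\<And>i. i \<in> I \<Longrightarrow> f i \<in> L2) \<Longrightarrow> (\<lambda>t. \<Sum>i\<in>I. f i t) \<in> L2"
  by (induction I rule: infinite_finite_induct) (auto simp: L2_zero L2_add)

lemma l2norm_minus_commute: "l2norm (\<lambda>t. f t - g t) = l2norm (\<lambda>t. g t - f t)"
  by (simp add: l2norm_def norm_minus_commute)

text \<open>Minkowski without Cauchy-Schwarz: a weighted pointwise bound for the square of a sum is
  integrated. The weights divide by the two norms, hence the separate case of a vanishing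
  norm.\<close>

lemma l2norm_triangle:
  assumes "f \<in> L2" "g \<in> L2"
  shows "l2norm (\<lambda>t. f t + g t) \<le> l2norm f + l2norm g"
proof (cases "l2norm f = 0 \<or> l2norm g = 0")
  case True
  then show ?thesis
  proof
    assume 0: "l2norm f = 0"
    then have "ae_eq (\<lambda>t. f t + g t) g"
      using assms by (simp add: l2norm_eq_0_iff ae_eq_def)
    then show ?thesis
      using l2norm_ae_cong[OF L2_add[OF assms] assms(2)] 0 by simp
  next
    assume 0: "l2norm g = 0"
    then have "ae_eq (\<lambda>t. f t + g t) f"
      using assms by (simp add: l2norm_eq_0_iff ae_eq_def)
    then show ?thesis
      using l2norm_ae_cong[OF L2_add[OF assms] assms(1)] 0 by simp
  qed
next
  case False
  define a b where "a = l2norm f" and "b = l2norm g"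
  have ab: "a > 0" "b > 0"
    using False by (simp_all add: a_def b_def less_le)
  \<comment> \<open>The weights come from 2xy \<le> (b/a) x^2 + (a/b) y^2, with equality when x : y
    = a : b; after integration the right side is exactly (a + b)^2.\<close>
  have pt: "(cmod (f t + g t))\<^sup>2 \<le> (1 + b / a) * (cmod (f t))\<^sup>2 + (1 + a / b) * (cmod (g t))\<^sup>2" for t
  proof -
    let ?x = "cmod (f t)" and ?y = "cmod (g t)"
    have "(cmod (f t + g t))\<^sup>2 \<le> (?x + ?y)\<^sup>2"
      by (intro power_mono norm_triangle_ineq) auto
    also have "\<dots> \<le> (1 + b / a) * ?x\<^sup>2 + (1 + a / b) * ?y\<^sup>2"
    proof -
      have "0 \<le> (b * ?x - a * ?y)\<^sup>2 / (a * b)"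
        using ab by simp
      also have "\<dots> = b / a * ?x\<^sup>2 + a / b * ?y\<^sup>2 - 2 * ?x * ?y"
        using ab by (simp add: field_simps power2_eq_square)
      finally show ?thesis
        by (simp add: power2_sum algebra_simps)
    qed
    finally show ?thesis .
  qed
  have "(l2norm (\<lambda>t. f t + g t))\<^sup>2 \<le> (\<integral>t. (1 + b / a) * (cmod (f t))\<^sup>2 + (1 + a / b) * (cmod (g t))\<^sup>2 \<partial>lborel)"
    unfolding l2norm_power2
    using assms by (intro integral_mono pt L2_integrable L2_add) (auto simp: L2_integrable)
  also have "\<dots> = (1 + b / a) * a\<^sup>2 + (1 + a / b) * b\<^sup>2"
    using assms by (simp add: L2_integrable a_def b_def flip: l2norm_power2)
  also have "\<dots> = (a + b)\<^sup>2"
    using ab by (simp add: field_simps power2_eq_square)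
  finally show ?thesis
    unfolding a_def[symmetric] b_def[symmetric] by (rule power2_le_imp_le) (use ab in auto)
qed

lemma l2norm_diff_triangle:
  assumes "f \<in> L2" "g \<in> L2" "h \<in> L2"
  shows "l2norm (\<lambda>t. f t - h t) \<le> l2norm (\<lambda>t. f t - g t) + l2norm (\<lambda>t. g t - h t)"
  using l2norm_triangle[OF L2_diff[OF assms(1,2)] L2_diff[OF assms(2,3)]] by simp

lemma l2norm_diff_abs:
  assumes "f \<in> L2" "g \<in> L2"
  shows "\<bar>l2norm f - l2norm g\<bar> \<le> l2norm (\<lambda>t. f t - g t)"
  using l2norm_diff_triangle[OF assms L2_zero] l2norm_diff_triangle[OF assms(2,1) L2_zero]
    l2norm_minus_commute[of f g] by simp

lemma l2norm_tendsto:
  assumes "\<And>n. f n \<in> L2" "g \<in> L2" "(\<lambda>n. l2norm (\<lambda>t. g t - f n t)) \<longlonglongrightarrow> 0"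
  shows "(\<lambda>n. l2norm (f n)) \<longlonglongrightarrow> l2norm g"
proof -
  have "(\<lambda>n. l2norm (f n) - l2norm g) \<longlonglongrightarrow> 0"
  proof (rule Lim_null_comparison[OF _ assms(3)], intro always_eventually allI)
    show "norm (l2norm (f n) - l2norm g) \<le> l2norm (\<lambda>t. g t - f n t)" for n
      using l2norm_diff_abs[OF assms(1,2), of n] l2norm_minus_commute[of g "f n"] by simp
  qed
  then show ?thesis
    by (simp add: LIM_zero_iff)
qed

text \<open>Riesz-Fischer: a fast subsequence converges almost everywhere, and Fatou shows that its
  limit approximates the whole sequence in norm.\<close>

lemma L2_complete:
  assumes L: "\<And>n. f n \<in> L2"
    and cauchy: "\<And>e. e > 0 \<Longrightarrow> \<exists>N. \<forall>m\<ge>N. \<forall>n\<ge>N. l2norm (\<lambda>t. f m t - f n t) < e"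
  shows "\<exists>g\<in>L2. (\<lambda>n. l2norm (\<lambda>t. g t - f n t)) \<longlonglongrightarrow> 0"
proof -
  have "\<exists>N. \<forall>m\<ge>N. \<forall>n\<ge>N. l2norm (\<lambda>t. f m t - f n t) < (1/2) ^ k" for k :: nat
    by (rule cauchy) simp
  then obtain N where N: "\<And>k m n. m \<ge> N k \<Longrightarrow> n \<ge> N k \<Longrightarrow> l2norm (\<lambda>t. f m t - f n t) < (1/2) ^ k"
    by metis
  \<comment> \<open>The partial sums make \<open>r\<close> monotone and at least \<open>N k\<close>;
    the summand \<open>k\<close> forces it to infinity, so that \<open>r j\<close> eventually
    exceeds every \<open>N k\<close>.\<close>
  define r where "r k = k + (\<Sum>j\<le>k. N j)" for k
  have rN: "N k \<le> r k" for k
    unfolding r_def using member_le_sum[of k "{..k}" N] by auto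
  have r_mono: "r k \<le> r (Suc k)" and r_ge: "k \<le> r k" for k
    by (simp_all add: r_def)
  define u where "u k = f (r k)" for k
  have uL: "u k \<in> L2" for k
    by (simp add: u_def L)
  have [measurable]: "u k \<in> borel_measurable borel" "f k \<in> borel_measurable borel" for k
    using uL L by (auto intro: L2_measurable)
  \<comment> \<open>The weight \<open>2 ^ k\<close> is affordable because the squared increments
    have integral at most \<open>(1/4) ^ k\<close>; it is what later makes the increments themselves
    summable.\<close>
  have d: "(\<integral>\<^sup>+t. ennreal (2 ^ k * (cmod (u (Suc k) t - u k t))\<^sup>2) \<partial>lborel) \<le> ennreal ((1/2) ^ k)" for k
  proof -
    have le: "l2norm (\<lambda>t. u (Suc k) t - u k t) \<le> (1/2) ^ k"
      unfolding u_def using N[of k "r (Suc k)" "r k"] rN[of k] r_mono[of k] by auto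
    have "(\<integral>\<^sup>+t. ennreal (2 ^ k * (cmod (u (Suc k) t - u k t))\<^sup>2) \<partial>lborel)
      = ennreal (2 ^ k) * (\<integral>\<^sup>+t. ennreal ((cmod (u (Suc k) t - u k t))\<^sup>2) \<partial>lborel)"
      by (subst nn_integral_cmult[symmetric]) (auto simp: ennreal_mult)
    also have "\<dots> = ennreal (2 ^ k * (l2norm (\<lambda>t. u (Suc k) t - u k t))\<^sup>2)"
      by (simp add: nn_integral_L2[OF L2_diff[OF uL uL]] ennreal_mult)
    also have "\<dots> \<le> ennreal (2 ^ k * ((1/2) ^ k)\<^sup>2)"
      using le by (intro ennreal_leI mult_left_mono power_mono) auto
    also have "2 ^ k * ((1/2) ^ k)\<^sup>2 = (1/2 :: real) ^ k"
      by (simp add: power2_eq_square power_divide)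
    finally show ?thesis .
  qed
  have "(\<integral>\<^sup>+t. (\<Sum>k. ennreal (2 ^ k * (cmod (u (Suc k) t - u k t))\<^sup>2)) \<partial>lborel)
     = (\<Sum>k. \<integral>\<^sup>+t. ennreal (2 ^ k * (cmod (u (Suc k) t - u k t))\<^sup>2) \<partial>lborel)"
    by (rule nn_integral_suminf) measurable
  also have "\<dots> \<le> (\<Sum>k. ennreal ((1/2) ^ k))"
    by (intro suminf_le d) auto
  also have "\<dots> < \<infinity>"
    by (subst suminf_ennreal2) (auto intro!: summable_geometric)
  finally have "AE t in lborel. (\<Sum>k. ennreal (2 ^ k * (cmod (u (Suc k) t - u k t))\<^sup>2)) \<noteq> \<infinity>"
    by (intro nn_integral_noteq_infinite) auto
  then have conv: "AE t in lborel. convergent (\<lambda>k. u k t)"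
  proof eventually_elim
    case (elim t)
    then have s: "summable (\<lambda>k. 2 ^ k * (cmod (u (Suc k) t - u k t))\<^sup>2)"
      by (intro summable_suminf_not_top) auto
    have "summable (\<lambda>k. u (Suc k) t - u k t)"
    proof (rule summable_comparison_test')
      show "summable (\<lambda>k. 2 ^ k * (cmod (u (Suc k) t - u k t))\<^sup>2 + (1/2) ^ k)"
        by (intro summable_add s summable_geometric) auto
      fix k :: nat
      let ?x = "cmod (u (Suc k) t - u k t)"
      \<comment> \<open>AM-GM: the increment is dominated by two summable terms, its weighted square
        and \<open>(1/2) ^ k\<close>.\<close>
      have "0 \<le> (2 ^ k * ?x - 1)\<^sup>2 / 2 ^ k"
        by simp
      also have "\<dots> = 2 ^ k * ?x\<^sup>2 + (1/2) ^ k - 2 * ?x"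
        by (simp add: field_simps power2_eq_square)
      finally show "norm (u (Suc k) t - u k t) \<le> 2 ^ k * ?x\<^sup>2 + (1/2) ^ k"
        using norm_ge_zero[of "u (Suc k) t - u k t"] by linarith
    qed
    then have "convergent (\<lambda>n. \<Sum>k<n. (u (Suc k) t - u k t))"
      by (simp add: summable_iff_convergent)
    then have "convergent (\<lambda>n. (\<Sum>k<n. (u (Suc k) t - u k t)) + u 0 t)"
      by (intro convergent_add convergent_const)
    moreover have "(\<Sum>k<n. (u (Suc k) t - u k t)) = u n t - u 0 t" for n
      by (rule sum_lessThan_telescope)
    ultimately show ?case
      by simp
  qed
  \<comment> \<open>Where \<open>u k t\<close> diverges, which happens only on a null set,
    \<open>lim\<close> is unspecified; the integrals below do not see this set.\<close>
  define g where "g t = lim (\<lambda>k. u k t)" for t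
  have [measurable]: "g \<in> borel_measurable borel"
    unfolding g_def by (rule borel_measurable_lim_metric) measurable
  have lim: "AE t in lborel. (\<lambda>k. u k t) \<longlonglongrightarrow> g t"
    using conv unfolding g_def by eventually_elim (simp add: convergent_LIMSEQ_iff)
  have key: "(\<lambda>t. g t - f n t) \<in> L2 \<and> l2norm (\<lambda>t. g t - f n t) \<le> (1/2) ^ k" if "n \<ge> N k" for n k
  proof -
    have "(\<integral>\<^sup>+t. ennreal ((cmod (g t - f n t))\<^sup>2) \<partial>lborel)
      = (\<integral>\<^sup>+t. liminf (\<lambda>j. ennreal ((cmod (u j t - f n t))\<^sup>2)) \<partial>lborel)"
    proof (rule nn_integral_cong_AE)
      show "AE t in lborel. ennreal ((cmod (g t - f n t))\<^sup>2) = liminf (\<lambda>j. ennreal ((cmod (u j t - f n t))\<^sup>2))"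
        using lim
      proof eventually_elim
        case (elim t)
        have "(\<lambda>j. ennreal ((cmod (u j t - f n t))\<^sup>2)) \<longlonglongrightarrow> ennreal ((cmod (g t - f n t))\<^sup>2)"
          by (intro tendsto_intros tendsto_ennrealI elim)
        then show ?case
          by (intro lim_imp_Liminf[symmetric]) simp_all
      qed
    qed
    also have "\<dots> \<le> liminf (\<lambda>j. \<integral>\<^sup>+t. ennreal ((cmod (u j t - f n t))\<^sup>2) \<partial>lborel)"
      by (rule nn_integral_liminf) measurable
    also have "\<dots> \<le> limsup (\<lambda>j. \<integral>\<^sup>+t. ennreal ((cmod (u j t - f n t))\<^sup>2) \<partial>lborel)"
      by (rule Liminf_le_Limsup) simp
    also have "\<dots> \<le> ennreal (((1/2) ^ k)\<^sup>2)"
    proof (rule Limsup_bounded)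
      show "\<forall>\<^sub>F j in sequentially. (\<integral>\<^sup>+t. ennreal ((cmod (u j t - f n t))\<^sup>2) \<partial>lborel) \<le> ennreal (((1/2) ^ k)\<^sup>2)"
        using eventually_ge_at_top[of "N k"]
      proof eventually_elim
        case (elim j)
        have "l2norm (\<lambda>t. u j t - f n t) \<le> (1/2) ^ k"
          unfolding u_def using N[of k "r j" n] that elim r_ge[of j] by auto
        then show ?case
          unfolding nn_integral_L2[OF L2_diff[OF uL L]] by (intro ennreal_leI power_mono) auto
      qed
    qed
    finally show ?thesis
      using L2_nn_integralI[of "\<lambda>t. g t - f n t" "(1/2) ^ k"] by auto
  qed
  have gL: "g \<in> L2"
    using L2_add[OF conjunct1[OF key[of 0 "N 0", OF order_refl]] L[of "N 0"]] by simp
  have "(\<lambda>n. l2norm (\<lambda>t. g t - f n t)) \<longlonglongrightarrow> 0"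
  proof (rule LIMSEQ_I)
    fix e :: real assume "e > 0"
    then obtain k where k: "(1/2) ^ k < e"
      using real_arch_pow_inv[of e "1/2"] by auto
    show "\<exists>no. \<forall>n\<ge>no. norm (l2norm (\<lambda>t. g t - f n t) - 0) < e"
    proof (intro exI[of _ "N k"] allI impI)
      fix n assume "n \<ge> N k"
      then show "norm (l2norm (\<lambda>t. g t - f n t) - 0) < e"
        using key[of k n] k by simp
    qed
  qed
  then show ?thesis using gL by blast
qed

section \<open>Gaussians and characters\<close>

lemma borel_measurable_cis [measurable]: "cis \<in> borel_measurable borel"
  by (intro borel_measurable_continuous_onI continuous_intros)

lemma borel_measurable_cnj [measurable]: "cnj \<in> borel_measurable borel"
  by (intro borel_measurable_continuous_onI continuous_intros)

section \<open>Translations and affine substitutions in Lebesgue integrals\<close>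

lemma nn_integral_lborel_translate:
  fixes a :: "'a::euclidean_space"
  assumes "f \<in> borel_measurable borel"
  shows "(\<integral>\<^sup>+x. f (x + a) \<partial>lborel) = (\<integral>\<^sup>+x. f x \<partial>lborel)"
  using assms
  by (subst (2) lborel_distr_plus[of a, symmetric]) (simp add: nn_integral_distr add.commute)

lemma nn_integral_lborel_translate_diff:
  fixes a :: "'a::euclidean_space"
  assumes "f \<in> borel_measurable borel"
  shows "(\<integral>\<^sup>+x. f (x - a) \<partial>lborel) = (\<integral>\<^sup>+x. f x \<partial>lborel)"
  using nn_integral_lborel_translate[OF assms, of "- a"] by simp

lemma lborel_integral_affine:
  fixes f :: "'a::euclidean_space \<Rightarrow> 'b::{banach, second_countable_topology}"
  assumes [measurable]: "f \<in> borel_measurable borel" and "c \<noteq> 0"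
  shows "(\<integral>x. f x \<partial>lborel) = \<bar>c\<bar> ^ DIM('a) *\<^sub>R (\<integral>x. f (t + c *\<^sub>R x) \<partial>lborel)"
proof -
  have "(\<integral>x. f x \<partial>lborel)
    = (\<integral>x. f x \<partial>density (distr lborel borel (\<lambda>x. t + c *\<^sub>R x)) (\<lambda>_. ennreal (\<bar>c\<bar> ^ DIM('a))))"
    using lborel_affine[OF \<open>c \<noteq> 0\<close>, of t] by (simp add: ennreal_power)
  also have "\<dots> = \<bar>c\<bar> ^ DIM('a) *\<^sub>R (\<integral>x. f (t + c *\<^sub>R x) \<partial>lborel)"
    by (subst integral_density) (auto simp: integral_distr)
  finally show ?thesis .
qed

lemma lborel_integrable_affine:
  fixes f :: "'a::euclidean_space \<Rightarrow> 'b::{banach, second_countable_topology}"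
  assumes f: "integrable lborel f" and "c \<noteq> 0"
  shows "integrable lborel (\<lambda>x. f (t + c *\<^sub>R x))"
proof -
  have [measurable]: "f \<in> borel_measurable borel"
    using f by auto
  have eq: "lborel = density (distr lborel borel (\<lambda>x. t + c *\<^sub>R x)) (\<lambda>_. ennreal (\<bar>c\<bar> ^ DIM('a)))"
    using lborel_affine[OF \<open>c \<noteq> 0\<close>, of t] by (simp add: ennreal_power)
  have "integrable (density (distr lborel borel (\<lambda>x. t + c *\<^sub>R x)) (\<lambda>_. ennreal (\<bar>c\<bar> ^ DIM('a)))) f"
    using f eq by metis
  then have "integrable (distr lborel borel (\<lambda>x. t + c *\<^sub>R x)) (\<lambda>x. \<bar>c\<bar> ^ DIM('a) *\<^sub>R f x)"
    by (subst (asm) integrable_density) auto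
  then have "integrable lborel (\<lambda>x. \<bar>c\<bar> ^ DIM('a) *\<^sub>R f (t + c *\<^sub>R x))"
    by (subst (asm) integrable_distr_eq) auto
  then have "integrable lborel (\<lambda>x. inverse (\<bar>c\<bar> ^ DIM('a)) *\<^sub>R (\<bar>c\<bar> ^ DIM('a) *\<^sub>R f (t + c *\<^sub>R x)))"
    by (rule integrable_scaleR_right)
  then show ?thesis
    using \<open>c \<noteq> 0\<close> by simp
qed

text \<open>\<open>lborel\<close> is the image of the product of the coordinate measures, so Fubini
  applies coordinate by coordinate; this reduces the Gaussian to one dimension.\<close>

lemma lborel_integral_prod_Basis:
  fixes f :: "'a::euclidean_space \<Rightarrow> real \<Rightarrow> complex"
  assumes int: "\<And>b. b \<in> Basis \<Longrightarrow> integrable lborel (f b)"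
  shows "(\<integral>x. (\<Prod>b\<in>Basis. f b (x \<bullet> b)) \<partial>lborel) = (\<Prod>b\<in>Basis. (\<integral>x. f b x \<partial>lborel))"
proof -
  interpret product_sigma_finite "\<lambda>_::'a. lborel :: real measure" ..
  have [measurable]: "b \<in> Basis \<Longrightarrow> f b \<in> borel_measurable borel" for b
    using int[of b] by auto
  have "(\<integral>x. (\<Prod>b\<in>Basis. f b (x \<bullet> b)) \<partial>lborel)
    = (\<integral>x. (\<Prod>b\<in>Basis. f b (x b)) \<partial>(\<Pi>\<^sub>M b\<in>Basis. lborel))"
    by (subst lborel_eq, subst integral_distr) (auto simp: inner_sum_left_Basis intro!: Bochner_Integration.integral_cong prod.cong)
  also have "\<dots> = (\<Prod>b\<in>Basis. (\<integral>x. f b x \<partial>lborel))"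
    using int by (intro product_integral_prod) auto
  finally show ?thesis .
qed

text \<open>Read off from the characteristic function of the standard normal law at
  \<open>- sqrt (2 * pi) * w\<close>; substituting \<open>sqrt (2 * pi) * x\<close> turns the normal
  density into exp(-pi x^2), the prefactor being absorbed by the Jacobian.\<close>

lemma gaussian_fourier_real:
  "(\<integral>x. complex_of_real (exp (- pi * x\<^sup>2)) * cis (- 2 * pi * (w * x)) \<partial>lborel) = complex_of_real (exp (- pi * w\<^sup>2))"
proof -
  let ?s = "sqrt (2 * pi)"
  let ?t = "- ?s * w"
  have "complex_of_real (exp (- pi * w\<^sup>2)) = complex_of_real (exp (- (?t\<^sup>2) / 2))"
    by (simp add: power_mult_distrib)
  also have "\<dots> = char std_normal_distribution ?t"
    by (simp add: char_std_normal_distribution)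
  also have "\<dots> = (\<integral>x. std_normal_density x *\<^sub>R cis (?t * x) \<partial>lborel)"
    unfolding char_def by (subst integral_density) (auto simp: cis_conv_exp)
  also have "\<dots> = ?s *\<^sub>R (\<integral>x. std_normal_density (?s *\<^sub>R x) *\<^sub>R cis (?t * (?s *\<^sub>R x)) \<partial>lborel)"
    by (subst lborel_integral_affine[where c = ?s and t = 0]) auto
  also have "\<dots> = (\<integral>x. ?s *\<^sub>R (std_normal_density (?s *\<^sub>R x) *\<^sub>R cis (?t * (?s *\<^sub>R x))) \<partial>lborel)"
    by (rule integral_scaleR_right[symmetric])
  also have "\<dots> = (\<integral>x. complex_of_real (exp (- pi * x\<^sup>2)) * cis (- 2 * pi * (w * x)) \<partial>lborel)"
  proof (intro Bochner_Integration.integral_cong refl)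
    fix x :: real
    have 1: "?t * (?s *\<^sub>R x) = - 2 * pi * (w * x)"
      by (simp add: algebra_simps flip: real_sqrt_mult)
    have 2: "?s * std_normal_density (?s *\<^sub>R x) = exp (- pi * x\<^sup>2)"
      by (simp add: std_normal_density_def power_mult_distrib)
    show "?s *\<^sub>R (std_normal_density (?s *\<^sub>R x) *\<^sub>R cis (?t * (?s *\<^sub>R x)))
      = complex_of_real (exp (- pi * x\<^sup>2)) * cis (- 2 * pi * (w * x))"
      unfolding scaleR_scaleR[of ?s "std_normal_density (?s *\<^sub>R x)"] 1 2 by (simp add: scaleR_conv_of_real)
  qed
  finally show ?thesis ..
qed

section \<open>Characters and the self-dual Gaussian\<close>

definition echar :: "'a::real_inner \<Rightarrow> 'a \<Rightarrow> complex" where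
  "echar w t = cis (- 2 * pi * (w \<bullet> t))"

lemma norm_echar [simp]: "cmod (echar w t) = 1"
  by (simp add: echar_def)

lemma echar_nonzero [simp]: "echar w t \<noteq> 0"
  by (simp add: echar_def)

lemma echar_zero [simp]: "echar 0 t = 1" "echar w 0 = 1"
  by (simp_all add: echar_def)

lemma echar_add_right: "echar w (s + t) = echar w s * echar w t"
  by (simp add: echar_def cis_mult inner_add_right algebra_simps)

lemma echar_add_left: "echar (v + w) t = echar v t * echar w t"
  by (simp add: echar_def cis_mult inner_add_left algebra_simps)

lemma cnj_echar: "cnj (echar w t) = echar w (- t)"
  by (simp add: echar_def cis_cnj)

lemma echar_diff_right: "echar w (s - t) = echar w s * cnj (echar w t)"
  using echar_add_right[of w s "- t"] by (simp add: cnj_echar)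

lemma borel_measurable_echar [measurable (raw)]:
  fixes f g :: "'b \<Rightarrow> 'a::euclidean_space"
  assumes [measurable]: "f \<in> borel_measurable M" "g \<in> borel_measurable M"
  shows "(\<lambda>x. echar (f x) (g x)) \<in> borel_measurable M"
  unfolding echar_def by measurable

text \<open>Normalised so that it has total mass 1 and is its own Fourier transform.\<close>

definition gauss :: "'a::euclidean_space \<Rightarrow> real" where
  "gauss x = exp (- pi * (norm x)\<^sup>2)"

lemma borel_measurable_gauss [measurable]: "gauss \<in> borel_measurable borel"
  unfolding gauss_def by measurable

lemma gauss_nonneg: "0 \<le> gauss x" and gauss_le_1: "gauss x \<le> 1"
  by (simp_all add: gauss_def)

lemma gaussian_fourier:
  fixes w :: "'a::euclidean_space"
  shows "(\<integral>x. complex_of_real (gauss x) * echar w x \<partial>lborel) = complex_of_real (gauss w)"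
proof -
  have sq: "gauss x = (\<Prod>b\<in>Basis. exp (- pi * (x \<bullet> b)\<^sup>2))" for x :: 'a
    by (simp add: gauss_def exp_sum[symmetric] norm_eq_sqrt_inner euclidean_inner[of x x] sum_distrib_left sum_nonneg
        power2_eq_square sum_negf)
  have cs: "echar w x = (\<Prod>b\<in>Basis. cis (- 2 * pi * ((w \<bullet> b) * (x \<bullet> b))))" for x
  proof -
    have "w \<bullet> x = (\<Sum>b\<in>Basis. (w \<bullet> b) * (x \<bullet> b))"
      by (rule euclidean_inner)
    then show ?thesis
      by (simp add: echar_def cis_conv_exp exp_sum[symmetric] sum_distrib_left sum_negf)
  qed
  \<comment> \<open>A function that is not integrable has Bochner integral 0, so the nonzero value
    in \<open>gaussian_fourier_real\<close> already proves integrability.\<close>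
  have int1: "integrable lborel (\<lambda>x::real. complex_of_real (exp (- pi * x\<^sup>2)) * cis (- 2 * pi * (v * x)))" for v
    using gaussian_fourier_real[of v] not_integrable_integral_eq by fastforce
  have "(\<integral>x. complex_of_real (gauss x) * echar w x \<partial>lborel)
    = (\<integral>x. (\<Prod>b\<in>Basis. complex_of_real (exp (- pi * (x \<bullet> b)\<^sup>2)) * cis (- 2 * pi * ((w \<bullet> b) * (x \<bullet> b)))) \<partial>lborel)"
    unfolding sq cs by (simp add: prod.distrib)
  also have "\<dots> = (\<Prod>b\<in>Basis. complex_of_real (exp (- pi * (w \<bullet> b)\<^sup>2)))"
    by (subst lborel_integral_prod_Basis
        [where f = "\<lambda>b y. complex_of_real (exp (- pi * y\<^sup>2)) * cis (- 2 * pi * ((w \<bullet> b) * y))"])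
      (auto simp only: gaussian_fourier_real int1)
  finally show ?thesis
    by (simp add: sq)
qed

lemma integrable_gauss: "integrable lborel (gauss :: 'a::euclidean_space \<Rightarrow> real)"
  and integral_gauss: "(\<integral>x. gauss (x::'a::euclidean_space) \<partial>lborel) = 1"
proof -
  have *: "(\<integral>x. complex_of_real (gauss (x::'a)) \<partial>lborel) = 1"
    using gaussian_fourier[of "0::'a"] by (simp add: gauss_def)
  then have "integrable lborel (\<lambda>x. complex_of_real (gauss (x::'a)))"
    using not_integrable_integral_eq by fastforce
  then show "integrable lborel (gauss :: 'a::euclidean_space \<Rightarrow> real)"
    by (simp add: complex_of_real_integrable_eq)
  show "(\<integral>x. gauss (x::'a::euclidean_space) \<partial>lborel) = 1"
    using * by simp
qed

section \<open>Fourier transform and autocorrelation\<close>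

text \<open>Meaningful for integrable \<open>h\<close>. On the rest of L2 the integral may fail to
  exist, and the transform is an L2 limit as in \<open>is_L2_fourier\<close>.\<close>

definition ft :: "((real, 'd::finite) vec \<Rightarrow> complex) \<Rightarrow> (real, 'd) vec \<Rightarrow> complex" where
  "ft h w = (\<integral>t. h t * echar w t \<partial>lborel)"

lemma integrable_mult_echar:
  fixes h :: "'a::euclidean_space \<Rightarrow> complex"
  assumes "integrable lborel h"
  shows "integrable lborel (\<lambda>t. h t * echar w t)"
proof (rule Bochner_Integration.integrable_bound[OF assms])
  show "(\<lambda>t. h t * echar w t) \<in> borel_measurable lborel"
    using assms by measurable
qed (simp add: norm_mult)

lemma borel_measurable_ft [measurable]:
  assumes [measurable]: "h \<in> borel_measurable borel"
  shows "ft h \<in> borel_measurable borel"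
  unfolding ft_def by measurable

lemma ft_diff:
  assumes "integrable lborel h" "integrable lborel k"
  shows "ft (\<lambda>t. h t - k t) w = ft h w - ft k w"
  unfolding ft_def using assms
  by (simp add: left_diff_distrib Bochner_Integration.integral_diff integrable_mult_echar)

lemma ft_sum_transl:
  assumes "integrable lborel h" "finite F"
  shows "ft (\<lambda>t. \<Sum>l\<in>F. a l * h (t - l)) w = (\<Sum>l\<in>F. a l * echar w l) * ft h w"
proof -
  have [measurable]: "h \<in> borel_measurable borel"
    using assms by auto
  have int: "integrable lborel (\<lambda>t. h (t - l))" for l
    using lborel_integrable_affine[OF assms(1), of 1 "- l"] by (simp add: algebra_simps)
  have sh: "ft (\<lambda>t. h (t - l)) w = echar w l * ft h w" for l
  proof -
    have "ft (\<lambda>t. h (t - l)) w = (\<integral>t. h t * echar w (l + t) \<partial>lborel)"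
      unfolding ft_def by (subst lborel_integral_affine[where c = 1 and t = l]) auto
    also have "\<dots> = (\<integral>t. echar w l * (h t * echar w t) \<partial>lborel)"
      by (intro Bochner_Integration.integral_cong refl)
        (simp add: echar_add_right mult_ac)
    also have "\<dots> = echar w l * ft h w"
      unfolding ft_def by (rule integral_mult_right_zero)
    finally show ?thesis .
  qed
  have "ft (\<lambda>t. \<Sum>l\<in>F. a l * h (t - l)) w
    = (\<integral>t. (\<Sum>l\<in>F. a l * (h (t - l) * echar w t)) \<partial>lborel)"
    unfolding ft_def by (simp add: sum_distrib_right mult.assoc)
  also have "\<dots> = (\<Sum>l\<in>F. a l * ft (\<lambda>t. h (t - l)) w)"
    unfolding ft_def
    by (subst Bochner_Integration.integral_sum) (auto intro!: integrable_mult_right integrable_mult_echar int)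
  finally show ?thesis
    by (simp add: sh sum_distrib_right mult.assoc)
qed

text \<open>The convolution of \<open>h\<close> with the conjugate of its reflection: at 0 it is the
  squared norm, and its Fourier transform is the squared modulus of \<open>ft h\<close>.\<close>

definition autocorr :: "((real, 'd::finite) vec \<Rightarrow> complex) \<Rightarrow> (real, 'd) vec \<Rightarrow> complex" where
  "autocorr h z = (\<integral>x. h x * cnj (h (x - z)) \<partial>lborel)"

lemma borel_measurable_autocorr [measurable]:
  assumes [measurable]: "h \<in> borel_measurable borel"
  shows "autocorr h \<in> borel_measurable borel"
  unfolding autocorr_def by measurable

text \<open>Integrating in \<open>z\<close> first, the inner integral of the modulus is
  \<open>norm (h x)\<close> times the L1 norm of \<open>h\<close>, which is integrable in
  \<open>x\<close>.\<close>

lemma integrable_autocorr_kernel: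
  fixes h :: "(real, 'd::finite) vec \<Rightarrow> complex"
  assumes h: "integrable lborel h"
  shows "integrable (lborel \<Otimes>\<^sub>M lborel) (\<lambda>(x, z). h x * cnj (h (x - z)))"
proof -
  have [measurable]: "h \<in> borel_measurable borel"
    using h by auto
  have "(\<integral>z. norm (h x * cnj (h (x - z))) \<partial>lborel) = norm (h x) * (\<integral>z. norm (h z) \<partial>lborel)" for x
    using lborel_integral_affine[where c = "-1" and t = x and f = "\<lambda>z. norm (h z)"]
    by (simp add: norm_mult)
  moreover have "integrable lborel (\<lambda>z. h x * cnj (h (x - z)))" for x
    using lborel_integrable_affine[OF h, of "-1" x]
    by (intro integrable_mult_right) simp
  ultimately show ?thesis
    using h by (intro lborel_pair.Fubini_integrable) auto
qed

lemma integrable_autocorr: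
  "integrable lborel h \<Longrightarrow> integrable lborel (autocorr h)"
  unfolding autocorr_def
  by (rule lborel_pair.integrable_snd[OF integrable_autocorr_kernel])

text \<open>The convolution theorem: \<open>echar w z\<close> splits as
  \<open>echar w x * cnj (echar w (x - z))\<close>, after which Fubini separates the two
  integrals.\<close>

lemma ft_autocorr:
  fixes h :: "(real, 'd::finite) vec \<Rightarrow> complex"
  assumes h: "integrable lborel h"
  shows "ft (autocorr h) w = complex_of_real ((cmod (ft h w))\<^sup>2)"
proof -
  have [measurable]: "h \<in> borel_measurable borel"
    using h by auto
  let ?e = "\<lambda>t. echar w t"
  have int: "integrable (lborel \<Otimes>\<^sub>M lborel) (\<lambda>(x, z). h x * cnj (h (x - z)) * ?e z)"
    by (rule Bochner_Integration.integrable_bound[OF integrable_autocorr_kernel[OF h]])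
      (auto simp: norm_mult)
  have in1: "(\<integral>z. h x * cnj (h (x - z)) * ?e z \<partial>lborel) = h x * ?e x * cnj (ft h w)" for x
  proof -
    have "cnj (ft h w) = (\<integral>y. cnj (h y) * cnj (?e y) \<partial>lborel)"
      using Bochner_Integration.integral_cnj[of lborel "\<lambda>t. h t * echar w t"] by (simp only: ft_def complex_cnj_mult)
    also have "\<dots> = (\<integral>z. cnj (h (x - z)) * cnj (?e (x - z)) \<partial>lborel)"
      by (subst lborel_integral_affine[where c = "-1" and t = x]) auto
    finally have "h x * ?e x * cnj (ft h w) = (\<integral>z. h x * ?e x * (cnj (h (x - z)) * cnj (?e (x - z))) \<partial>lborel)"
      by simp
    also have "\<dots> = (\<integral>z. h x * cnj (h (x - z)) * ?e z \<partial>lborel)"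
      by (intro Bochner_Integration.integral_cong refl)
        (simp add: echar_diff_right mult_ac flip: complex_norm_square)
    finally show ?thesis ..
  qed
  have "ft (autocorr h) w = (\<integral>z. (\<integral>x. h x * cnj (h (x - z)) * ?e z \<partial>lborel) \<partial>lborel)"
    unfolding ft_def autocorr_def by simp
  also have "\<dots> = (\<integral>x. (\<integral>z. h x * cnj (h (x - z)) * ?e z \<partial>lborel) \<partial>lborel)"
    by (rule lborel_pair.Fubini_integral[OF int])
  also have "\<dots> = ft h w * cnj (ft h w)"
    unfolding in1 by (simp add: ft_def)
  finally show ?thesis
    by (simp only: complex_norm_square)
qed

text \<open>The multiplication formula: Fubini moves the transform from \<open>r\<close> to the
  dilated Gaussian. The substitution \<open>t = e *\<^sub>R u\<close> then puts the dilation on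
  \<open>r\<close>, leaving a fixed integrable weight for dominated convergence as \<open>e\<close>
  tends to 0.\<close>

lemma integral_ft_gauss:
  fixes r :: "(real, 'd::finite) vec \<Rightarrow> complex"
  assumes r: "integrable lborel r" and e: "e > 0"
  shows "(\<integral>w. ft r w * gauss (e *\<^sub>R w) \<partial>lborel) = (\<integral>u. r (e *\<^sub>R u) * gauss u \<partial>lborel)"
proof -
  have [measurable]: "r \<in> borel_measurable borel"
    using r by auto
  have g_int: "integrable lborel (\<lambda>w::(real, 'd) vec. gauss (e *\<^sub>R w))"
    using lborel_integrable_affine[OF integrable_gauss, of e 0] e by simp
  let ?K = "\<lambda>w t. r t * echar w t * gauss (e *\<^sub>R w)"
  have int: "integrable (lborel \<Otimes>\<^sub>M lborel) (\<lambda>(w, t). ?K w t)"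
  proof (rule lborel_pair.Fubini_integrable)
    show "integrable lborel (\<lambda>w. \<integral>t. norm (case (w, t) of (w, t) \<Rightarrow> ?K w t) \<partial>lborel)"
      using g_int by (simp add: norm_mult gauss_nonneg)
    show "AE w in lborel. integrable lborel (\<lambda>t. case (w, t) of (w, t) \<Rightarrow> ?K w t)"
      using integrable_mult_echar[OF r] by auto
  qed measurable
  \<comment> \<open>The factor \<open>1 / e ^ CARD('d)\<close> is the Jacobian of the dilation; it
    cancels against that of the substitution \<open>t = e *\<^sub>R u\<close>.\<close>
  have in1: "(\<integral>w. ?K w t \<partial>lborel) = r t * ((1 / e ^ CARD('d)) * gauss (t /\<^sub>R e))" for t
  proof -
    have "(\<integral>w. echar w t * gauss (e *\<^sub>R w) \<partial>lborel)
        = (1 / e ^ CARD('d)) *\<^sub>R (\<integral>w. complex_of_real (gauss w) * echar (t /\<^sub>R e) w \<partial>lborel)"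
      using e by (subst lborel_integral_affine[where c = "1/e" and t = 0])
        (auto simp: echar_def inner_commute power_divide power_inverse mult.commute divide_inverse)
    also have "\<dots> = (1 / e ^ CARD('d)) * gauss (t /\<^sub>R e)"
      unfolding gaussian_fourier by (simp add: scaleR_conv_of_real)
    finally show ?thesis
      by (simp add: mult.assoc)
  qed
  have "(\<integral>w. ft r w * gauss (e *\<^sub>R w) \<partial>lborel) = (\<integral>w. (\<integral>t. ?K w t \<partial>lborel) \<partial>lborel)"
    unfolding ft_def by simp
  also have "\<dots> = (\<integral>t. (\<integral>w. ?K w t \<partial>lborel) \<partial>lborel)"
    using lborel_pair.Fubini_integral[OF int] by simp
  also have "\<dots> = (\<integral>t. r t * ((1 / e ^ CARD('d)) * gauss (t /\<^sub>R e)) \<partial>lborel)"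
    unfolding in1 ..
  also have "\<dots> = (\<integral>u. r (e *\<^sub>R u) * gauss u \<partial>lborel)"
  proof -
    have "(\<integral>t. r t * ((1 / e ^ CARD('d)) * gauss (t /\<^sub>R e)) \<partial>lborel)
      = \<bar>e\<bar> ^ DIM((real, 'd) vec) *\<^sub>R (\<integral>u. r (0 + e *\<^sub>R u) * ((1 / e ^ CARD('d)) * gauss ((0 + e *\<^sub>R u) /\<^sub>R e)) \<partial>lborel)"
      using e by (intro lborel_integral_affine) auto
    also have "\<dots> = (\<integral>u. \<bar>e\<bar> ^ DIM((real, 'd) vec) *\<^sub>R (r (0 + e *\<^sub>R u) * ((1 / e ^ CARD('d)) * gauss ((0 + e *\<^sub>R u) /\<^sub>R e))) \<partial>lborel)"
      by (rule integral_scaleR_right[symmetric])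
    also have "\<dots> = (\<integral>u. r (e *\<^sub>R u) * gauss u \<partial>lborel)"
    proof (intro Bochner_Integration.integral_cong refl)
      fix u :: "(real, 'd) vec"
      show "\<bar>e\<bar> ^ DIM((real, 'd) vec) *\<^sub>R (r (0 + e *\<^sub>R u) * ((1 / e ^ CARD('d)) * gauss ((0 + e *\<^sub>R u) /\<^sub>R e)))
        = r (e *\<^sub>R u) * gauss u"
        using e by (simp add: scaleR_conv_of_real[where 'a = complex] divide_simps)
    qed
    finally show ?thesis .
  qed
  finally show ?thesis .
qed

section \<open>Plancherel theorem\<close>

text \<open>Cauchy-Schwarz in the form xy \<le> (x^2 + y^2) / 2, which costs nothing here because
  both factors have the same norm.\<close>

lemma norm_autocorr_le:
  assumes h: "h \<in> L2"
  shows "cmod (autocorr h z) \<le> (l2norm h)\<^sup>2"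
proof -
  note [measurable] = L2_measurable[OF h]
  have int: "integrable lborel (\<lambda>x. (cmod (h x))\<^sup>2)"
    using h by (rule L2_integrable)
  have intz: "integrable lborel (\<lambda>x. (cmod (h (x - z)))\<^sup>2)"
    using lborel_integrable_affine[OF int, of 1 "- z"] by simp
  have eqz: "(\<integral>x. (cmod (h (x - z)))\<^sup>2 \<partial>lborel) = (\<integral>x. (cmod (h x))\<^sup>2 \<partial>lborel)"
    using lborel_integral_affine[where c = 1 and t = "- z" and f = "\<lambda>x. (cmod (h x))\<^sup>2"] by simp
  have pt: "norm (h x * cnj (h (x - z))) \<le> ((cmod (h x))\<^sup>2 + (cmod (h (x - z)))\<^sup>2) / 2" for x
    using sum_squares_bound[of "cmod (h x)" "cmod (h (x - z))"] by (simp add: norm_mult)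
  have "integrable lborel (\<lambda>x. h x * cnj (h (x - z)))"
    by (rule Bochner_Integration.integrable_bound[where f = "\<lambda>x. ((cmod (h x))\<^sup>2 + (cmod (h (x - z)))\<^sup>2) / 2"])
      (use int intz pt in \<open>auto intro!: AE_I2 simp: abs_of_nonneg\<close>)
  then have "cmod (autocorr h z) \<le> (\<integral>x. ((cmod (h x))\<^sup>2 + (cmod (h (x - z)))\<^sup>2) / 2 \<partial>lborel)"
    unfolding autocorr_def using int intz
    by (intro Bochner_Integration.integral_norm_bound_integral pt) auto
  also have "\<dots> = (l2norm h)\<^sup>2"
    using int intz by (simp add: eqz l2norm_power2)
  finally show ?thesis .
qed

lemma autocorr_zero: "autocorr h 0 = complex_of_real ((l2norm h)\<^sup>2)"
proof -
  have "autocorr h 0 = (\<integral>x. complex_of_real ((cmod (h x))\<^sup>2) \<partial>lborel)"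
    unfolding autocorr_def by (intro Bochner_Integration.integral_cong) (auto simp only: complex_norm_square diff_zero)
  then show ?thesis
    by (simp only: integral_complex_of_real l2norm_power2)
qed

text \<open>Membership of \<open>ft h\<close> in L2 is not yet available, but \<open>ft h\<close> is
  bounded since \<open>h\<close> is integrable, so the Gaussian weight makes the left side
  finite.\<close>

lemma integral_ft_square_gauss:
  fixes h :: "(real, 'd::finite) vec \<Rightarrow> complex"
  assumes h1: "integrable lborel h" and h2: "h \<in> L2" and e: "e > 0"
  shows "(\<integral>\<^sup>+w. ennreal ((cmod (ft h w))\<^sup>2 * gauss (e *\<^sub>R w)) \<partial>lborel)
      = ennreal (Re (\<integral>u. autocorr h (e *\<^sub>R u) * gauss u \<partial>lborel))"
proof -
  note [measurable] = L2_measurable[OF h2]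
  have bd: "cmod (ft h w) \<le> (\<integral>t. cmod (h t) \<partial>lborel)" for w
  proof -
    have "cmod (ft h w) \<le> (\<integral>t. cmod (h t * echar w t) \<partial>lborel)"
      unfolding ft_def by (rule integral_norm_bound)
    then show ?thesis
      by (simp add: norm_mult)
  qed
  have g_int: "integrable lborel (\<lambda>w::(real, 'd) vec. gauss (e *\<^sub>R w))"
    using lborel_integrable_affine[OF integrable_gauss, of e 0] e by simp
  have int: "integrable lborel (\<lambda>w. (cmod (ft h w))\<^sup>2 * gauss (e *\<^sub>R w))"
  proof (rule Bochner_Integration.integrable_bound)
    show "integrable lborel (\<lambda>w::(real, 'd) vec. (\<integral>t. cmod (h t) \<partial>lborel)\<^sup>2 * gauss (e *\<^sub>R w))"
      using g_int by simp
    show "AE w in lborel. norm ((cmod (ft h w))\<^sup>2 * gauss (e *\<^sub>R w)) \<le> norm ((\<integral>t. cmod (h t) \<partial>lborel)\<^sup>2 * gauss (e *\<^sub>R w))"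
      using bd by (intro AE_I2) (auto simp: abs_mult gauss_nonneg intro!: mult_right_mono power_mono)
  qed measurable
  have "(\<integral>\<^sup>+w. ennreal ((cmod (ft h w))\<^sup>2 * gauss (e *\<^sub>R w)) \<partial>lborel)
     = ennreal (\<integral>w. (cmod (ft h w))\<^sup>2 * gauss (e *\<^sub>R w) \<partial>lborel)"
    using int by (intro nn_integral_eq_integral) (auto simp: gauss_nonneg)
  also have "(\<integral>w. (cmod (ft h w))\<^sup>2 * gauss (e *\<^sub>R w) \<partial>lborel)
     = Re (\<integral>u. autocorr h (e *\<^sub>R u) * gauss u \<partial>lborel)"
  proof -
    have "complex_of_real (\<integral>w. (cmod (ft h w))\<^sup>2 * gauss (e *\<^sub>R w) \<partial>lborel)
       = (\<integral>w. ft (autocorr h) w * gauss (e *\<^sub>R w) \<partial>lborel)"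
      unfolding ft_autocorr[OF h1] of_real_mult[symmetric] integral_complex_of_real ..
    also have "\<dots> = (\<integral>u. autocorr h (e *\<^sub>R u) * gauss u \<partial>lborel)"
      by (rule integral_ft_gauss[OF integrable_autocorr[OF h1] e])
    finally have "Re (complex_of_real (\<integral>w. (cmod (ft h w))\<^sup>2 * gauss (e *\<^sub>R w) \<partial>lborel))
       = Re (\<integral>u. autocorr h (e *\<^sub>R u) * gauss u \<partial>lborel)"
      by (rule arg_cong)
    then show ?thesis
      unfolding Re_complex_of_real .
  qed
  finally show ?thesis .
qed

lemma integrable_autocorr_gauss:
  fixes h :: "(real, 'd::finite) vec \<Rightarrow> complex"
  assumes h2: "h \<in> L2"
  shows "integrable lborel (\<lambda>u. autocorr h (e *\<^sub>R u) * gauss u)"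
proof (rule Bochner_Integration.integrable_bound)
  note [measurable] = L2_measurable[OF h2]
  show "integrable lborel (\<lambda>u::(real, 'd) vec. (l2norm h)\<^sup>2 * gauss u)"
    by (simp add: integrable_gauss)
  show "AE u in lborel. norm (autocorr h (e *\<^sub>R u) * gauss u) \<le> norm ((l2norm h)\<^sup>2 * gauss u)"
    using norm_autocorr_le[OF h2] by (intro AE_I2) (auto simp: norm_mult gauss_nonneg intro!: mult_right_mono)
  show "(\<lambda>u. autocorr h (e *\<^sub>R u) * gauss u) \<in> borel_measurable lborel"
    by measurable
qed

text \<open>As the dilation tends to 0 the Gaussian weight tends to 1, and Fatou preserves the bound
  that \<open>norm_autocorr_le\<close> gives for every Gaussian average. Holding for all integrable
  L2 functions, the inequality can later carry the equality over from a dense class.\<close>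

lemma Bessel_ft:
  fixes h :: "(real, 'd::finite) vec \<Rightarrow> complex"
  assumes h1: "integrable lborel h" and h2: "h \<in> L2"
  shows ft_L2: "ft h \<in> L2" and l2norm_ft_le: "l2norm (ft h) \<le> l2norm h"
proof -
  note [measurable] = L2_measurable[OF h2]
  let ?e = "\<lambda>n. inverse (real (Suc n))"
  let ?F = "\<lambda>n w. ennreal ((cmod (ft h w))\<^sup>2 * gauss (?e n *\<^sub>R w))"
  have "(\<integral>\<^sup>+w. ennreal ((cmod (ft h w))\<^sup>2) \<partial>lborel) = (\<integral>\<^sup>+w. liminf (\<lambda>n. ?F n w) \<partial>lborel)"
  proof (rule nn_integral_cong)
    fix w :: "(real, 'd) vec"
    have "(\<lambda>n. ?e n *\<^sub>R w) \<longlonglongrightarrow> 0 *\<^sub>R w"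
      by (intro tendsto_scaleR tendsto_const LIMSEQ_inverse_real_of_nat)
    then have "(\<lambda>n. (cmod (ft h w))\<^sup>2 * exp (- pi * (norm (?e n *\<^sub>R w))\<^sup>2)) \<longlonglongrightarrow> (cmod (ft h w))\<^sup>2 * exp (- pi * (norm (0 *\<^sub>R w))\<^sup>2)"
      by (intro tendsto_mult tendsto_const tendsto_exp tendsto_power tendsto_norm)
    then have "(\<lambda>n. ?F n w) \<longlonglongrightarrow> ennreal ((cmod (ft h w))\<^sup>2)"
      unfolding gauss_def by (intro tendsto_ennrealI) simp
    then show "ennreal ((cmod (ft h w))\<^sup>2) = liminf (\<lambda>n. ?F n w)"
      by (intro lim_imp_Liminf[symmetric]) simp_all
  qed
  also have "\<dots> \<le> liminf (\<lambda>n. \<integral>\<^sup>+w. ?F n w \<partial>lborel)"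
    by (rule nn_integral_liminf) measurable
  also have "\<dots> \<le> limsup (\<lambda>n. \<integral>\<^sup>+w. ?F n w \<partial>lborel)"
    by (rule Liminf_le_Limsup) simp
  also have "\<dots> \<le> ennreal ((l2norm h)\<^sup>2)"
  proof (rule Limsup_bounded, intro always_eventually allI)
    fix n
    have "cmod (\<integral>u. autocorr h (?e n *\<^sub>R u) * gauss u \<partial>lborel) \<le> (\<integral>u. (l2norm h)\<^sup>2 * gauss (u::(real, 'd) vec) \<partial>lborel)"
      using norm_autocorr_le[OF h2]
      by (intro Bochner_Integration.integral_norm_bound_integral integrable_autocorr_gauss[OF h2])
        (auto simp: norm_mult gauss_nonneg integrable_gauss intro!: mult_right_mono)
    also have "\<dots> = (l2norm h)\<^sup>2"
      by (simp add: integral_gauss)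
    finally have "Re (\<integral>u. autocorr h (?e n *\<^sub>R u) * gauss u \<partial>lborel) \<le> (l2norm h)\<^sup>2"
      using complex_Re_le_cmod order_trans by blast
    then show "(\<integral>\<^sup>+w. ?F n w \<partial>lborel) \<le> ennreal ((l2norm h)\<^sup>2)"
      by (subst integral_ft_square_gauss[OF h1 h2]) (auto intro: ennreal_leI)
  qed
  finally have "(\<integral>\<^sup>+w. ennreal ((cmod (ft h w))\<^sup>2) \<partial>lborel) \<le> ennreal ((l2norm h)\<^sup>2)" .
  from L2_nn_integralI[OF _ this] show "ft h \<in> L2" "l2norm (ft h) \<le> l2norm h"
    by auto
qed

section \<open>Continuous functions of bounded support and their density\<close>

lemma continuous_support_bounded:
  fixes h :: "'a::euclidean_space \<Rightarrow> complex"
  assumes c: "continuous_on UNIV h" and z: "\<forall>x. norm x > r \<longrightarrow> h x = 0"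
  obtains B where "0 < B" "\<And>x. cmod (h x) \<le> B"
proof -
  have "compact (h ` cball 0 r)"
    using c by (intro compact_continuous_image) (auto intro: continuous_on_subset)
  then obtain B where B: "0 < B" "\<forall>y \<in> h ` cball 0 r. cmod y \<le> B"
    using compact_imp_bounded bounded_pos by metis
  have "cmod (h x) \<le> B" for x
    using B z[rule_format, of x] by (cases "norm x \<le> r") auto
  then show ?thesis using that B by blast
qed

lemma continuous_support_L1_L2:
  fixes h :: "(real, 'd::finite) vec \<Rightarrow> complex"
  assumes c: "continuous_on UNIV h" and z: "\<forall>x. norm x > r \<longrightarrow> h x = 0"
  shows "integrable lborel h" and "h \<in> L2"
proof -
  have [measurable]: "h \<in> borel_measurable borel"
    using c by (rule borel_measurable_continuous_onI)
  have int: "integrable lborel (\<lambda>x::(real, 'd) vec. b * indicator (cball 0 r) x)" for b :: real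
    using emeasure_compact_finite[of "cball (0::(real, 'd) vec) r"] by (auto simp: less_top)
  obtain B where B: "0 < B" "\<And>x. cmod (h x) \<le> B"
    using continuous_support_bounded[OF c z] by blast
  show "integrable lborel h"
    by (rule Bochner_Integration.integrable_bound[OF int[of B]])
      (use B z in \<open>auto simp: indicator_def not_le intro!: AE_I2\<close>)
  have "(cmod (h x))\<^sup>2 \<le> B\<^sup>2" for x
    using B by (intro power_mono) auto
  then have "integrable lborel (\<lambda>x. (cmod (h x))\<^sup>2)"
    by (intro Bochner_Integration.integrable_bound[OF int[of "B\<^sup>2"]])
      (use z in \<open>auto simp: indicator_def not_le intro!: AE_I2\<close>)
  then show "h \<in> L2"
    by (simp add: L2_def)
qed

text \<open>Continuity of \<open>h\<close> lets the autocorrelation tend to its value at 0, so its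
  Gaussian averages tend to the squared norm of \<open>h\<close>; each average is at most the
  squared norm of \<open>ft h\<close> since \<open>gauss\<close> is at most 1.\<close>

lemma Plancherel_continuous:
  fixes h :: "(real, 'd::finite) vec \<Rightarrow> complex"
  assumes c: "continuous_on UNIV h" and z: "\<forall>x. norm x > r \<longrightarrow> h x = 0"
  shows "l2norm (ft h) = l2norm h"
proof (rule antisym)
  note h1 = continuous_support_L1_L2(1)[OF c z] and h2 = continuous_support_L1_L2(2)[OF c z]
  note [measurable] = L2_measurable[OF h2]
  show "l2norm (ft h) \<le> l2norm h"
    by (rule l2norm_ft_le[OF h1 h2])
  obtain B where B: "0 < B" "\<And>x. cmod (h x) \<le> B"
    using continuous_support_bounded[OF c z] by blast
  let ?e = "\<lambda>n. inverse (real (Suc n))"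
  have R: "(\<lambda>n. autocorr h (?e n *\<^sub>R u)) \<longlonglongrightarrow> autocorr h 0" for u
    unfolding autocorr_def
  proof (rule integral_dominated_convergence)
    show "integrable lborel (\<lambda>x. B * cmod (h x))"
      using h1 by simp
    show "AE x in lborel. (\<lambda>n. h x * cnj (h (x - ?e n *\<^sub>R u))) \<longlonglongrightarrow> h x * cnj (h (x - 0))"
    proof (rule AE_I2)
      fix x
      have "(\<lambda>n. x - ?e n *\<^sub>R u) \<longlonglongrightarrow> x - 0 *\<^sub>R u"
        by (intro tendsto_intros LIMSEQ_inverse_real_of_nat)
      then have "(\<lambda>n. h (x - ?e n *\<^sub>R u)) \<longlonglongrightarrow> h (x - 0 *\<^sub>R u)"
        using c continuous_on_tendsto_compose[OF c] by auto
      then show "(\<lambda>n. h x * cnj (h (x - ?e n *\<^sub>R u))) \<longlonglongrightarrow> h x * cnj (h (x - 0))"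
        by (intro tendsto_intros) simp
    qed
    show "AE x in lborel. norm (h x * cnj (h (x - ?e n *\<^sub>R u))) \<le> B * cmod (h x)" for n
      using B by (intro AE_I2) (auto simp: norm_mult mult.commute[of B] intro!: mult_left_mono)
  qed measurable
  have "(\<lambda>n. \<integral>u. autocorr h (?e n *\<^sub>R u) * gauss u \<partial>lborel) \<longlonglongrightarrow> (\<integral>u. autocorr h 0 * gauss (u::(real, 'd) vec) \<partial>lborel)"
  proof (rule integral_dominated_convergence)
    show "integrable lborel (\<lambda>u::(real, 'd) vec. (l2norm h)\<^sup>2 * gauss u)"
      by (simp add: integrable_gauss)
    show "AE u in lborel. (\<lambda>n. autocorr h (?e n *\<^sub>R u) * gauss u) \<longlonglongrightarrow> autocorr h 0 * gauss u"
      by (intro AE_I2 tendsto_intros R)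
    show "AE u in lborel. norm (autocorr h (?e n *\<^sub>R u) * gauss u) \<le> (l2norm h)\<^sup>2 * gauss u" for n
      using norm_autocorr_le[OF h2] by (intro AE_I2) (auto simp: norm_mult gauss_nonneg intro!: mult_right_mono)
  qed measurable
  moreover have "(\<integral>u. autocorr h 0 * gauss (u::(real, 'd) vec) \<partial>lborel) = (l2norm h)\<^sup>2"
    by (simp add: autocorr_zero integral_gauss)
  ultimately have "(\<lambda>n. Re (\<integral>u. autocorr h (?e n *\<^sub>R u) * gauss u \<partial>lborel)) \<longlonglongrightarrow> Re ((l2norm h)\<^sup>2)"
    by (intro tendsto_Re) simp
  moreover have "Re (\<integral>u. autocorr h (?e n *\<^sub>R u) * gauss u \<partial>lborel) \<le> (l2norm (ft h))\<^sup>2" for n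
  proof -
    have "ennreal (Re (\<integral>u. autocorr h (?e n *\<^sub>R u) * gauss u \<partial>lborel))
       \<le> (\<integral>\<^sup>+w. ennreal ((cmod (ft h w))\<^sup>2) \<partial>lborel)"
      by (subst integral_ft_square_gauss[OF h1 h2, symmetric])
        (auto intro!: nn_integral_mono ennreal_leI mult_left_le simp: gauss_le_1)
    then show ?thesis
      unfolding nn_integral_L2[OF ft_L2[OF h1 h2]] by (simp add: ennreal_le_iff)
  qed
  ultimately have "Re ((l2norm h)\<^sup>2) \<le> (l2norm (ft h))\<^sup>2"
    by (intro LIMSEQ_le_const2) auto
  then show "l2norm h \<le> l2norm (ft h)"
    by (intro power2_le_imp_le[of "l2norm h"]) (auto simp flip: of_real_power)
qed

lemma l2norm_dominated_convergence:
  fixes f :: "(real, 'd::finite) vec \<Rightarrow> complex"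
  assumes m: "f \<in> borel_measurable borel" "\<And>n. g n \<in> borel_measurable borel"
    and lim: "AE t in lborel. (\<lambda>n. g n t) \<longlonglongrightarrow> f t"
    and dom: "\<And>n. AE t in lborel. cmod (f t - g n t) \<le> k t"
    and k: "integrable lborel (\<lambda>t. (k t)\<^sup>2)"
  shows "(\<lambda>n. l2norm (\<lambda>t. f t - g n t)) \<longlonglongrightarrow> 0"
proof -
  note [measurable] = m
  have "(\<lambda>n. \<integral>t. (cmod (f t - g n t))\<^sup>2 \<partial>lborel) \<longlonglongrightarrow> (\<integral>t. 0 \<partial>(lborel :: (real, 'd) vec measure))"
  proof (rule integral_dominated_convergence[OF _ _ k])
    show "AE t in lborel. (\<lambda>n. (cmod (f t - g n t))\<^sup>2) \<longlonglongrightarrow> 0"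
      using lim
    proof eventually_elim
      case (elim t)
      have "(\<lambda>n. (cmod (f t - g n t))\<^sup>2) \<longlonglongrightarrow> (cmod (f t - f t))\<^sup>2"
        by (intro tendsto_intros elim)
      then show ?case by simp
    qed
    show "AE t in lborel. norm ((cmod (f t - g n t))\<^sup>2) \<le> (k t)\<^sup>2" for n
      using dom[of n] by eventually_elim (auto intro: power_mono)
  qed measurable
  then show ?thesis
    unfolding l2norm_def using tendsto_real_sqrt by fastforce
qed

text \<open>Almost everywhere approximation by continuous functions comes without domination or
  control of supports. A continuous clamp of the values and a continuous cut-off restore both:
  \<open>h\<close> is first made bounded with bounded support, then the same truncation is applied
  to the continuous approximants.\<close>

lemma continuous_dense_L2:
  fixes h :: "(real, 'd::finite) vec \<Rightarrow> complex"
  assumes h: "h \<in> L2" and e: "e > 0"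
  obtains k r where "continuous_on UNIV k" "\<forall>x. norm x > r \<longrightarrow> k x = 0" "l2norm (\<lambda>t. h t - k t) < e"
proof -
  note [measurable] = L2_measurable[OF h]
  have "h measurable_on UNIV"
    by (rule lebesgue_measurable_imp_measurable_on) (auto intro: measurable_completion)
  then obtain N g where N: "negligible N" and g: "\<And>n. continuous_on UNIV (g n)"
    and lim: "\<And>x. x \<notin> N \<Longrightarrow> (\<lambda>n. g n x) \<longlonglongrightarrow> h x"
    unfolding measurable_on_def by auto
  have [measurable]: "g n \<in> borel_measurable borel" for n
    using g by (rule borel_measurable_continuous_onI)
  have AEN: "AE x in lborel. x \<notin> N"
    using N by (metis AE_completion_iff AE_not_in negligible_iff_null_sets)
  \<comment> \<open>\<open>\<kappa> r\<close> is the radial retraction onto the closed disc of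
    radius \<open>r\<close>; \<open>\<tau> r\<close> is 1 up to radius \<open>r\<close>, 0 beyond
    \<open>r + 1\<close>, and linear in the norm between.\<close>
  define \<kappa> :: "real \<Rightarrow> complex \<Rightarrow> complex" where "\<kappa> r z = (r / max r (cmod z)) *\<^sub>R z" for r z
  define \<tau> :: "real \<Rightarrow> (real, 'd) vec \<Rightarrow> real" where "\<tau> r x = max 0 (min 1 (r + 1 - norm x))" for r x
  have \<kappa>_cont: "continuous_on UNIV (\<kappa> r)" if "r > 0" for r
    unfolding \<kappa>_def using that by (intro continuous_intros) (auto simp: max_def)
  have \<tau>_cont: "continuous_on UNIV (\<tau> r)" for r
    unfolding \<tau>_def by (intro continuous_intros)
  have \<kappa>_le: "cmod (\<kappa> r z) \<le> r" if "r > 0" for r z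
    using that by (auto simp: \<kappa>_def max_def field_simps abs_mult)
  have \<kappa>_id: "\<kappa> r z = z" if "r > 0" "cmod z \<le> r" for r z
    using that by (simp add: \<kappa>_def max_def)
  have \<tau>01: "0 \<le> \<tau> r x" "\<tau> r x \<le> 1" for r x
    by (auto simp: \<tau>_def)
  have \<tau>_id: "\<tau> r x = 1" if "norm x \<le> r" for r x
    using that by (simp add: \<tau>_def)
  have \<tau>_0: "\<tau> r x = 0" if "norm x > r + 1" for r x
    using that by (simp add: \<tau>_def)
  have [measurable]: "\<tau> r \<in> borel_measurable borel" for r
    using \<tau>_cont by (rule borel_measurable_continuous_onI)
  have \<kappa>m: "r > 0 \<Longrightarrow> \<kappa> r \<in> borel_measurable borel" for r
    using \<kappa>_cont by (rule borel_measurable_continuous_onI)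
  have [measurable]: "\<kappa> (real (Suc n)) \<in> borel_measurable borel" for n
    by (rule \<kappa>m) simp
  let ?H = "\<lambda>n x. \<tau> (real (Suc n)) x *\<^sub>R \<kappa> (real (Suc n)) (h x)"
  have "(\<lambda>n. l2norm (\<lambda>t. h t - ?H n t)) \<longlonglongrightarrow> 0"
  proof (rule l2norm_dominated_convergence)
    show "AE t in lborel. (\<lambda>n. ?H n t) \<longlonglongrightarrow> h t"
    proof (rule AE_I2)
      fix t
      obtain m where m: "norm t \<le> real m" "cmod (h t) \<le> real m"
        using real_arch_simple[of "max (norm t) (cmod (h t))"] by auto
      have "?H n t = h t" if "n \<ge> m" for n
      proof -
        have "real m \<le> real (Suc n)" using that by simp
        then show ?thesis
          using m \<kappa>_id[of "real (Suc n)" "h t"] \<tau>_id[of t "real (Suc n)"] by simp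
      qed
      then show "(\<lambda>n. ?H n t) \<longlonglongrightarrow> h t"
        by (intro tendsto_eventually) (auto simp: eventually_sequentially)
    qed
    show "AE t in lborel. cmod (h t - ?H n t) \<le> cmod (h t)" for n
    proof (rule AE_I2)
      fix t
      let ?c = "\<tau> (real (Suc n)) t * (real (Suc n) / max (real (Suc n)) (cmod (h t)))"
      define q where "q = real (Suc n) / max (real (Suc n)) (cmod (h t))"
      have "0 \<le> q" "q \<le> 1"
        by (auto simp: q_def divide_le_eq)
      then have c: "0 \<le> ?c" "?c \<le> 1"
        using \<tau>01[of "real (Suc n)" t] unfolding q_def[symmetric] by (auto intro!: mult_nonneg_nonneg mult_le_one)
      have "h t - ?H n t = (1 - ?c) *\<^sub>R h t"
        by (simp add: \<kappa>_def scaleR_diff_left)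
      then have "cmod (h t - ?H n t) = (1 - ?c) * cmod (h t)"
        using c by simp
      also have "\<dots> \<le> 1 * cmod (h t)"
        using c by (intro mult_right_mono) auto
      finally show "cmod (h t - ?H n t) \<le> cmod (h t)" by simp
    qed
  qed (use L2_integrable[OF h] in measurable)
  then obtain n where n: "l2norm (\<lambda>t. h t - ?H n t) < e / 2"
    using e by (metis (no_types, lifting) LIMSEQ_D abs_of_nonneg diff_zero half_gt_zero l2norm_nonneg order_refl real_norm_def)
  let ?r = "real (Suc n)"
  \<comment> \<open>This is \<open>?H n\<close> with the continuous \<open>g m\<close> in place of
    \<open>h\<close>: continuity of the clamp gives convergence almost everywhere, and
    \<open>2 * ?r\<close> on a ball dominates.\<close>
  let ?G = "\<lambda>m x. \<tau> ?r x *\<^sub>R \<kappa> ?r (g m x)"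
  have r: "?r > 0" by simp
  have Gc: "continuous_on UNIV (?G m)" for m
    using continuous_on_compose2[OF \<kappa>_cont[OF r] g[of m]] \<tau>_cont[of ?r]
    by (intro continuous_on_scaleR) auto
  have G0: "\<forall>x. norm x > ?r + 1 \<longrightarrow> ?G m x = 0" for m
    using \<tau>_0 by simp
  have HL: "?H n \<in> L2"
  proof -
    have i: "integrable lborel (\<lambda>x::(real, 'd) vec. ?r\<^sup>2 * indicator (cball 0 (?r + 1)) x)"
      using emeasure_compact_finite[of "cball (0::(real, 'd) vec) (?r + 1)"] by (auto simp: less_top)
    have b: "(cmod (?H n x))\<^sup>2 \<le> ?r\<^sup>2 * indicator (cball 0 (?r + 1)) x" for x
    proof (cases "norm x > ?r + 1")
      case False
      have "cmod (?H n x) \<le> 1 * ?r"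
        using \<tau>01[of ?r x] \<kappa>_le[OF r, of "h x"] by (auto simp only: norm_scaleR abs_of_nonneg norm_ge_zero intro!: mult_mono)
      then have "(cmod (?H n x))\<^sup>2 \<le> ?r\<^sup>2"
        by (intro power_mono) auto
      then show ?thesis using False by (simp add: indicator_def)
    qed (simp add: \<tau>_0)
    have "integrable lborel (\<lambda>x. (cmod (?H n x))\<^sup>2)"
    proof (rule Bochner_Integration.integrable_bound[OF i])
      show "AE x in lborel. norm ((cmod (?H n x))\<^sup>2) \<le> norm (?r\<^sup>2 * indicat_real (cball 0 (?r + 1)) x)"
        using order_trans[OF b abs_ge_self] by (intro AE_I2) (simp only: real_norm_def abs_of_nonneg[OF zero_le_power2])
    qed measurable
    moreover have "?H n \<in> borel_measurable lborel"
      by measurable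
    ultimately show ?thesis
      unfolding L2_def mem_Collect_eq by blast
  qed
  have "(\<lambda>m. l2norm (\<lambda>t. ?H n t - ?G m t)) \<longlonglongrightarrow> 0"
  proof (rule l2norm_dominated_convergence)
    show "AE t in lborel. (\<lambda>m. ?G m t) \<longlonglongrightarrow> ?H n t"
      using AEN
    proof eventually_elim
      case (elim t)
      then show ?case
        using continuous_on_tendsto_compose[OF \<kappa>_cont[OF r] lim[of t]] by (intro tendsto_intros) auto
    qed
    show "AE t in lborel. cmod (?H n t - ?G m t) \<le> 2 * ?r * indicator (cball 0 (?r + 1)) t" for m
    proof (rule AE_I2)
      fix t :: "(real, 'd) vec"
      show "cmod (?H n t - ?G m t) \<le> 2 * ?r * indicator (cball 0 (?r + 1)) t"
      proof (cases "norm t > ?r + 1")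
        case False
        have "cmod (\<kappa> ?r (h t) - \<kappa> ?r (g m t)) \<le> 2 * ?r"
          using norm_triangle_ineq4[of "\<kappa> ?r (h t)" "\<kappa> ?r (g m t)"] \<kappa>_le[OF r, of "h t"] \<kappa>_le[OF r, of "g m t"] by simp
        then have "\<tau> ?r t * cmod (\<kappa> ?r (h t) - \<kappa> ?r (g m t)) \<le> 1 * (2 * ?r)"
          using \<tau>01[of ?r t] by (intro mult_mono) auto
        moreover have "cmod (?H n t - ?G m t) = \<tau> ?r t * cmod (\<kappa> ?r (h t) - \<kappa> ?r (g m t))"
          using \<tau>01[of ?r t] by (simp only: scaleR_diff_right[symmetric] norm_scaleR abs_of_nonneg)
        ultimately show ?thesis
          using False by (simp add: indicator_def)
      qed (simp add: \<tau>_0)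
    qed
    have "(\<lambda>t::(real, 'd) vec. (2 * ?r * indicator (cball 0 (?r + 1)) t)\<^sup>2) = (\<lambda>t. (2 * ?r)\<^sup>2 * indicator (cball 0 (?r + 1)) t)"
      by (auto simp: indicator_def)
    then show "integrable lborel (\<lambda>t::(real, 'd) vec. (2 * ?r * indicator (cball 0 (?r + 1)) t)\<^sup>2)"
      using emeasure_compact_finite[of "cball (0::(real, 'd) vec) (?r + 1)"] by (auto simp: less_top)
  qed measurable
  then obtain m where m: "l2norm (\<lambda>t. ?H n t - ?G m t) < e / 2"
    using e by (metis (no_types, lifting) LIMSEQ_D abs_of_nonneg diff_zero half_gt_zero l2norm_nonneg order_refl real_norm_def)
  have "l2norm (\<lambda>t. h t - ?G m t) < e"
    using l2norm_diff_triangle[OF h HL continuous_support_L1_L2(2)[OF Gc G0], of m] n m by linarith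
  then show ?thesis
    using that[OF Gc G0] by blast
qed

text \<open>\<open>l2norm_ft_le\<close> for the difference shows that both norms move by less than
  e/2 when \<open>h\<close> is replaced by a nearby \<open>k\<close>, for which they agree.\<close>

theorem Plancherel:
  fixes h :: "(real, 'd::finite) vec \<Rightarrow> complex"
  assumes h1: "integrable lborel h" and h2: "h \<in> L2"
  shows "l2norm (ft h) = l2norm h"
proof (rule antisym)
  show "l2norm (ft h) \<le> l2norm h"
    by (rule l2norm_ft_le[OF h1 h2])
  show "l2norm h \<le> l2norm (ft h)"
  proof (rule field_le_epsilon)
    fix e :: real assume "e > 0"
    then obtain k r where k: "continuous_on UNIV k" "\<forall>x. norm x > r \<longrightarrow> k x = 0" "l2norm (\<lambda>t. h t - k t) < e / 2"
      using continuous_dense_L2[OF h2, of "e/2"] by auto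
    note k1 = continuous_support_L1_L2(1)[OF k(1,2)] and k2 = continuous_support_L1_L2(2)[OF k(1,2)]
    have d1: "integrable lborel (\<lambda>t. h t - k t)" and d2: "(\<lambda>t. h t - k t) \<in> L2"
      using h1 k1 h2 k2 by (auto intro: L2_diff)
    have "l2norm (\<lambda>w. ft h w - ft k w) \<le> l2norm (\<lambda>t. h t - k t)"
      using l2norm_ft_le[OF d1 d2] unfolding ft_diff[OF h1 k1, THEN ext] .
    moreover have "\<bar>l2norm (ft h) - l2norm (ft k)\<bar> \<le> l2norm (\<lambda>w. ft h w - ft k w)"
      by (rule l2norm_diff_abs[OF ft_L2[OF h1 h2] ft_L2[OF k1 k2]])
    moreover have "\<bar>l2norm h - l2norm k\<bar> \<le> l2norm (\<lambda>w. h w - k w)"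
      by (rule l2norm_diff_abs[OF h2 k2])
    moreover have "l2norm (ft k) = l2norm k"
      by (rule Plancherel_continuous[OF k(1,2)])
    ultimately show "l2norm h \<le> l2norm (ft h) + e"
      using k(3) by linarith
  qed
qed

section \<open>Translates and trigonometric polynomials\<close>

lemma L2_transl: "h \<in> L2 \<Longrightarrow> (\<lambda>t. h (t - l)) \<in> L2"
  and l2norm_transl: "h \<in> L2 \<Longrightarrow> l2norm (\<lambda>t. h (t - l)) = l2norm h"
proof -
  assume h: "h \<in> L2"
  note [measurable] = L2_measurable[OF h]
  have "(\<integral>\<^sup>+t. ennreal ((cmod (h (t - l)))\<^sup>2) \<partial>lborel) = ennreal ((l2norm h)\<^sup>2)"
    using nn_integral_L2[OF h] nn_integral_lborel_translate_diff[of "\<lambda>t. ennreal ((cmod (h t))\<^sup>2)" l] by simp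
  from L2_nn_integral_eqI[OF _ this]
  show "(\<lambda>t. h (t - l)) \<in> L2" "l2norm (\<lambda>t. h (t - l)) = l2norm h"
    by auto
qed

lemma L2_sum_transl: "h \<in> L2 \<Longrightarrow> (\<lambda>t. \<Sum>l\<in>F. a l * h (t - l)) \<in> L2"
  by (intro L2_sum L2_scale L2_transl)

lemma l2norm_sum_le:
  assumes "\<And>i. i \<in> I \<Longrightarrow> f i \<in> L2"
  shows "l2norm (\<lambda>t. \<Sum>i\<in>I. f i t) \<le> (\<Sum>i\<in>I. l2norm (f i))"
  using assms
proof (induction I rule: infinite_finite_induct)
  case (insert i I)
  then have "l2norm (\<lambda>t. f i t + (\<Sum>i\<in>I. f i t)) \<le> l2norm (f i) + l2norm (\<lambda>t. \<Sum>i\<in>I. f i t)"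
    by (intro l2norm_triangle L2_sum) auto
  then show ?case
    using insert by fastforce
qed (simp_all add: l2norm_def)

lemma l2norm_sum_transl_le:
  assumes "h \<in> L2"
  shows "l2norm (\<lambda>t. \<Sum>l\<in>F. a l * h (t - l)) \<le> (\<Sum>l\<in>F. cmod (a l)) * l2norm h"
  using l2norm_sum_le[of F "\<lambda>l t. a l * h (t - l)"] assms
  by (simp add: L2_scale L2_transl l2norm_scale l2norm_transl sum_distrib_right)

lemma L2_mult_bounded:
  assumes h: "h \<in> L2" and [measurable]: "p \<in> borel_measurable borel" and p: "\<And>t. cmod (p t) \<le> C"
  shows "(\<lambda>t. p t * h t) \<in> L2" and "l2norm (\<lambda>t. p t * h t) \<le> C * l2norm h"
proof -
  note [measurable] = L2_measurable[OF h]
  have C: "0 \<le> C"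
    using order_trans[OF norm_ge_zero p] .
  have "(\<integral>\<^sup>+t. ennreal ((cmod (p t * h t))\<^sup>2) \<partial>lborel) \<le> (\<integral>\<^sup>+t. ennreal (C\<^sup>2) * ennreal ((cmod (h t))\<^sup>2) \<partial>lborel)"
    using p C by (intro nn_integral_mono)
      (auto simp: norm_mult power_mult_distrib ennreal_mult[symmetric] intro!: ennreal_leI mult_right_mono power_mono)
  also have "\<dots> = ennreal ((C * l2norm h)\<^sup>2)"
    by (subst nn_integral_cmult) (auto simp: nn_integral_L2[OF h] power_mult_distrib ennreal_mult)
  finally show "(\<lambda>t. p t * h t) \<in> L2" "l2norm (\<lambda>t. p t * h t) \<le> C * l2norm h"
    using L2_nn_integralI[of "\<lambda>t. p t * h t" "C * l2norm h"] C by auto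
qed

section \<open>Truncations and the L2 Fourier transform\<close>

definition trunc :: "((real, 'd::finite) vec \<Rightarrow> complex) \<Rightarrow> nat \<Rightarrow> (real, 'd) vec \<Rightarrow> complex" where
  "trunc \<psi> n t = indicator (ball 0 (real n)) t * \<psi> t"

lemma ft_trunc_eq: "ft_trunc \<psi> (real n) = ft (trunc \<psi> n)"
  by (simp add: ft_trunc_def ft_def trunc_def echar_def fun_eq_iff)

lemma
  fixes \<psi> :: "(real, 'd::finite) vec \<Rightarrow> complex"
  assumes \<psi>: "\<psi> \<in> L2"
  shows trunc_L2: "trunc \<psi> n \<in> L2"
    and integrable_trunc: "integrable lborel (trunc \<psi> n)"
    and trunc_tendsto: "(\<lambda>n. l2norm (\<lambda>t. \<psi> t - trunc \<psi> n t)) \<longlonglongrightarrow> 0"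
proof -
  note [measurable] = L2_measurable[OF \<psi>]
  have [measurable]: "ball (0::(real, 'd) vec) r \<in> sets borel" for r
    by simp
  have m: "trunc \<psi> k \<in> borel_measurable borel" for k
  proof -
    have "(\<lambda>t. indicator (ball 0 (real k)) t * \<psi> t) \<in> borel_measurable borel"
      by measurable
    then show ?thesis
      by (simp add: trunc_def[abs_def])
  qed
  note [measurable] = m
  show L: "trunc \<psi> n \<in> L2"
    unfolding trunc_def
  proof (rule L2_mult_bounded(1)[OF \<psi>])
    show "cmod (indicator (ball 0 (real n)) t) \<le> 1" for t :: "(real, 'd) vec"
      by (simp add: indicator_def)
  qed measurable
  have i: "integrable lborel (\<lambda>t. indicat_real (ball 0 (real n)) t + (cmod (\<psi> t))\<^sup>2)"
    using L2_integrable[OF \<psi>] emeasure_bounded_finite[of "ball (0::(real, 'd) vec) (real n)"]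
    by (intro Bochner_Integration.integrable_add) (auto simp: less_top)
  show "integrable lborel (trunc \<psi> n)"
  proof (rule Bochner_Integration.integrable_bound[OF i])
    \<comment> \<open>On a ball, which has finite measure, this makes square-integrable functions
      integrable.\<close>
    have "x \<le> 1 + x\<^sup>2" if "x \<ge> 0" for x :: real
      using zero_le_power2[of "x - 1"] that by (simp add: power2_diff)
    then show "AE t in lborel. norm (trunc \<psi> n t) \<le> norm (indicat_real (ball 0 (real n)) t + (cmod (\<psi> t))\<^sup>2)"
      by (intro AE_I2) (auto simp: trunc_def indicator_def)
  qed measurable
  show "(\<lambda>n. l2norm (\<lambda>t. \<psi> t - trunc \<psi> n t)) \<longlonglongrightarrow> 0"
  proof (rule l2norm_dominated_convergence[OF L2_measurable[OF \<psi>] m _ _ L2_integrable[OF \<psi>]])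
    show "AE t in lborel. (\<lambda>n. trunc \<psi> n t) \<longlonglongrightarrow> \<psi> t"
    proof (rule AE_I2)
      fix t :: "(real, 'd) vec"
      obtain k :: nat where k: "norm t < real k"
        using reals_Archimedean2 by blast
      have "trunc \<psi> n t = \<psi> t" if "n \<ge> k" for n
      proof -
        have "norm t < real n" using k that by (meson less_le_trans of_nat_le_iff)
        then show ?thesis by (simp add: trunc_def)
      qed
      then show "(\<lambda>n. trunc \<psi> n t) \<longlonglongrightarrow> \<psi> t"
        by (intro tendsto_eventually) (auto simp: eventually_sequentially)
    qed
    show "AE t in lborel. cmod (\<psi> t - trunc \<psi> n t) \<le> cmod (\<psi> t)" for n
      by (intro AE_I2) (auto simp: trunc_def indicator_def)
  qed
qed

text \<open>By Plancherel the transforms of the truncations are Cauchy. Existence matters for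
  finitely supported \<open>c\<close>, where no transform of \<psi> is provided.\<close>

lemma L2_fourier_exists:
  assumes \<psi>: "\<psi> \<in> L2"
  shows "\<exists>g. is_L2_fourier \<psi> g"
proof -
  note L = trunc_L2[OF \<psi>] and I = integrable_trunc[OF \<psi>]
  have "\<exists>g\<in>L2. (\<lambda>n. l2norm (\<lambda>w. g w - ft (trunc \<psi> n) w)) \<longlonglongrightarrow> 0"
  proof (rule L2_complete)
    show "ft (trunc \<psi> n) \<in> L2" for n
      by (rule ft_L2[OF I L])
    fix e :: real assume "e > 0"
    then have "\<forall>\<^sub>F n in sequentially. l2norm (\<lambda>t. \<psi> t - trunc \<psi> n t) < e / 2"
      by (intro order_tendstoD[OF trunc_tendsto[OF \<psi>]]) auto
    then obtain N where N: "\<And>n. n \<ge> N \<Longrightarrow> l2norm (\<lambda>t. \<psi> t - trunc \<psi> n t) < e / 2"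
      by (auto simp: eventually_sequentially)
    have "l2norm (\<lambda>w. ft (trunc \<psi> m) w - ft (trunc \<psi> n) w) < e" if "m \<ge> N" "n \<ge> N" for m n
    proof -
      have "l2norm (\<lambda>w. ft (trunc \<psi> m) w - ft (trunc \<psi> n) w) = l2norm (\<lambda>t. trunc \<psi> m t - trunc \<psi> n t)"
        using Plancherel[of "\<lambda>t. trunc \<psi> m t - trunc \<psi> n t"] L I
        unfolding ft_diff[OF I I, THEN ext] by (simp add: L2_diff)
      also have "\<dots> \<le> l2norm (\<lambda>t. trunc \<psi> m t - \<psi> t) + l2norm (\<lambda>t. \<psi> t - trunc \<psi> n t)"
        by (rule l2norm_diff_triangle[OF L \<psi> L])
      also have "\<dots> < e"
        using N[OF that(1)] N[OF that(2)] l2norm_minus_commute[of "trunc \<psi> m" \<psi>] by simp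
      finally show ?thesis .
    qed
    then show "\<exists>N. \<forall>m\<ge>N. \<forall>n\<ge>N. l2norm (\<lambda>w. ft (trunc \<psi> m) w - ft (trunc \<psi> n) w) < e"
      by blast
  qed
  then show ?thesis
    by (auto simp: is_L2_fourier_def ft_trunc_eq)
qed

section \<open>Trigonometric polynomials and their zeros\<close>

definition trigpoly :: "(real, 'd::finite) vec set \<Rightarrow> ((real, 'd) vec \<Rightarrow> complex) \<Rightarrow> (real, 'd) vec \<Rightarrow> complex" where
  "trigpoly F a w = (\<Sum>l\<in>F. a l * echar w l)"

lemma borel_measurable_trigpoly [measurable]: "trigpoly F a \<in> borel_measurable borel"
  unfolding trigpoly_def by measurable

lemma norm_trigpoly_le: "cmod (trigpoly F a w) \<le> (\<Sum>l\<in>F. cmod (a l))"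
  unfolding trigpoly_def by (rule order_trans[OF norm_sum]) (simp add: norm_mult)

text \<open>For truncations this is Plancherel. Both sides are Lipschitz in the function, with
  constant the sum of the moduli of the coefficients, so it survives the limit.\<close>

lemma l2norm_sum_transl:
  fixes \<psi> :: "(real, 'd::finite) vec \<Rightarrow> complex"
  assumes \<psi>: "\<psi> \<in> L2" and g: "is_L2_fourier \<psi> g" and F: "finite F"
  shows "l2norm (\<lambda>t. \<Sum>l\<in>F. a l * \<psi> (t - l)) = l2norm (\<lambda>w. trigpoly F a w * g w)"
proof -
  note L = trunc_L2[OF \<psi>] and I = integrable_trunc[OF \<psi>]
  have gL: "g \<in> L2" and glim: "(\<lambda>n. l2norm (\<lambda>w. g w - ft (trunc \<psi> n) w)) \<longlonglongrightarrow> 0"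
    using g by (auto simp: is_L2_fourier_def ft_trunc_eq)
  let ?C = "\<Sum>l\<in>F. cmod (a l)"
  let ?S = "\<lambda>h t. \<Sum>l\<in>F. a l * h (t - l)" and ?P = "\<lambda>h w. trigpoly F a w * h w"
  have sint: "integrable lborel (?S (trunc \<psi> n))" for n
  proof (intro Bochner_Integration.integrable_sum Bochner_Integration.integrable_mult_right)
    show "integrable lborel (\<lambda>t. trunc \<psi> n (t - l))" for l
      using lborel_integrable_affine[OF I[of n], of 1 "- l"] by simp
  qed
  have PL: "h \<in> L2 \<Longrightarrow> ?P h \<in> L2" "h \<in> L2 \<Longrightarrow> l2norm (?P h) \<le> ?C * l2norm h" for h
    by (rule L2_mult_bounded[OF _ borel_measurable_trigpoly norm_trigpoly_le]; simp)+
  have "(\<lambda>n. l2norm (?S (trunc \<psi> n))) \<longlonglongrightarrow> l2norm (?S \<psi>)"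
  proof (rule l2norm_tendsto)
    show "(\<lambda>n. l2norm (\<lambda>t. ?S \<psi> t - ?S (trunc \<psi> n) t)) \<longlonglongrightarrow> 0"
    proof (rule Lim_null_comparison)
      show "(\<lambda>n. ?C * l2norm (\<lambda>t. \<psi> t - trunc \<psi> n t)) \<longlonglongrightarrow> 0"
        using tendsto_mult_right_zero[OF trunc_tendsto[OF \<psi>]] .
      show "\<forall>\<^sub>F n in sequentially. norm (l2norm (\<lambda>t. ?S \<psi> t - ?S (trunc \<psi> n) t)) \<le> ?C * l2norm (\<lambda>t. \<psi> t - trunc \<psi> n t)"
        using l2norm_sum_transl_le[where F = F and a = a, OF L2_diff[OF \<psi> L]]
        by (intro always_eventually allI) (simp add: sum_subtractf right_diff_distrib)
    qed
  qed (use \<psi> L in \<open>auto intro: L2_sum_transl\<close>)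
  moreover have "l2norm (?S (trunc \<psi> n)) = l2norm (?P (ft (trunc \<psi> n)))" for n
    using Plancherel[OF sint L2_sum_transl[OF L], of n]
    unfolding ft_sum_transl[OF I F, THEN ext] trigpoly_def by simp
  moreover have "(\<lambda>n. l2norm (?P (ft (trunc \<psi> n)))) \<longlonglongrightarrow> l2norm (?P g)"
  proof (rule l2norm_tendsto)
    show "(\<lambda>n. l2norm (\<lambda>w. ?P g w - ?P (ft (trunc \<psi> n)) w)) \<longlonglongrightarrow> 0"
    proof (rule Lim_null_comparison)
      show "(\<lambda>n. ?C * l2norm (\<lambda>w. g w - ft (trunc \<psi> n) w)) \<longlonglongrightarrow> 0"
        using tendsto_mult_right_zero[OF glim] .
      show "\<forall>\<^sub>F n in sequentially. norm (l2norm (\<lambda>w. ?P g w - ?P (ft (trunc \<psi> n)) w)) \<le> ?C * l2norm (\<lambda>w. g w - ft (trunc \<psi> n) w)"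
        using PL(2)[OF L2_diff[OF gL ft_L2[OF I L]]]
        by (intro always_eventually allI) (simp add: right_diff_distrib)
    qed
  qed (auto intro!: PL gL ft_L2 I L)
  ultimately show ?thesis
    by (simp add: LIMSEQ_unique)
qed

text \<open>Multiplying by \<open>exp (- \<theta> x * s)\<close> makes one term constant, and
  differentiation removes it. The other coefficients acquire nonzero factors
  \<open>\<theta> l - \<theta> x\<close>, and these new frequencies stay distinct; hence the
  induction over arbitrary \<open>b\<close> and \<open>\<theta>\<close>.\<close>

lemma exp_sum_eq_0_imp:
  fixes \<theta> b :: "'i \<Rightarrow> complex"
  assumes "finite F" "inj_on \<theta> F" "\<And>s. (\<Sum>l\<in>F. b l * exp (\<theta> l * s)) = 0"
  shows "\<forall>l\<in>F. b l = 0"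
  using assms
proof (induction F arbitrary: b \<theta> rule: finite_induct)
  case (insert x F)
  let ?h = "\<lambda>s. b x + (\<Sum>l\<in>F. b l * exp ((\<theta> l - \<theta> x) * s))"
  have h0: "?h s = 0" for s
  proof -
    have e: "exp ((\<theta> l - \<theta> x) * s) = exp (- \<theta> x * s) * exp (\<theta> l * s)" for l
      by (simp add: mult_exp_exp left_diff_distrib)
    have "?h s = (\<Sum>l\<in>insert x F. b l * exp ((\<theta> l - \<theta> x) * s))"
      using insert.hyps by simp
    also have "\<dots> = exp (- \<theta> x * s) * (\<Sum>l\<in>insert x F. b l * exp (\<theta> l * s))"
      unfolding e sum_distrib_left by (intro sum.cong refl) (simp only: mult.left_commute)
    finally have "?h s = exp (- \<theta> x * s) * (\<Sum>l\<in>insert x F. b l * exp (\<theta> l * s))" .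
    then show ?thesis
      using insert.prems(2) by simp
  qed
  have "(\<Sum>l\<in>F. (b l * (\<theta> l - \<theta> x)) * exp ((\<theta> l - \<theta> x) * s)) = 0" for s
  proof -
    have "(?h has_field_derivative (\<Sum>l\<in>F. (b l * (\<theta> l - \<theta> x)) * exp ((\<theta> l - \<theta> x) * s))) (at s)"
      by (auto intro!: derivative_eq_intros sum.cong)
    moreover have "(?h has_field_derivative 0) (at s)"
      unfolding h0 by simp
    ultimately show ?thesis
      by (rule DERIV_unique)
  qed
  then have "\<forall>l\<in>F. b l * (\<theta> l - \<theta> x) = 0"
    using insert.prems(1) by (intro insert.IH[of "\<lambda>l. \<theta> l - \<theta> x"]) (auto simp: inj_on_def)
  moreover have "\<theta> l \<noteq> \<theta> x" if "l \<in> F" for l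
    using inj_onD[OF insert.prems(1), of l x] insert.hyps that by auto
  ultimately have "\<forall>l\<in>F. b l = 0"
    by auto
  then show ?case
    using h0[of 0] by simp
qed simp

text \<open>The sum extends to an entire function of \<open>s\<close>, whose zeros are countable
  unless it is constant; a constant sum is nonzero by \<open>exp_sum_eq_0_imp\<close>.\<close>

lemma countable_real_zeros_exp_sum:
  fixes b :: "'i \<Rightarrow> complex" and \<theta> :: "'i \<Rightarrow> complex"
  assumes F: "finite F" "inj_on \<theta> F" and l: "l \<in> F" "b l \<noteq> 0"
  shows "countable {s::real. (\<Sum>l\<in>F. b l * exp (\<theta> l * s)) = 0}"
proof -
  let ?f = "\<lambda>s. \<Sum>l\<in>F. b l * exp (\<theta> l * s)"
  have "countable {s. ?f s = 0}"
  proof (cases "?f constant_on UNIV")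
    case True
    then obtain k where "\<And>s. ?f s = k"
      by (auto simp: constant_on_def)
    moreover have "\<exists>s. ?f s \<noteq> 0"
      using exp_sum_eq_0_imp[OF F, of b] l by blast
    ultimately show ?thesis
      by simp
  next
    case False
    moreover have "?f holomorphic_on UNIV"
      by (intro holomorphic_intros)
    ultimately show ?thesis
      using holomorphic_countable_zeros[of ?f UNIV] by (simp add: connected_UNIV)
  qed
  then have "countable (complex_of_real ` {s::real. ?f s = 0})"
    by (rule countable_subset[rotated]) auto
  then show ?thesis
    by (rule countable_image_inj_on) (simp add: inj_on_def)
qed

text \<open>A finite union of hyperplanes is negligible, hence not the whole space. Restricted to a
  line in such a direction, different frequencies stay different.\<close>

lemma separating_direction:
  fixes F :: "'a::euclidean_space set"
  assumes "finite F"
  shows "\<exists>v. inj_on (\<lambda>l. v \<bullet> l) F"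
proof -
  let ?N = "\<Union>(l, m) \<in> {(l, m). l \<in> F \<and> m \<in> F \<and> l \<noteq> m}. {x. (l - m) \<bullet> x = 0}"
  have "finite {(l, m). l \<in> F \<and> m \<in> F \<and> l \<noteq> m}"
    by (rule finite_subset[of _ "F \<times> F"]) (use assms in auto)
  then have "negligible ?N"
    by (intro negligible_Union) (auto intro!: negligible_hyperplane)
  then have "?N \<noteq> UNIV"
    using non_negligible_UNIV by metis
  then obtain v where "v \<notin> ?N"
    by blast
  then show ?thesis
    by (intro exI[of _ v] inj_onI) (auto simp: inner_diff_left inner_commute[of v])
qed

text \<open>Along a direction that separates the frequencies, every line meets the zero set in a
  countable set; averaging over translates of the zero set along that direction gives the claim.\<close>
lemma trigpoly_nonzero_AE:
  fixes F :: "(real, 'd::finite) vec set"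
  assumes F: "finite F" and l: "l \<in> F" "a l \<noteq> 0"
  shows "AE w in lborel. trigpoly F a w \<noteq> 0"
proof -
  obtain v where v: "inj_on (\<lambda>l. v \<bullet> l) F"
    using separating_direction[OF F] by blast
  define Z where "Z = {w. trigpoly F a w = 0}"
  have [measurable]: "Z \<in> sets borel"
    unfolding Z_def by measurable
  have "countable {s::real. w + s *\<^sub>R v \<in> Z}" for w
  proof -
    have "trigpoly F a (w + s *\<^sub>R v) = (\<Sum>l\<in>F. (a l * echar w l) * exp (complex_of_real (- 2 * pi * (v \<bullet> l)) * \<i> * s))" for s
      unfolding trigpoly_def echar_add_left by (intro sum.cong refl) (simp add: echar_def cis_conv_exp mult_ac)
    moreover have "inj_on (\<lambda>l. complex_of_real (- 2 * pi * (v \<bullet> l)) * \<i>) F"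
      using v by (auto simp: inj_on_def)
    ultimately show ?thesis
      using countable_real_zeros_exp_sum[OF F _ l(1), of "\<lambda>l. complex_of_real (- 2 * pi * (v \<bullet> l)) * \<i>" "\<lambda>l. a l * echar w l"] l(2)
      by (simp add: Z_def)
  qed
  then have null: "{s::real. w + s *\<^sub>R v \<in> Z} \<in> null_sets lborel" for w
    by (rule countable_imp_null_set_lborel)
  \<comment> \<open>\<open>{0..1}\<close> has mass 1 and every translate of \<open>Z\<close> has the
    measure of \<open>Z\<close>; after the exchange the inner integral runs over a countable set of
    \<open>s\<close>.\<close>
  have "emeasure lborel Z = (\<integral>\<^sup>+s. indicator {0..1::real} s * emeasure lborel Z \<partial>lborel)"
    by (subst nn_integral_multc) auto
  also have "\<dots> = (\<integral>\<^sup>+s. (\<integral>\<^sup>+w. indicator {0..1::real} s * indicator Z (w + s *\<^sub>R v) \<partial>lborel) \<partial>lborel)"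
    by (intro nn_integral_cong, subst nn_integral_cmult)
      (auto simp: nn_integral_lborel_translate[of "indicator Z"])
  also have "\<dots> = (\<integral>\<^sup>+w. (\<integral>\<^sup>+s. indicator {0..1::real} s * indicator Z (w + s *\<^sub>R v) \<partial>lborel) \<partial>lborel)"
    by (rule lborel_pair.Fubini'[symmetric]) measurable
  also have "\<dots> = (\<integral>\<^sup>+w. 0 \<partial>(lborel :: (real, 'd) vec measure))"
  proof (rule nn_integral_cong)
    fix w
    have "(\<integral>\<^sup>+s. indicator {0..1::real} s * indicator Z (w + s *\<^sub>R v) \<partial>lborel) = (\<integral>\<^sup>+s. 0 \<partial>(lborel :: real measure))"
      by (intro nn_integral_cong_AE, rule AE_mp[OF AE_not_in[OF null[of w]]]) (auto simp: indicator_def)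
    then show "(\<integral>\<^sup>+s. indicator {0..1::real} s * indicator Z (w + s *\<^sub>R v) \<partial>lborel) = 0"
      by simp
  qed
  finally have "Z \<in> null_sets lborel"
    by (auto simp: null_sets_def)
  from AE_not_in[OF this] show ?thesis
    by (simp add: Z_def)
qed

lemma finite_translates_independent:
  fixes \<psi> :: "(real, 'd::finite) vec \<Rightarrow> complex"
  assumes \<psi>: "\<psi> \<in> L2" "l2norm \<psi> \<noteq> 0" and F: "finite F"
    and 0: "l2norm (\<lambda>t. \<Sum>l\<in>F. a l * \<psi> (t - l)) = 0"
  shows "\<forall>l\<in>F. a l = 0"
proof (rule ccontr)
  assume "\<not> ?thesis"
  then obtain l where l: "l \<in> F" "a l \<noteq> 0"
    by blast
  obtain g where g: "is_L2_fourier \<psi> g"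
    using L2_fourier_exists[OF \<psi>(1)] by blast
  have gL: "g \<in> L2"
    using g by (simp add: is_L2_fourier_def)
  have P: "(\<lambda>w. trigpoly F a w * g w) \<in> L2"
    by (rule L2_mult_bounded(1)[OF gL borel_measurable_trigpoly norm_trigpoly_le])
  have "AE w in lborel. trigpoly F a w * g w = 0"
    using 0 l2norm_eq_0_iff[OF P] unfolding l2norm_sum_transl[OF \<psi>(1) g F] ae_eq_def by simp
  with trigpoly_nonzero_AE[of F l a, OF F l] have "AE w in lborel. g w = 0"
    by eventually_elim simp
  then have "l2norm g = 0"
    using l2norm_eq_0_iff[OF gL] by (simp add: ae_eq_def)
  \<comment> \<open>The single translate by 0 with coefficient 1 gives Plancherel for \<psi>
    itself.\<close>
  moreover have "l2norm \<psi> = l2norm g"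
    using l2norm_sum_transl[OF \<psi>(1) g, of "{0}" "\<lambda>_. 1"] by (simp add: trigpoly_def)
  ultimately show False
    using \<psi>(2) by simp
qed

section \<open>Lattices and Riesz bounds\<close>

text \<open>As a simp rule it would turn \<open>transpose M *v x\<close> into \<open>x v* M\<close>
  and hide the form in which the cell and the dual lattice are described below.\<close>

declare transpose_matrix_vector [simp del]

lemma matrix_inv_transpose:
  fixes M :: "((real, 'd::finite) vec, 'd) vec"
  assumes "invertible M"
  shows "transpose M ** matrix_inv (transpose M) = mat 1" "matrix_inv (transpose M) ** transpose M = mat 1"
proof -
  have "\<exists>B. transpose M ** B = mat 1 \<and> B ** transpose M = mat 1"
    using transpose_invertible[OF assms] by (simp add: invertible_def)
  then have "transpose M ** matrix_inv (transpose M) = mat 1 \<and> matrix_inv (transpose M) ** transpose M = mat 1"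
    unfolding matrix_inv_def by (rule someI_ex)
  then show "transpose M ** matrix_inv (transpose M) = mat 1" "matrix_inv (transpose M) ** transpose M = mat 1"
    by auto
qed

text \<open>In the coordinates given by \<open>transpose M\<close> the dual lattice is the integer
  lattice and the half-open cell is the unit cube; the tiling is proved there.\<close>

lemma mem_dual_lattice_iff:
  assumes "invertible M"
  shows "\<gamma> \<in> dual_lattice M \<longleftrightarrow> transpose M *v \<gamma> \<in> intvecs"
proof
  assume "\<gamma> \<in> dual_lattice M"
  then obtain k where k: "k \<in> intvecs" "\<gamma> = matrix_inv (transpose M) *v k"
    by (auto simp: dual_lattice_def lattice_of_def)
  then show "transpose M *v \<gamma> \<in> intvecs"
    by (simp add: matrix_vector_mul_assoc matrix_inv_transpose[OF assms])
next
  assume "transpose M *v \<gamma> \<in> intvecs"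
  moreover have "\<gamma> = matrix_inv (transpose M) *v (transpose M *v \<gamma>)"
    by (simp add: matrix_vector_mul_assoc matrix_inv_transpose[OF assms])
  ultimately show "\<gamma> \<in> dual_lattice M"
    unfolding dual_lattice_def lattice_of_def by blast
qed

lemma countable_intvecs: "countable (intvecs :: (real, 'd::finite) vec set)"
proof -
  have "intvecs \<subseteq> range (\<lambda>f::'d \<Rightarrow> int. \<chi> i. real_of_int (f i))"
  proof
    fix k :: "(real, 'd) vec" assume "k \<in> intvecs"
    then have "\<forall>i. \<exists>z. k $ i = real_of_int z"
      by (auto simp: intvecs_def Ints_def)
    then obtain f where "\<forall>i. k $ i = real_of_int (f i)"
      by metis
    then have "k = (\<chi> i. real_of_int (f i))"
      by (simp add: vec_eq_iff)
    then show "k \<in> range (\<lambda>f::'d \<Rightarrow> int. \<chi> i. real_of_int (f i))"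
      by blast
  qed
  then show ?thesis
    by (rule countable_subset) simp
qed

lemma countable_dual_lattice: "countable (dual_lattice M)"
  unfolding dual_lattice_def lattice_of_def by (rule countable_image[OF countable_intvecs])

lemma intvecs_diff: "k \<in> intvecs \<Longrightarrow> l \<in> intvecs \<Longrightarrow> k - l \<in> intvecs"
  by (simp add: intvecs_def)

lemma lattice_of_diff: "k \<in> lattice_of M \<Longrightarrow> l \<in> lattice_of M \<Longrightarrow> k - l \<in> lattice_of M"
  unfolding lattice_of_def by (auto simp: matrix_vector_mult_diff_distrib[symmetric] intro!: imageI intvecs_diff)

lemma uminus_dual_lattice:
  assumes "\<gamma> \<in> dual_lattice M"
  shows "- \<gamma> \<in> dual_lattice M"
proof -
  have "0 \<in> lattice_of (matrix_inv (transpose M))"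
    unfolding lattice_of_def by (rule image_eqI[of _ _ 0]) (auto simp: intvecs_def)
  then show ?thesis
    using lattice_of_diff[of 0 "matrix_inv (transpose M)" \<gamma>] assms by (simp add: dual_lattice_def)
qed

text \<open>Moving \<open>M\<close> to the other side of the inner product leaves two integer
  vectors, so \<open>\<gamma> \<bullet> l\<close> is an integer.\<close>

lemma echar_dual_lattice:
  assumes M: "invertible M" and \<gamma>: "\<gamma> \<in> dual_lattice M" and l: "l \<in> lattice_of M"
  shows "echar \<gamma> l = 1"
proof -
  obtain k where k: "k \<in> intvecs" "l = M *v k"
    using l by (auto simp: lattice_of_def)
  have "\<gamma> \<bullet> l = (transpose M *v \<gamma>) \<bullet> k"
    unfolding k by (metis dot_lmul_matrix transpose_matrix_vector)
  also have "\<dots> \<in> \<int>"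
    using \<gamma> k(1) unfolding mem_dual_lattice_iff[OF M] by (auto simp: inner_vec_def intvecs_def intro!: Ints_sum Ints_mult)
  finally obtain n where "\<gamma> \<bullet> l = real_of_int n"
    by (auto simp: Ints_def)
  then have "echar \<gamma> l = cis (2 * pi * real_of_int (- n))"
    by (simp add: echar_def)
  also have "\<dots> = 1"
    by (rule cis_multiple_2pi) simp
  finally show ?thesis .
qed

lemma trigpoly_periodic:
  assumes "invertible M" "\<gamma> \<in> dual_lattice M" "F \<subseteq> lattice_of M"
  shows "trigpoly F a (t + \<gamma>) = trigpoly F a t"
  unfolding trigpoly_def using assms
  by (intro sum.cong refl) (auto simp: echar_add_left echar_dual_lattice subset_iff)

text \<open>Unlike the closed cell \<^const>\<open>dual_cell\<close>, its translates by the dual lattice partition the space.\<close>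
definition half_open_cell :: "((real, 'd::finite) vec, 'd) vec \<Rightarrow> (real, 'd) vec set" where
  "half_open_cell M = {t. \<forall>i. 0 \<le> (transpose M *v t) $ i \<and> (transpose M *v t) $ i < 1}"

lemma half_open_cell_subset:
  assumes "invertible M"
  shows "half_open_cell M \<subseteq> dual_cell M"
proof
  fix t assume "t \<in> half_open_cell M"
  moreover have "t = matrix_inv (transpose M) *v (transpose M *v t)"
    by (simp add: matrix_vector_mul_assoc matrix_inv_transpose[OF assms])
  ultimately show "t \<in> dual_cell M"
    unfolding dual_cell_def half_open_cell_def by (intro image_eqI) (auto intro: less_imp_le)
qed

lemma half_open_cell_measurable [measurable]: "half_open_cell M \<in> sets borel"
  unfolding half_open_cell_def matrix_vector_mul_component by measurable

lemma half_open_cell_finite: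
  fixes M :: "((real, 'd::finite) vec, 'd) vec"
  assumes "invertible M"
  shows "emeasure lborel (half_open_cell M) < \<infinity>"
proof (rule emeasure_bounded_finite)
  have "{s::(real, 'd) vec. \<forall>i. 0 \<le> s $ i \<and> s $ i \<le> 1} = cbox 0 (\<chi> i. 1)"
    by (auto simp: mem_box_cart)
  then have "bounded (dual_cell M)"
    unfolding dual_cell_def by (simp add: bounded_linear_image)
  then show "bounded (half_open_cell M)"
    using half_open_cell_subset[OF assms] bounded_subset by blast
qed

lemma half_open_cell_tiling:
  assumes M: "invertible M"
  obtains \<gamma>0 where "\<gamma>0 \<in> dual_lattice M"
    and "\<And>\<gamma>. \<gamma> \<in> dual_lattice M \<Longrightarrow> t + \<gamma> \<in> half_open_cell M \<longleftrightarrow> \<gamma> = \<gamma>0"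
proof -
  let ?T = "transpose M" and ?N = "matrix_inv (transpose M)"
  \<comment> \<open>Subtracting the integer parts of the coordinates moves \<open>t\<close> into the
    cell.\<close>
  define k where "k = (\<chi> i. - real_of_int \<lfloor>(?T *v t) $ i\<rfloor>)"
  define \<gamma>0 where "\<gamma>0 = ?N *v k"
  have T0: "?T *v \<gamma>0 = k"
    by (simp add: \<gamma>0_def matrix_vector_mul_assoc matrix_inv_transpose[OF M])
  show ?thesis
  proof (rule that)
    show "\<gamma>0 \<in> dual_lattice M"
      unfolding mem_dual_lattice_iff[OF M] T0 by (simp add: k_def intvecs_def)
    fix \<gamma> assume "\<gamma> \<in> dual_lattice M"
    then have int: "\<forall>i. (?T *v \<gamma>) $ i \<in> \<int>"
      by (simp add: mem_dual_lattice_iff[OF M] intvecs_def)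
    show "t + \<gamma> \<in> half_open_cell M \<longleftrightarrow> \<gamma> = \<gamma>0"
    proof
      assume "t + \<gamma> \<in> half_open_cell M"
      then have c: "0 \<le> (?T *v t) $ i + (?T *v \<gamma>) $ i \<and> (?T *v t) $ i + (?T *v \<gamma>) $ i < 1" for i
        by (simp add: half_open_cell_def matrix_vector_right_distrib)
      have "?T *v \<gamma> = k"
      proof (rule vec_eq_iff[THEN iffD2, rule_format])
        fix i
        obtain z where z: "(?T *v \<gamma>) $ i = real_of_int z"
          using int by (auto elim: Ints_cases)
        have "\<lfloor>(?T *v t) $ i\<rfloor> = - z"
          using c[of i] z by (intro floor_unique) auto
        then show "(?T *v \<gamma>) $ i = k $ i"
          using z by (simp add: k_def)
      qed
      then have "?N *v (?T *v \<gamma>) = \<gamma>0"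
        by (simp add: \<gamma>0_def)
      then show "\<gamma> = \<gamma>0"
        by (simp add: matrix_vector_mul_assoc matrix_inv_transpose[OF M])
    next
      assume "\<gamma> = \<gamma>0"
      then show "t + \<gamma> \<in> half_open_cell M"
        by (auto simp: half_open_cell_def matrix_vector_right_distrib T0 k_def) linarith+
    qed
  qed
qed

text \<open>The tiling as a partition of unity, ready to be inserted into integrals; the second form
  follows by the symmetry of the dual lattice.\<close>

lemma half_open_cell_count:
  assumes M: "invertible M"
  shows "(\<integral>\<^sup>+\<gamma>. indicator (half_open_cell M) (t + \<gamma>) \<partial>count_space (dual_lattice M)) = 1"
    and "(\<integral>\<^sup>+\<gamma>. indicator (half_open_cell M) (t - \<gamma>) \<partial>count_space (dual_lattice M)) = 1"
proof -
  obtain \<gamma>0 where \<gamma>0: "\<gamma>0 \<in> dual_lattice M"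
    "\<And>\<gamma>. \<gamma> \<in> dual_lattice M \<Longrightarrow> t + \<gamma> \<in> half_open_cell M \<longleftrightarrow> \<gamma> = \<gamma>0"
    using half_open_cell_tiling[OF M, of t] by blast
  have "(\<integral>\<^sup>+\<gamma>. indicator (half_open_cell M) (t + \<gamma>) \<partial>count_space (dual_lattice M))
    = (\<integral>\<^sup>+\<gamma>. indicator {\<gamma>0} \<gamma> \<partial>count_space (dual_lattice M))"
    using \<gamma>0(2) by (intro nn_integral_cong) (auto simp: indicator_def)
  also have "\<dots> = 1"
    using \<gamma>0(1) by (simp add: nn_integral_indicator)
  finally show "(\<integral>\<^sup>+\<gamma>. indicator (half_open_cell M) (t + \<gamma>) \<partial>count_space (dual_lattice M)) = 1" .
  have "t - \<gamma> \<in> half_open_cell M \<longleftrightarrow> \<gamma> = - \<gamma>0" if "\<gamma> \<in> dual_lattice M" for \<gamma>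
    using \<gamma>0(2)[OF uminus_dual_lattice[OF that]] by auto
  then have "(\<integral>\<^sup>+\<gamma>. indicator (half_open_cell M) (t - \<gamma>) \<partial>count_space (dual_lattice M))
    = (\<integral>\<^sup>+\<gamma>. indicator {- \<gamma>0} \<gamma> \<partial>count_space (dual_lattice M))"
    by (intro nn_integral_cong) (auto simp: indicator_def)
  also have "\<dots> = 1"
    using uminus_dual_lattice[OF \<gamma>0(1)] by (simp add: nn_integral_indicator)
  finally show "(\<integral>\<^sup>+\<gamma>. indicator (half_open_cell M) (t - \<gamma>) \<partial>count_space (dual_lattice M)) = 1" .
qed

text \<open>Insert the partition of unity, exchange sum and integral, and translate each tile back
  to the cell. Nonnegativity and countability of the lattice justify the exchange.\<close>

lemma nn_integral_tiling:
  fixes M :: "((real, 'd::finite) vec, 'd) vec"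
  assumes M: "invertible M" and [measurable]: "f \<in> borel_measurable borel"
  shows "(\<integral>\<^sup>+t. f t \<partial>lborel)
    = (\<integral>\<^sup>+t. indicator (half_open_cell M) t * (\<integral>\<^sup>+\<gamma>. f (t + \<gamma>) \<partial>count_space (dual_lattice M)) \<partial>lborel)"
proof -
  let ?C = "half_open_cell M" and ?D = "dual_lattice M"
  have "(\<integral>\<^sup>+t. f t \<partial>lborel) = (\<integral>\<^sup>+t. (\<integral>\<^sup>+\<gamma>. indicator ?C (t - \<gamma>) * f t \<partial>count_space ?D) \<partial>lborel)"
    by (simp add: nn_integral_multc half_open_cell_count[OF M])
  also have "\<dots> = (\<integral>\<^sup>+\<gamma>. (\<integral>\<^sup>+t. indicator ?C (t - \<gamma>) * f t \<partial>lborel) \<partial>count_space ?D)"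
    by (rule nn_integral_count_space_nn_integral[OF countable_dual_lattice]) measurable
  also have "\<dots> = (\<integral>\<^sup>+\<gamma>. (\<integral>\<^sup>+t. indicator ?C t * f (t + \<gamma>) \<partial>lborel) \<partial>count_space ?D)"
  proof (rule nn_integral_cong)
    fix \<gamma>
    show "(\<integral>\<^sup>+t. indicator ?C (t - \<gamma>) * f t \<partial>lborel) = (\<integral>\<^sup>+t. indicator ?C t * f (t + \<gamma>) \<partial>lborel)"
      by (subst nn_integral_lborel_translate[of _ \<gamma>, symmetric]) auto
  qed
  also have "\<dots> = (\<integral>\<^sup>+t. (\<integral>\<^sup>+\<gamma>. indicator ?C t * f (t + \<gamma>) \<partial>count_space ?D) \<partial>lborel)"
    by (rule nn_integral_count_space_nn_integral[OF countable_dual_lattice, symmetric]) measurable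
  also have "\<dots> = (\<integral>\<^sup>+t. indicator ?C t * (\<integral>\<^sup>+\<gamma>. f (t + \<gamma>) \<partial>count_space ?D) \<partial>lborel)"
    by (simp add: nn_integral_cmult)
  finally show ?thesis .
qed

text \<open>A null cell would make the whole space null, by the tiling formula for the constant 1;
  this avoids computing the volume.\<close>

lemma half_open_cell_pos:
  fixes M :: "((real, 'd::finite) vec, 'd) vec"
  assumes M: "invertible M"
  shows "0 < measure lborel (half_open_cell M)"
proof -
  let ?C = "half_open_cell M"
  have "emeasure lborel ?C \<noteq> 0"
  proof
    assume "emeasure lborel ?C = 0"
    then have "AE t in lborel. t \<notin> ?C"
      by (intro AE_not_in) (auto simp: null_sets_def)
    then have "(\<integral>\<^sup>+t. indicator ?C t * (\<integral>\<^sup>+\<gamma>. 1 \<partial>count_space (dual_lattice M)) \<partial>lborel) = (\<integral>\<^sup>+t. 0 \<partial>(lborel :: (real, 'd) vec measure))"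
      by (intro nn_integral_cong_AE, eventually_elim) (simp add: indicator_def)
    then have "emeasure lborel (UNIV :: (real, 'd) vec set) = 0"
      using nn_integral_tiling[OF M, of "\<lambda>_. 1"] by simp
    then show False
      by simp
  qed
  then show ?thesis
    using half_open_cell_finite[OF M] by (simp add: measure_def enn2real_positive_iff less_top zero_less_iff_neq_zero)
qed

text \<open>A shifted cell is again a fundamental domain: tiling folds it back onto the cell, where
  periodicity and the partition of unity collapse the sum.\<close>

lemma nn_integral_cell_shift:
  fixes M :: "((real, 'd::finite) vec, 'd) vec"
  assumes M: "invertible M" and [measurable]: "f \<in> borel_measurable borel"
    and per: "\<And>t \<gamma>. \<gamma> \<in> dual_lattice M \<Longrightarrow> f (t + \<gamma>) = f t"
  shows "(\<integral>\<^sup>+t. indicator (half_open_cell M) t * f (t + x) \<partial>lborel) = (\<integral>\<^sup>+t. indicator (half_open_cell M) t * f t \<partial>lborel)"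
proof -
  let ?C = "half_open_cell M" and ?D = "dual_lattice M"
  have "(\<integral>\<^sup>+t. indicator ?C t * f (t + x) \<partial>lborel) = (\<integral>\<^sup>+t. indicator ?C (t - x) * f t \<partial>lborel)"
    by (subst nn_integral_lborel_translate_diff[of _ x, symmetric]) auto
  also have "\<dots> = (\<integral>\<^sup>+t. indicator ?C t * (\<integral>\<^sup>+\<gamma>. indicator ?C (t + \<gamma> - x) * f (t + \<gamma>) \<partial>count_space ?D) \<partial>lborel)"
    by (rule nn_integral_tiling[OF M]) measurable
  also have "\<dots> = (\<integral>\<^sup>+t. indicator ?C t * f t \<partial>lborel)"
  proof (rule nn_integral_cong)
    fix t
    have "(\<integral>\<^sup>+\<gamma>. indicator ?C (t + \<gamma> - x) * f (t + \<gamma>) \<partial>count_space ?D) = (\<integral>\<^sup>+\<gamma>. indicator ?C ((t - x) + \<gamma>) * f t \<partial>count_space ?D)"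
      by (intro nn_integral_cong) (simp add: per diff_add_eq)
    also have "\<dots> = f t"
      by (simp add: nn_integral_multc half_open_cell_count[OF M])
    finally show "indicator ?C t * (\<integral>\<^sup>+\<gamma>. indicator ?C (t + \<gamma> - x) * f (t + \<gamma>) \<partial>count_space ?D) = indicator ?C t * f t"
      by simp
  qed
  finally show ?thesis .
qed

text \<open>Shifting by half a period of the character reverses its sign but preserves cell integrals of
  periodic functions.\<close>
lemma integral_cell_echar_real:
  fixes M :: "((real, 'd::finite) vec, 'd) vec"
  assumes M: "invertible M" and k: "k \<in> lattice_of M" "k \<noteq> 0" and u: "cmod u = 1"
  shows "(\<integral>t. indicator (half_open_cell M) t * Re (u * echar t k) \<partial>lborel) = 0"
proof -
  let ?C = "half_open_cell M"
  \<comment> \<open>Chosen so that \<open>x \<bullet> k\<close> is 1/2, where the character equals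
    \<open>cis (- pi)\<close>.\<close>
  define x where "x = (1 / (2 * (k \<bullet> k))) *\<^sub>R k"
  have x: "echar x k = - 1"
    using k(2) by (simp add: echar_def x_def cis.ctr complex_eq_iff)
  have bd: "\<bar>Re (u * echar t k)\<bar> \<le> 1" for t
    using abs_Re_le_cmod[of "u * echar t k"] u by (simp add: norm_mult)
  have int1: "integrable lborel (indicat_real ?C)"
    using half_open_cell_finite[OF M] by (simp add: less_top)
  have int2: "integrable lborel (\<lambda>t. indicat_real ?C t * Re (u * echar t k))"
  proof (rule Bochner_Integration.integrable_bound[OF int1])
    show "AE t in lborel. norm (indicat_real ?C t * Re (u * echar t k)) \<le> norm (indicat_real ?C t)"
      using bd by (intro AE_I2) (auto simp: indicator_def)
  qed measurable
  have vol: "(\<integral>t. indicat_real ?C t \<partial>lborel) = measure lborel ?C"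
    using int1 by simp
  define I where "I = (\<integral>t. indicat_real ?C t * Re (u * echar t k) \<partial>lborel)"
  \<comment> \<open>Adding 1 makes the integrand nonnegative, so that
    \<open>nn_integral_cell_shift\<close> applies; the half-period shift exchanges
    \<open>s = 1\<close> and \<open>s = - 1\<close>.\<close>
  have val: "(\<integral>\<^sup>+t. indicator ?C t * ennreal (1 + s * Re (u * echar t k)) \<partial>lborel)
     = ennreal (measure lborel ?C + s * I)" if "s = 1 \<or> s = - 1" for s
  proof -
    have "(\<integral>\<^sup>+t. indicator ?C t * ennreal (1 + s * Re (u * echar t k)) \<partial>lborel)
      = (\<integral>\<^sup>+t. ennreal (indicat_real ?C t + s * (indicat_real ?C t * Re (u * echar t k))) \<partial>lborel)"
      by (intro nn_integral_cong) (auto simp: indicator_def)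
    also have "\<dots> = ennreal (\<integral>t. indicat_real ?C t + s * (indicat_real ?C t * Re (u * echar t k)) \<partial>lborel)"
    proof (rule nn_integral_eq_integral)
      show "integrable lborel (\<lambda>t. indicat_real ?C t + s * (indicat_real ?C t * Re (u * echar t k)))"
        using int1 int2 by (intro Bochner_Integration.integrable_add integrable_mult_right)
      have "0 \<le> indicat_real ?C t + s * (indicat_real ?C t * Re (u * echar t k))" for t
      proof -
        have "\<bar>s * Re (u * echar t k)\<bar> \<le> 1"
          using bd[of t] that by (auto simp only: mult_1_left mult_minus1 abs_minus_cancel)
        then have "0 \<le> 1 + s * Re (u * echar t k)"
          by linarith
        then show ?thesis
          by (cases "t \<in> ?C") (simp_all only: indicator_simps mult_1_left mult_zero_left mult_zero_right add_0 order_refl not_False_eq_True)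
      qed
      then show "AE t in lborel. 0 \<le> indicat_real ?C t + s * (indicat_real ?C t * Re (u * echar t k))"
        by (intro AE_I2)
    qed
    also have "(\<integral>t. indicat_real ?C t + s * (indicat_real ?C t * Re (u * echar t k)) \<partial>lborel) = measure lborel ?C + s * I"
      unfolding Bochner_Integration.integral_add[OF int1 integrable_mult_right[OF int2]] integral_mult_right_zero vol I_def ..
    finally show ?thesis .
  qed
  have "Re (u * echar (t + x) k) = - 1 * Re (u * echar t k)" for t
    by (simp add: echar_add_left x)
  moreover have "(\<integral>\<^sup>+t. indicator ?C t * ennreal (1 + Re (u * echar (t + x) k)) \<partial>lborel)
    = (\<integral>\<^sup>+t. indicator ?C t * ennreal (1 + 1 * Re (u * echar t k)) \<partial>lborel)"
    using nn_integral_cell_shift[OF M, of "\<lambda>t. ennreal (1 + Re (u * echar t k))" x]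
    by (simp add: echar_add_left echar_dual_lattice[OF M _ k(1)])
  ultimately have "ennreal (measure lborel ?C + (- 1) * I) = ennreal (measure lborel ?C + 1 * I)"
    using val[of 1] val[of "- 1"] by (simp only:) simp
  \<comment> \<open>\<open>ennreal\<close> is injective only on nonnegative reals; this bound puts
    both sides there.\<close>
  moreover have "\<bar>I\<bar> \<le> measure lborel ?C"
  proof -
    have "\<bar>I\<bar> \<le> (\<integral>t. indicat_real ?C t \<partial>lborel)"
      unfolding I_def
    proof (intro Bochner_Integration.integral_abs_bound_integral int1 int2)
      show "\<bar>indicat_real ?C t * Re (u * echar t k)\<bar> \<le> indicat_real ?C t" for t
        using bd[of t] by (cases "t \<in> ?C") simp_all
    qed
    then show ?thesis
      by simp
  qed
  ultimately have "I = 0"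
    by (simp add: ennreal_inj abs_le_iff)
  then show ?thesis
    by (simp add: I_def)
qed

lemma integral_cell_echar:
  fixes M :: "((real, 'd::finite) vec, 'd) vec"
  assumes M: "invertible M" and k: "k \<in> lattice_of M"
  shows "integrable lborel (\<lambda>t. indicator (half_open_cell M) t * echar t k)"
    and "(\<integral>t. indicator (half_open_cell M) t * echar t k \<partial>lborel) = (if k = 0 then complex_of_real (measure lborel (half_open_cell M)) else 0)"
proof -
  let ?C = "half_open_cell M"
  have int1: "integrable lborel (indicat_real ?C)"
    using half_open_cell_finite[OF M] by (simp add: less_top)
  show int: "integrable lborel (\<lambda>t. indicator ?C t * echar t k)"
    by (rule Bochner_Integration.integrable_bound[OF int1]) (auto simp: norm_mult indicator_def[abs_def] intro!: AE_I2)
  show "(\<integral>t. indicator ?C t * echar t k \<partial>lborel) = (if k = 0 then complex_of_real (measure lborel ?C) else 0)"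
  proof (cases "k = 0")
    case True
    have "(\<integral>t. indicator ?C t * echar t k \<partial>lborel) = (\<integral>t. complex_of_real (indicat_real ?C t) \<partial>lborel)"
      using True by (intro Bochner_Integration.integral_cong) (auto simp: indicator_def)
    also have "\<dots> = complex_of_real (measure lborel ?C)"
      unfolding integral_complex_of_real using int1 by simp
    finally show ?thesis using True by simp
  next
    case False
    \<comment> \<open>One real lemma covers both parts, through
      \<open>Im z = Re (- \<i> * z)\<close>.\<close>
    have "Re (\<integral>t. indicator ?C t * echar t k \<partial>lborel) = (\<integral>t. indicator ?C t * Re (1 * echar t k) \<partial>lborel)"
      unfolding integral_Re[OF int, symmetric] by (intro Bochner_Integration.integral_cong) (auto simp: indicator_def)
    moreover have "Im (\<integral>t. indicator ?C t * echar t k \<partial>lborel) = (\<integral>t. indicator ?C t * Re ((- \<i>) * echar t k) \<partial>lborel)"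
      unfolding integral_Im[OF int, symmetric] by (intro Bochner_Integration.integral_cong) (auto simp: indicator_def)
    ultimately show ?thesis
      using False integral_cell_echar_real[OF M k False, of 1] integral_cell_echar_real[OF M k False, of "- \<i>"]
      by (simp add: complex_eq_iff)
  qed
qed

text \<open>Parseval on the cell: expanding the square leaves characters at the differences
  \<open>l - m\<close>, whose cell integrals vanish unless \<open>l = m\<close>.\<close>

lemma nn_integral_cell_trigpoly:
  fixes M :: "((real, 'd::finite) vec, 'd) vec"
  assumes M: "invertible M" and F: "finite F" "F \<subseteq> lattice_of M"
  shows "(\<integral>\<^sup>+t. indicator (half_open_cell M) t * ennreal ((cmod (trigpoly F a t))\<^sup>2) \<partial>lborel)
    = ennreal (measure lborel (half_open_cell M) * (\<Sum>l\<in>F. (cmod (a l))\<^sup>2))"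
proof -
  let ?C = "half_open_cell M"
  have lm: "l - m \<in> lattice_of M" if "l \<in> F" "m \<in> F" for l m
    using that F(2) by (auto intro: lattice_of_diff)
  have exp: "complex_of_real (indicator ?C t * (cmod (trigpoly F a t))\<^sup>2)
     = (\<Sum>l\<in>F. \<Sum>m\<in>F. (a l * cnj (a m)) * (indicator ?C t * echar t (l - m)))" for t
  proof -
    have "complex_of_real (indicator ?C t * (cmod (trigpoly F a t))\<^sup>2)
      = indicator ?C t * (trigpoly F a t * cnj (trigpoly F a t))"
      unfolding complex_norm_square[symmetric] by (simp add: indicator_def)
    also have "\<dots> = (\<Sum>l\<in>F. \<Sum>m\<in>F. indicator ?C t * ((a l * echar t l) * cnj (a m * echar t m)))"
      unfolding trigpoly_def cnj_sum sum_product by (simp only: sum_distrib_left)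
    also have "\<dots> = (\<Sum>l\<in>F. \<Sum>m\<in>F. (a l * cnj (a m)) * (indicator ?C t * echar t (l - m)))"
      by (intro sum.cong refl) (simp add: echar_diff_right mult_ac)
    finally show ?thesis .
  qed
  have int: "integrable lborel (\<lambda>t. \<Sum>l\<in>F. \<Sum>m\<in>F. (a l * cnj (a m)) * (indicator ?C t * echar t (l - m)))"
    by (intro Bochner_Integration.integrable_sum integrable_mult_right integral_cell_echar[OF M] lm)
  then have "integrable lborel (\<lambda>t. complex_of_real (indicator ?C t * (cmod (trigpoly F a t))\<^sup>2))"
    unfolding exp .
  then have int': "integrable lborel (\<lambda>t. indicator ?C t * (cmod (trigpoly F a t))\<^sup>2)"
    by (simp only: complex_of_real_integrable_eq)
  have "complex_of_real (\<integral>t. indicator ?C t * (cmod (trigpoly F a t))\<^sup>2 \<partial>lborel)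
    = (\<integral>t. (\<Sum>l\<in>F. \<Sum>m\<in>F. (a l * cnj (a m)) * (indicator ?C t * echar t (l - m))) \<partial>lborel)"
    unfolding integral_complex_of_real[symmetric] exp ..
  also have "\<dots> = (\<Sum>l\<in>F. \<Sum>m\<in>F. (a l * cnj (a m)) * (\<integral>t. indicator ?C t * echar t (l - m) \<partial>lborel))"
  proof -
    have 1: "integrable lborel (\<lambda>t. (a l * cnj (a m)) * (indicator ?C t * echar t (l - m)))" if "l \<in> F" "m \<in> F" for l m
      by (intro integrable_mult_right integral_cell_echar[OF M] lm that)
    have "(\<integral>t. (\<Sum>l\<in>F. \<Sum>m\<in>F. (a l * cnj (a m)) * (indicator ?C t * echar t (l - m))) \<partial>lborel)
      = (\<Sum>l\<in>F. \<integral>t. (\<Sum>m\<in>F. (a l * cnj (a m)) * (indicator ?C t * echar t (l - m))) \<partial>lborel)"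
      by (intro Bochner_Integration.integral_sum Bochner_Integration.integrable_sum 1)
    also have "\<dots> = (\<Sum>l\<in>F. \<Sum>m\<in>F. \<integral>t. (a l * cnj (a m)) * (indicator ?C t * echar t (l - m)) \<partial>lborel)"
      by (intro sum.cong refl Bochner_Integration.integral_sum 1)
    also have "\<dots> = (\<Sum>l\<in>F. \<Sum>m\<in>F. (a l * cnj (a m)) * (\<integral>t. indicator ?C t * echar t (l - m) \<partial>lborel))"
      by (intro sum.cong refl integral_mult_right_zero)
    finally show ?thesis .
  qed
  also have "\<dots> = (\<Sum>l\<in>F. \<Sum>m\<in>F. if l = m then (a l * cnj (a l)) * complex_of_real (measure lborel ?C) else 0)"
    by (intro sum.cong refl) (auto simp: integral_cell_echar(2)[OF M lm])
  also have "\<dots> = (\<Sum>l\<in>F. complex_of_real ((cmod (a l))\<^sup>2 * measure lborel ?C))"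
    using F(1) by (simp add: complex_norm_square del: of_real_power)
  also have "\<dots> = complex_of_real (measure lborel ?C * (\<Sum>l\<in>F. (cmod (a l))\<^sup>2))"
    by (simp only: of_real_sum[symmetric] sum_distrib_left mult.commute)
  finally have val: "(\<integral>t. indicator ?C t * (cmod (trigpoly F a t))\<^sup>2 \<partial>lborel) = measure lborel ?C * (\<Sum>l\<in>F. (cmod (a l))\<^sup>2)"
    by (simp only: of_real_eq_iff)
  have "(\<integral>\<^sup>+t. indicator ?C t * ennreal ((cmod (trigpoly F a t))\<^sup>2) \<partial>lborel)
    = (\<integral>\<^sup>+t. ennreal (indicator ?C t * (cmod (trigpoly F a t))\<^sup>2) \<partial>lborel)"
    by (intro nn_integral_cong) (auto simp: indicator_def)
  also have "\<dots> = ennreal (\<integral>t. indicator ?C t * (cmod (trigpoly F a t))\<^sup>2 \<partial>lborel)"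
    by (intro nn_integral_eq_integral int') auto
  finally show ?thesis
    unfolding val .
qed

section \<open>From the periodization to Riesz bounds\<close>

lemma nn_integral_count_space_summable:
  fixes f :: "'i \<Rightarrow> real"
  assumes "f summable_on A" "\<And>x. x \<in> A \<Longrightarrow> 0 \<le> f x"
  shows "(\<integral>\<^sup>+x. ennreal (f x) \<partial>count_space A) = ennreal (infsum f A)"
proof -
  have "(\<lambda>x. norm (f x)) summable_on A"
    using assms(1) by (rule summable_on_cong[THEN iffD1, rotated]) (simp add: assms(2))
  then have *: "Infinite_Set_Sum.abs_summable_on f A"
    by (rule abs_summable_equivalent[THEN iffD1])
  show ?thesis
    unfolding infsetsum_infsum[OF *, symmetric] by (rule nn_integral_conv_infsetsum[OF *]) (rule assms(2))
qed

text \<open>The trigonometric polynomial is periodic under the dual lattice, so it factors out of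
  the lattice sum and the weight that remains is the periodization. The modulus of \<open>B\<close>
  keeps the upper constant nonnegative without comparing \<open>A\<close> with
  \<open>B\<close>.\<close>

lemma periodization_Riesz_bounds:
  fixes M :: "((real, 'd::finite) vec, 'd) vec"
  assumes M: "invertible M" and \<psi>: "\<psi> \<in> L2" and g: "is_L2_fourier \<psi> g" and A: "0 < A"
    and per: "AE t in lborel. t \<in> dual_cell M \<longrightarrow>
             (\<lambda>\<gamma>. (cmod (g (t + \<gamma>)))\<^sup>2) summable_on dual_lattice M \<and>
             A \<le> periodization M g t \<and> periodization M g t \<le> B"
    and F: "finite F" "F \<subseteq> lattice_of M"
  shows "A * measure lborel (half_open_cell M) * (\<Sum>l\<in>F. (cmod (a l))\<^sup>2) \<le> (l2norm (\<lambda>t. \<Sum>l\<in>F. a l * \<psi> (t - l)))\<^sup>2"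
    and "(l2norm (\<lambda>t. \<Sum>l\<in>F. a l * \<psi> (t - l)))\<^sup>2 \<le> \<bar>B\<bar> * measure lborel (half_open_cell M) * (\<Sum>l\<in>F. (cmod (a l))\<^sup>2)"
proof -
  let ?C = "half_open_cell M" and ?D = "dual_lattice M"
  let ?P = "\<lambda>t. indicator ?C t * ennreal ((cmod (trigpoly F a t))\<^sup>2)"
  have gL: "g \<in> L2"
    using g by (simp add: is_L2_fourier_def)
  note [measurable] = L2_measurable[OF gL]
  have P: "(\<lambda>w. trigpoly F a w * g w) \<in> L2"
    by (rule L2_mult_bounded(1)[OF gL borel_measurable_trigpoly norm_trigpoly_le])
  have "ennreal ((l2norm (\<lambda>t. \<Sum>l\<in>F. a l * \<psi> (t - l)))\<^sup>2) = (\<integral>\<^sup>+w. ennreal ((cmod (trigpoly F a w * g w))\<^sup>2) \<partial>lborel)"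
    unfolding l2norm_sum_transl[OF \<psi> g F(1)] nn_integral_L2[OF P] ..
  also have "\<dots> = (\<integral>\<^sup>+t. indicator ?C t * (\<integral>\<^sup>+\<gamma>. ennreal ((cmod (trigpoly F a (t + \<gamma>) * g (t + \<gamma>)))\<^sup>2) \<partial>count_space ?D) \<partial>lborel)"
    by (rule nn_integral_tiling[OF M]) measurable
  also have "\<dots> = (\<integral>\<^sup>+t. ?P t * (\<integral>\<^sup>+\<gamma>. ennreal ((cmod (g (t + \<gamma>)))\<^sup>2) \<partial>count_space ?D) \<partial>lborel)"
  proof (rule nn_integral_cong)
    fix t
    have "(\<integral>\<^sup>+\<gamma>. ennreal ((cmod (trigpoly F a (t + \<gamma>) * g (t + \<gamma>)))\<^sup>2) \<partial>count_space ?D)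
      = (\<integral>\<^sup>+\<gamma>. ennreal ((cmod (trigpoly F a t))\<^sup>2) * ennreal ((cmod (g (t + \<gamma>)))\<^sup>2) \<partial>count_space ?D)"
      by (intro nn_integral_cong) (simp add: trigpoly_periodic[OF M _ F(2)] norm_mult power_mult_distrib ennreal_mult)
    also have "\<dots> = ennreal ((cmod (trigpoly F a t))\<^sup>2) * (\<integral>\<^sup>+\<gamma>. ennreal ((cmod (g (t + \<gamma>)))\<^sup>2) \<partial>count_space ?D)"
      by (rule nn_integral_cmult) simp
    finally show "indicator ?C t * (\<integral>\<^sup>+\<gamma>. ennreal ((cmod (trigpoly F a (t + \<gamma>) * g (t + \<gamma>)))\<^sup>2) \<partial>count_space ?D)
      = ?P t * (\<integral>\<^sup>+\<gamma>. ennreal ((cmod (g (t + \<gamma>)))\<^sup>2) \<partial>count_space ?D)"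
      by (simp add: mult.assoc)
  qed
  finally have eq: "ennreal ((l2norm (\<lambda>t. \<Sum>l\<in>F. a l * \<psi> (t - l)))\<^sup>2)
    = (\<integral>\<^sup>+t. ?P t * (\<integral>\<^sup>+\<gamma>. ennreal ((cmod (g (t + \<gamma>)))\<^sup>2) \<partial>count_space ?D) \<partial>lborel)" .
  have bounds: "AE t in lborel. t \<in> ?C \<longrightarrow>
      ennreal A \<le> (\<integral>\<^sup>+\<gamma>. ennreal ((cmod (g (t + \<gamma>)))\<^sup>2) \<partial>count_space ?D)
      \<and> (\<integral>\<^sup>+\<gamma>. ennreal ((cmod (g (t + \<gamma>)))\<^sup>2) \<partial>count_space ?D) \<le> ennreal \<bar>B\<bar>"
    using per
  proof eventually_elim
    case (elim t)
    show ?case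
    proof
      assume "t \<in> ?C"
      then have *: "(\<lambda>\<gamma>. (cmod (g (t + \<gamma>)))\<^sup>2) summable_on ?D" "A \<le> periodization M g t" "periodization M g t \<le> B"
        using elim half_open_cell_subset[OF M] by auto
      then show "ennreal A \<le> (\<integral>\<^sup>+\<gamma>. ennreal ((cmod (g (t + \<gamma>)))\<^sup>2) \<partial>count_space ?D)
        \<and> (\<integral>\<^sup>+\<gamma>. ennreal ((cmod (g (t + \<gamma>)))\<^sup>2) \<partial>count_space ?D) \<le> ennreal \<bar>B\<bar>"
        by (simp add: nn_integral_count_space_summable periodization_def[symmetric] ennreal_leI)
    qed
  qed
  have cP: "(\<integral>\<^sup>+t. ?P t * ennreal c \<partial>lborel) = ennreal (c * measure lborel ?C * (\<Sum>l\<in>F. (cmod (a l))\<^sup>2))" if "c \<ge> 0" for c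
  proof -
    have "(\<integral>\<^sup>+t. ?P t * ennreal c \<partial>lborel) = (\<integral>\<^sup>+t. ?P t \<partial>lborel) * ennreal c"
      by (rule nn_integral_multc) measurable
    then show ?thesis
      unfolding nn_integral_cell_trigpoly[OF M F] using that by (simp add: ennreal_mult'[symmetric] mult_ac sum_nonneg)
  qed
  have "ennreal (A * measure lborel ?C * (\<Sum>l\<in>F. (cmod (a l))\<^sup>2)) \<le> ennreal ((l2norm (\<lambda>t. \<Sum>l\<in>F. a l * \<psi> (t - l)))\<^sup>2)"
    unfolding eq cP[OF less_imp_le[OF A], symmetric]
    by (rule nn_integral_mono_AE, rule AE_mp[OF bounds]) (auto intro!: AE_I2 simp: indicator_def mult_left_mono)
  then show "A * measure lborel ?C * (\<Sum>l\<in>F. (cmod (a l))\<^sup>2) \<le> (l2norm (\<lambda>t. \<Sum>l\<in>F. a l * \<psi> (t - l)))\<^sup>2"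
    by simp
  have "ennreal ((l2norm (\<lambda>t. \<Sum>l\<in>F. a l * \<psi> (t - l)))\<^sup>2) \<le> ennreal (\<bar>B\<bar> * measure lborel ?C * (\<Sum>l\<in>F. (cmod (a l))\<^sup>2))"
    unfolding eq cP[OF abs_ge_zero, symmetric]
    by (rule nn_integral_mono_AE, rule AE_mp[OF bounds]) (auto intro!: AE_I2 simp: indicator_def mult_left_mono)
  then show "(l2norm (\<lambda>t. \<Sum>l\<in>F. a l * \<psi> (t - l)))\<^sup>2 \<le> \<bar>B\<bar> * measure lborel ?C * (\<Sum>l\<in>F. (cmod (a l))\<^sup>2)"
    by (subst (asm) ennreal_le_iff) (auto intro!: mult_nonneg_nonneg sum_nonneg)
qed

section \<open>Phase equivalence of translate expansions\<close>

text \<open>With \<alpha> half the argument of \<nu>, the relation says that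
  \<open>cis (- \<alpha>) * c l\<close> is its own conjugate, hence real.\<close>

lemma unimodular_conjugate_iff:
  fixes c :: "'i \<Rightarrow> complex"
  shows "(\<exists>\<nu>. cmod \<nu> = 1 \<and> (\<forall>l\<in>I. c l = \<nu> * cnj (c l)))
    \<longleftrightarrow> (\<exists>\<alpha>::real. \<forall>l\<in>I. \<exists>r::real. c l = cis \<alpha> * complex_of_real r)"
proof
  assume "\<exists>\<nu>. cmod \<nu> = 1 \<and> (\<forall>l\<in>I. c l = \<nu> * cnj (c l))"
  then obtain \<nu> where \<nu>: "cmod \<nu> = 1" "\<And>l. l \<in> I \<Longrightarrow> c l = \<nu> * cnj (c l)"
    by blast
  define \<alpha> where "\<alpha> = Arg \<nu> / 2"
  have "\<nu> \<noteq> 0"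
    using \<nu>(1) by auto
  then have "cis (Arg \<nu>) = \<nu>"
    using \<nu>(1) by (simp add: cis_Arg sgn_div_norm)
  then have \<nu>2: "\<nu> = cis \<alpha> * cis \<alpha>"
    by (simp add: cis_mult \<alpha>_def)
  have "\<exists>r::real. c l = cis \<alpha> * complex_of_real r" if l: "l \<in> I" for l
  proof -
    define w where "w = cis (- \<alpha>) * c l"
    have cl: "c l = cis \<alpha> * w"
      by (simp add: w_def cis_mult flip: mult.assoc)
    have "w = cis (- \<alpha>) * (cis \<alpha> * cis \<alpha> * cnj (c l))"
      unfolding w_def using \<nu>(2)[OF l] \<nu>2 by simp
    also have "\<dots> = cnj w"
      by (simp add: w_def cis_cnj cis_mult flip: mult.assoc)
    finally have "w = complex_of_real (Re w)"
      by (simp add: complex_eq_iff)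
    then show ?thesis
      using cl by metis
  qed
  then show "\<exists>\<alpha>::real. \<forall>l\<in>I. \<exists>r::real. c l = cis \<alpha> * complex_of_real r"
    by blast
next
  assume "\<exists>\<alpha>::real. \<forall>l\<in>I. \<exists>r::real. c l = cis \<alpha> * complex_of_real r"
  then obtain \<alpha> :: real where \<alpha>: "\<And>l. l \<in> I \<Longrightarrow> \<exists>r::real. c l = cis \<alpha> * complex_of_real r"
    by blast
  have "c l = cis (2 * \<alpha>) * cnj (c l)" if l: "l \<in> I" for l
  proof -
    obtain r :: real where "c l = cis \<alpha> * complex_of_real r"
      using \<alpha>[OF l] by blast
    then show ?thesis
      by (simp add: cis_cnj cis_mult flip: mult.assoc)
  qed
  then show "\<exists>\<nu>. cmod \<nu> = 1 \<and> (\<forall>l\<in>I. c l = \<nu> * cnj (c l))"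
    by (intro exI[of _ "cis (2 * \<alpha>)"]) simp
qed

section \<open>Unconditional sums in L2 and their coefficients\<close>

lemma l2norm_eq_0I: "(\<And>\<epsilon>. \<epsilon> > 0 \<Longrightarrow> l2norm f < \<epsilon>) \<Longrightarrow> l2norm f = 0"
  by (metis l2norm_nonneg less_irrefl less_le)

lemma l2_has_sumD:
  assumes "l2_has_sum g I f" "\<epsilon> > 0"
  shows "\<exists>F0. finite F0 \<and> F0 \<subseteq> I \<and>
    (\<forall>F. finite F \<and> F0 \<subseteq> F \<and> F \<subseteq> I \<longrightarrow> l2norm (\<lambda>t. f t - (\<Sum>l\<in>F. g l t)) < \<epsilon>)"
  by (rule assms(1)[unfolded l2_has_sum_def, THEN conjunct2, THEN spec, THEN mp, OF assms(2)])

lemma l2_has_sum_diff_scale: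
  assumes e: "\<And>l. l \<in> I \<Longrightarrow> e l \<in> L2"
    and f: "l2_has_sum (\<lambda>l t. a l * e l t) I f" and h: "l2_has_sum (\<lambda>l t. b l * e l t) I h"
  shows "l2_has_sum (\<lambda>l t. (a l - \<nu> * b l) * e l t) I (\<lambda>t. f t - \<nu> * h t)"
  unfolding l2_has_sum_def
proof (intro conjI allI impI)
  have fL: "f \<in> L2" and hL: "h \<in> L2"
    using f h by (auto simp: l2_has_sum_def)
  then show "(\<lambda>t. f t - \<nu> * h t) \<in> L2"
    by (intro L2_diff L2_scale)
  fix \<epsilon> :: real assume \<epsilon>: "\<epsilon> > 0"
  \<comment> \<open>The added 1 makes the divisor positive also for
    \<open>\<nu> = 0\<close>.\<close>
  let ?C = "cmod \<nu> + 1"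
  have C: "?C > 0"
    by (simp add: add_nonneg_pos)
  obtain F1 where F1: "finite F1" "F1 \<subseteq> I"
    "\<forall>F. finite F \<and> F1 \<subseteq> F \<and> F \<subseteq> I \<longrightarrow> l2norm (\<lambda>t. f t - (\<Sum>l\<in>F. a l * e l t)) < \<epsilon> / 2"
    using l2_has_sumD[OF f half_gt_zero[OF \<epsilon>]] by (elim exE conjE)
  obtain F2 where F2: "finite F2" "F2 \<subseteq> I"
    "\<forall>F. finite F \<and> F2 \<subseteq> F \<and> F \<subseteq> I \<longrightarrow> l2norm (\<lambda>t. h t - (\<Sum>l\<in>F. b l * e l t)) < \<epsilon> / 2 / ?C"
    using l2_has_sumD[OF h divide_pos_pos[OF half_gt_zero[OF \<epsilon>] C]] by (elim exE conjE)
  show "\<exists>F0. finite F0 \<and> F0 \<subseteq> I \<and> (\<forall>F. finite F \<and> F0 \<subseteq> F \<and> F \<subseteq> I \<longrightarrow>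
      l2norm (\<lambda>t. f t - \<nu> * h t - (\<Sum>l\<in>F. (a l - \<nu> * b l) * e l t)) < \<epsilon>)"
  proof (intro exI[of _ "F1 \<union> F2"] conjI allI impI)
    fix F assume F: "finite F \<and> F1 \<union> F2 \<subseteq> F \<and> F \<subseteq> I"
    let ?u = "\<lambda>t. f t - (\<Sum>l\<in>F. a l * e l t)" and ?v = "\<lambda>t. h t - (\<Sum>l\<in>F. b l * e l t)"
    have uL: "?u \<in> L2" and vL: "?v \<in> L2"
      using F e by (auto intro!: L2_diff L2_sum L2_scale fL hL)
    have "l2norm (\<lambda>t. f t - \<nu> * h t - (\<Sum>l\<in>F. (a l - \<nu> * b l) * e l t)) = l2norm (\<lambda>t. ?u t + (- \<nu>) * ?v t)"
      by (simp add: left_diff_distrib sum_subtractf sum_distrib_left sum_negf algebra_simps)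
    also have "\<dots> \<le> l2norm ?u + cmod \<nu> * l2norm ?v"
      using l2norm_triangle[OF uL L2_scale[OF vL, of "- \<nu>"]] unfolding l2norm_scale by simp
    also have "\<dots> \<le> l2norm ?u + ?C * l2norm ?v"
      by (simp add: distrib_right)
    also have "\<dots> < \<epsilon> / 2 + ?C * (\<epsilon> / 2 / ?C)"
      using F1(3)[rule_format, of F] F2(3)[rule_format, of F] F C by (intro add_strict_mono mult_strict_left_mono) auto
    also have "\<dots> = \<epsilon>"
      using C by (simp add: field_simps)
    finally show "l2norm (\<lambda>t. f t - \<nu> * h t - (\<Sum>l\<in>F. (a l - \<nu> * b l) * e l t)) < \<epsilon>" .
  qed (use F1 F2 in auto)
qed

lemma l2_has_sum_zero:
  assumes "l2_has_sum g I f" "\<And>l t. l \<in> I \<Longrightarrow> g l t = 0"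
  shows "ae_eq f (\<lambda>_. 0)"
proof -
  have fL: "f \<in> L2"
    using assms(1) by (simp add: l2_has_sum_def)
  have "l2norm f < \<epsilon>" if \<epsilon>: "\<epsilon> > 0" for \<epsilon>
  proof -
    obtain F where F: "finite F" "F \<subseteq> I" "l2norm (\<lambda>t. f t - (\<Sum>l\<in>F. g l t)) < \<epsilon>"
      using l2_has_sumD[OF assms(1) \<epsilon>] by auto
    have "(\<Sum>l\<in>F. g l t) = 0" for t
      using F(2) assms(2) by (intro sum.neutral) auto
    then show ?thesis
      using F(3) by simp
  qed
  then have "l2norm f = 0"
    by (rule l2norm_eq_0I)
  then show ?thesis
    using l2norm_eq_0_iff[OF fL] by simp
qed

text \<open>Brings a vanishing limit into the form of the premise of \<open>inj\<close> in
  \<open>phase_equiv_iff_coefficients\<close>.\<close>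

lemma l2_has_sum_ae_zero:
  assumes e: "\<And>l. l \<in> I \<Longrightarrow> g l \<in> L2" and f: "l2_has_sum g I f" "ae_eq f (\<lambda>_. 0)" and \<epsilon>: "\<epsilon> > 0"
  shows "\<exists>F0. finite F0 \<and> F0 \<subseteq> I \<and> (\<forall>F. finite F \<and> F0 \<subseteq> F \<and> F \<subseteq> I \<longrightarrow> l2norm (\<lambda>t. \<Sum>l\<in>F. g l t) < \<epsilon>)"
proof -
  have fL: "f \<in> L2"
    using f(1) by (simp add: l2_has_sum_def)
  have eq: "l2norm (\<lambda>t. f t - (\<Sum>l\<in>F. g l t)) = l2norm (\<lambda>t. \<Sum>l\<in>F. g l t)" if "F \<subseteq> I" for F
  proof -
    have SL: "(\<lambda>t. \<Sum>l\<in>F. g l t) \<in> L2"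
      using that e by (intro L2_sum) auto
    have "ae_eq (\<lambda>t. f t - (\<Sum>l\<in>F. g l t)) (\<lambda>t. - 1 * (\<Sum>l\<in>F. g l t))"
      using f(2) unfolding ae_eq_def by eventually_elim simp
    then show ?thesis
      using l2norm_ae_cong[OF L2_diff[OF fL SL] L2_scale[OF SL, of "- 1"]] unfolding l2norm_scale by simp
  qed
  obtain F0 where "finite F0" "F0 \<subseteq> I"
    "\<forall>F. finite F \<and> F0 \<subseteq> F \<and> F \<subseteq> I \<longrightarrow> l2norm (\<lambda>t. f t - (\<Sum>l\<in>F. g l t)) < \<epsilon>"
    using l2_has_sumD[OF f(1) \<epsilon>] by (elim exE conjE)
  then show ?thesis
    using eq by (intro exI[of _ F0]) auto
qed

text \<open>\<open>inj\<close> is the independence required, stated only for the coefficients that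
  occur. The same form can be met by linear independence on a finite support and by a lower Riesz
  bound.\<close>

lemma phase_equiv_iff_coefficients:
  assumes e: "\<And>l. l \<in> I \<Longrightarrow> e l \<in> L2"
    and f: "l2_has_sum (\<lambda>l t. c l * e l t) I f" and fx: "l2_has_sum (\<lambda>l t. cnj (c l) * e l t) I fx"
    and inj: "\<And>\<nu>. (\<And>\<epsilon>. \<epsilon> > 0 \<Longrightarrow> \<exists>F0. finite F0 \<and> F0 \<subseteq> I \<and> (\<forall>F. finite F \<and> F0 \<subseteq> F \<and> F \<subseteq> I \<longrightarrow>
         l2norm (\<lambda>t. \<Sum>l\<in>F. (c l - \<nu> * cnj (c l)) * e l t) < \<epsilon>)) \<Longrightarrow> \<forall>l\<in>I. c l - \<nu> * cnj (c l) = 0"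
  shows "phase_equiv f fx \<longleftrightarrow> (\<exists>\<nu>. cmod \<nu> = 1 \<and> (\<forall>l\<in>I. c l = \<nu> * cnj (c l)))"
proof -
  have "ae_eq f (\<lambda>t. \<nu> * fx t) \<longleftrightarrow> (\<forall>l\<in>I. c l = \<nu> * cnj (c l))" for \<nu>
  proof -
    note s = l2_has_sum_diff_scale[of I e, OF e f fx, of \<nu>]
    have ae: "ae_eq f (\<lambda>t. \<nu> * fx t) \<longleftrightarrow> ae_eq (\<lambda>t. f t - \<nu> * fx t) (\<lambda>_. 0)"
      by (simp add: ae_eq_def)
    show ?thesis
    proof
      assume "ae_eq f (\<lambda>t. \<nu> * fx t)"
      then have "\<forall>l\<in>I. c l - \<nu> * cnj (c l) = 0"
        unfolding ae by (intro inj l2_has_sum_ae_zero[OF _ s]) (auto intro: L2_scale e)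
      then show "\<forall>l\<in>I. c l = \<nu> * cnj (c l)"
        by simp
    next
      assume "\<forall>l\<in>I. c l = \<nu> * cnj (c l)"
      then show "ae_eq f (\<lambda>t. \<nu> * fx t)"
        unfolding ae by (intro l2_has_sum_zero[OF s]) auto
    qed
  qed
  then show ?thesis
    by (simp add: phase_equiv_def)
qed

lemma summable_on_tail:
  fixes f :: "'i \<Rightarrow> real"
  assumes f: "f summable_on I" "\<And>x. x \<in> I \<Longrightarrow> 0 \<le> f x" and \<epsilon>: "\<epsilon> > 0"
  obtains F0 where "finite F0" "F0 \<subseteq> I" "\<And>G. finite G \<Longrightarrow> G \<subseteq> I \<Longrightarrow> G \<inter> F0 = {} \<Longrightarrow> sum f G < \<epsilon>"
proof -
  have "(sum f \<longlongrightarrow> infsum f I) (finite_subsets_at_top I)"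
    using f(1) by (rule infsum_tendsto)
  then have "\<forall>\<^sub>F F in finite_subsets_at_top I. infsum f I - \<epsilon> < sum f F"
    using \<epsilon> by (intro order_tendstoD) auto
  then obtain F0 where F0: "finite F0" "F0 \<subseteq> I" "infsum f I - \<epsilon> < sum f F0"
    unfolding eventually_finite_subsets_at_top by blast
  have "sum f G < \<epsilon>" if "finite G" "G \<subseteq> I" "G \<inter> F0 = {}" for G
  proof -
    have "sum f (F0 \<union> G) \<le> infsum f I"
      using F0 that f by (intro finite_sum_le_infsum) auto
    moreover have "sum f (F0 \<union> G) = sum f F0 + sum f G"
      using F0 that by (intro sum.union_disjoint) auto
    ultimately show ?thesis
      using F0(3) by linarith
  qed
  then show ?thesis
    using that F0 by blast
qed

text \<open>The upper bound makes tails small, hence the partial sums Cauchy.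
  \<open>L2_complete\<close> is about sequences, so the limit is taken along an increasing sequence
  of finite sets and then compared with all larger ones.\<close>

lemma l2_has_sum_exists:
  assumes e: "\<And>l. l \<in> I \<Longrightarrow> e l \<in> L2"
    and bound: "\<And>F. finite F \<Longrightarrow> F \<subseteq> I \<Longrightarrow> (l2norm (\<lambda>t. \<Sum>l\<in>F. b l * e l t))\<^sup>2 \<le> K * (\<Sum>l\<in>F. (cmod (b l))\<^sup>2)"
    and K: "0 \<le> K" and b: "(\<lambda>l. (cmod (b l))\<^sup>2) summable_on I"
  shows "\<exists>f. l2_has_sum (\<lambda>l t. b l * e l t) I f"
proof -
  let ?S = "\<lambda>F t. \<Sum>l\<in>F. b l * e l t"
  have SL: "F \<subseteq> I \<Longrightarrow> ?S F \<in> L2" for F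
    using e by (intro L2_sum L2_scale) auto
  have tail: "\<exists>F0. finite F0 \<and> F0 \<subseteq> I \<and> (\<forall>G. finite G \<longrightarrow> G \<subseteq> I \<longrightarrow> G \<inter> F0 = {} \<longrightarrow> l2norm (?S G) < \<epsilon>)" if \<epsilon>: "\<epsilon> > 0" for \<epsilon>
  proof -
    \<comment> \<open>\<open>K + 1\<close> instead of \<open>K\<close>, since \<open>K\<close> may
      be 0.\<close>
    have "0 < \<epsilon>\<^sup>2 / (K + 1)"
      using \<epsilon> K by simp
    then obtain F0 where F0: "finite F0" "F0 \<subseteq> I"
      "\<And>G. finite G \<Longrightarrow> G \<subseteq> I \<Longrightarrow> G \<inter> F0 = {} \<Longrightarrow> (\<Sum>l\<in>G. (cmod (b l))\<^sup>2) < \<epsilon>\<^sup>2 / (K + 1)"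
      using summable_on_tail[OF b, of "\<epsilon>\<^sup>2 / (K + 1)"] by auto
    have "l2norm (?S G) < \<epsilon>" if G: "finite G" "G \<subseteq> I" "G \<inter> F0 = {}" for G
    proof -
      have "(l2norm (?S G))\<^sup>2 \<le> K * (\<Sum>l\<in>G. (cmod (b l))\<^sup>2)"
        by (rule bound[OF G(1,2)])
      also have "\<dots> \<le> (K + 1) * (\<Sum>l\<in>G. (cmod (b l))\<^sup>2)"
        by (simp add: distrib_right sum_nonneg)
      also have "\<dots> < (K + 1) * (\<epsilon>\<^sup>2 / (K + 1))"
        using F0(3)[OF G] K by (intro mult_strict_left_mono) auto
      also have "\<dots> = \<epsilon>\<^sup>2"
        using K by simp
      finally show ?thesis
        using \<epsilon> by (simp add: power2_less_imp_less)
    qed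
    then show ?thesis
      using F0 by blast
  qed
  have "\<forall>n::nat. \<exists>F0. finite F0 \<and> F0 \<subseteq> I \<and>
    (\<forall>G. finite G \<longrightarrow> G \<subseteq> I \<longrightarrow> G \<inter> F0 = {} \<longrightarrow> l2norm (?S G) < inverse (real (Suc n)))"
    by (intro allI tail) simp
  then obtain T where T: "\<And>n. finite (T n)" "\<And>n. T n \<subseteq> I"
    "\<And>n G. finite G \<Longrightarrow> G \<subseteq> I \<Longrightarrow> G \<inter> T n = {} \<Longrightarrow> l2norm (?S G) < inverse (real (Suc n))"
    by metis
  \<comment> \<open>Unions make the sets increasing and keep \<open>T n\<close> inside
    \<open>G n\<close>, so whatever is added to \<open>G n\<close> is disjoint from
    \<open>T n\<close> and has a small sum.\<close>
  define G where "G n = (\<Union>k\<le>n. T k)" for n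
  have G: "finite (G n)" "G n \<subseteq> I" "T n \<subseteq> G n" for n
    using T by (auto simp: G_def)
  have G_mono: "G m \<subseteq> G n" if "m \<le> n" for m n
    using that by (force simp: G_def)
  have S_diff: "?S F t - ?S (G n) t = ?S (F - G n) t" if "finite F" "G n \<subseteq> F" for F n t
    using that by (simp add: sum_diff)
  have near: "l2norm (\<lambda>t. ?S F t - ?S (G n) t) < inverse (real (Suc n))" if "finite F" "G n \<subseteq> F" "F \<subseteq> I" for F n
    unfolding S_diff[OF that(1,2)] using that G(3)[of n] by (intro T(3)) auto
  have "\<exists>f\<in>L2. (\<lambda>n. l2norm (\<lambda>t. f t - ?S (G n) t)) \<longlonglongrightarrow> 0"
  proof (rule L2_complete)
    show "?S (G n) \<in> L2" for n
      by (rule SL[OF G(2)])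
    fix \<epsilon> :: real assume "\<epsilon> > 0"
    then obtain N where N: "inverse (real (Suc N)) < \<epsilon> / 2"
      using reals_Archimedean[of "\<epsilon> / 2"] by auto
    have "l2norm (\<lambda>t. ?S (G m) t - ?S (G n) t) < \<epsilon>" if "m \<ge> N" "n \<ge> N" for m n
    proof -
      have "l2norm (\<lambda>t. ?S (G m) t - ?S (G n) t)
        \<le> l2norm (\<lambda>t. ?S (G m) t - ?S (G N) t) + l2norm (\<lambda>t. ?S (G N) t - ?S (G n) t)"
        by (rule l2norm_diff_triangle[OF SL[OF G(2)] SL[OF G(2)] SL[OF G(2)]])
      then show ?thesis
        using near[OF G(1) G_mono[OF that(1)] G(2)] near[OF G(1) G_mono[OF that(2)] G(2)] N
          l2norm_minus_commute[of "?S (G N)" "?S (G n)"] by linarith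
    qed
    then show "\<exists>N. \<forall>m\<ge>N. \<forall>n\<ge>N. l2norm (\<lambda>t. ?S (G m) t - ?S (G n) t) < \<epsilon>"
      by blast
  qed
  then obtain f where fL: "f \<in> L2" and lim: "(\<lambda>n. l2norm (\<lambda>t. f t - ?S (G n) t)) \<longlonglongrightarrow> 0"
    by blast
  have "l2_has_sum (\<lambda>l t. b l * e l t) I f"
    unfolding l2_has_sum_def
  proof (intro conjI allI impI fL)
    fix \<epsilon> :: real assume "\<epsilon> > 0"
    then have "\<forall>\<^sub>F n in sequentially. l2norm (\<lambda>t. f t - ?S (G n) t) < \<epsilon> / 2"
      "\<forall>\<^sub>F n in sequentially. inverse (real (Suc n)) < \<epsilon> / 2"
      by (intro order_tendstoD[OF lim] order_tendstoD[OF LIMSEQ_inverse_real_of_nat]; simp)+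
    then have "\<forall>\<^sub>F n in sequentially. l2norm (\<lambda>t. f t - ?S (G n) t) < \<epsilon> / 2 \<and> inverse (real (Suc n)) < \<epsilon> / 2"
      by (rule eventually_conj)
    then obtain n where n: "l2norm (\<lambda>t. f t - ?S (G n) t) < \<epsilon> / 2" "inverse (real (Suc n)) < \<epsilon> / 2"
      by (auto simp: eventually_sequentially)
    show "\<exists>F0. finite F0 \<and> F0 \<subseteq> I \<and> (\<forall>F. finite F \<and> F0 \<subseteq> F \<and> F \<subseteq> I \<longrightarrow> l2norm (\<lambda>t. f t - ?S F t) < \<epsilon>)"
    proof (intro exI[of _ "G n"] conjI allI impI G)
      fix F assume F: "finite F \<and> G n \<subseteq> F \<and> F \<subseteq> I"
      then have "l2norm (\<lambda>t. f t - ?S F t) \<le> l2norm (\<lambda>t. f t - ?S (G n) t) + l2norm (\<lambda>t. ?S (G n) t - ?S F t)"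
        by (intro l2norm_diff_triangle fL SL G) auto
      then show "l2norm (\<lambda>t. f t - ?S F t) < \<epsilon>"
        using n near[of F n] F l2norm_minus_commute[of "?S (G n)" "?S F"] by linarith
    qed
  qed
  then show ?thesis
    by blast
qed

section \<open>Finite sums under a metaplectic operator\<close>

lemma metaplectic_linear:
  assumes "metaplectic_op S U" "f \<in> L2" "g \<in> L2"
  shows "ae_eq (U (\<lambda>t. p * f t + q * g t)) (\<lambda>t. p * U f t + q * U g t)"
  using assms unfolding metaplectic_op_def by blast

text \<open>Linearity is given for two functions and up to a null set, so the sum is built term by
  term, collecting finitely many null sets.\<close>

lemma metaplectic_sum:
  assumes U: "metaplectic_op S U" and \<psi>: "\<psi> \<in> L2" and F: "finite F"
  shows "ae_eq (U (\<lambda>t. \<Sum>l\<in>F. a l * \<psi> (t - l))) (\<lambda>t. \<Sum>l\<in>F. a l * U (transl l \<psi>) t)"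
  using F
proof (induction F rule: finite_induct)
  case empty
  \<comment> \<open>Linearity with both coefficients 0 says that \<open>U\<close> of the zero
    function vanishes almost everywhere.\<close>
  show ?case
    using metaplectic_linear[OF U \<psi> \<psi>, of 0 0] by simp
next
  case (insert x F)
  have "ae_eq (U (\<lambda>t. a x * transl x \<psi> t + 1 * (\<Sum>l\<in>F. a l * \<psi> (t - l))))
    (\<lambda>t. a x * U (transl x \<psi>) t + 1 * U (\<lambda>t. \<Sum>l\<in>F. a l * \<psi> (t - l)) t)"
    by (rule metaplectic_linear[OF U]) (auto simp: transl_def intro: L2_transl L2_sum_transl \<psi>)
  then have "AE t in lborel. U (\<lambda>t. \<Sum>l\<in>insert x F. a l * \<psi> (t - l)) t
     = a x * U (transl x \<psi>) t + U (\<lambda>t. \<Sum>l\<in>F. a l * \<psi> (t - l)) t"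
    using insert.hyps by (simp add: ae_eq_def transl_def)
  with insert.IH show ?case
    unfolding ae_eq_def by eventually_elim (use insert.hyps in simp)
qed

lemma
  assumes U: "metaplectic_op S U" and \<psi>: "\<psi> \<in> L2"
  shows metaplectic_transl_L2: "U (transl l \<psi>) \<in> L2"
    and l2norm_metaplectic_sum: "finite F \<Longrightarrow>
      l2norm (\<lambda>t. \<Sum>l\<in>F. a l * U (transl l \<psi>) t) = l2norm (\<lambda>t. \<Sum>l\<in>F. a l * \<psi> (t - l))"
proof -
  have iso: "U f \<in> L2" "l2norm (U f) = l2norm f" if "f \<in> L2" for f
    using U that unfolding metaplectic_op_def by blast+
  show L: "U (transl l \<psi>) \<in> L2" for l
    by (rule iso) (simp add: transl_def L2_transl \<psi>)
  assume F: "finite F"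
  have "l2norm (\<lambda>t. \<Sum>l\<in>F. a l * U (transl l \<psi>) t) = l2norm (U (\<lambda>t. \<Sum>l\<in>F. a l * \<psi> (t - l)))"
  proof (rule l2norm_ae_cong[symmetric, OF _ _ metaplectic_sum[OF U \<psi> F]])
    show "U (\<lambda>t. \<Sum>l\<in>F. a l * \<psi> (t - l)) \<in> L2"
      by (rule iso(1)[OF L2_sum_transl[OF \<psi>]])
    show "(\<lambda>t. \<Sum>l\<in>F. a l * U (transl l \<psi>) t) \<in> L2"
      by (intro L2_sum L2_scale L)
  qed
  also have "\<dots> = l2norm (\<lambda>t. \<Sum>l\<in>F. a l * \<psi> (t - l))"
    by (rule iso(2)[OF L2_sum_transl[OF \<psi>]])
  finally show "l2norm (\<lambda>t. \<Sum>l\<in>F. a l * U (transl l \<psi>) t) = l2norm (\<lambda>t. \<Sum>l\<in>F. a l * \<psi> (t - l))" .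
qed

text \<open>\<open>\<psi>\<close> is the preimage of \<open>\<phi>\<close> under \<open>U\<close>,
  so \<open>U (transl l \<psi>)\<close> is the conjugated translation applied to
  \<open>\<phi>\<close>. The limit \<open>fx\<close> is determined only up to a null set; hence
  existence and a claim about every such limit.\<close>

theorem theorem3p8:
  fixes \<phi> \<psi> f :: "(real, 'd::finite) vec \<Rightarrow> complex"
    and M :: "((real, 'd) vec, 'd) vec"
    and S :: "((real, 'd + 'd) vec, 'd + 'd) vec"
    and U :: "((real, 'd) vec \<Rightarrow> complex) \<Rightarrow> ((real, 'd) vec \<Rightarrow> complex)"
    and c :: "(real, 'd) vec \<Rightarrow> complex"
  assumes phi_L2: "\<phi> \<in> L2" and phi_nz: "\<not> ae_eq \<phi> (\<lambda>_. 0)"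
    and lat: "invertible M"
    and symp: "symplectic S"
    and meta: "metaplectic_op S U"
    and psi: "\<psi> \<in> L2" "ae_eq (U \<psi>) \<phi>"
    and c_l2: "l2seq (lattice_of M) c"
    and f_sum: "l2_has_sum (\<lambda>l t. c l * U (transl l \<psi>) t) (lattice_of M) f"
  shows
    "(c00 (lattice_of M) c \<longrightarrow>
        (\<exists>fx. l2_has_sum (\<lambda>l t. cnj (c l) * U (transl l \<psi>) t) (lattice_of M) fx) \<and>
        (\<forall>fx. l2_has_sum (\<lambda>l t. cnj (c l) * U (transl l \<psi>) t) (lattice_of M) fx \<longrightarrow>
              (\<not> phase_equiv f fx \<longleftrightarrow> l2_O (lattice_of M) c)))
   \<and> ((\<exists>A B g. 0 < A \<and> A \<le> B \<and> is_L2_fourier \<psi> g \<and>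
          (AE t in lborel. t \<in> dual_cell M \<longrightarrow>
             (\<lambda>\<gamma>. (cmod (g (t + \<gamma>)))\<^sup>2) summable_on dual_lattice M \<and>
             A \<le> periodization M g t \<and> periodization M g t \<le> B)) \<longrightarrow>
        (\<exists>fx. l2_has_sum (\<lambda>l t. cnj (c l) * U (transl l \<psi>) t) (lattice_of M) fx) \<and>
        (\<forall>fx. l2_has_sum (\<lambda>l t. cnj (c l) * U (transl l \<psi>) t) (lattice_of M) fx \<longrightarrow>
              (\<not> phase_equiv f fx \<longleftrightarrow> l2_O (lattice_of M) c)))"
proof (intro conjI impI)
  let ?L = "lattice_of M" and ?e = "\<lambda>l. U (transl l \<psi>)"
  note eL = metaplectic_transl_L2[OF meta psi(1)]
  have norm_eq: "l2norm (\<lambda>t. \<Sum>l\<in>F. a l * ?e l t) = l2norm (\<lambda>t. \<Sum>l\<in>F. a l * \<psi> (t - l))" if "finite F" for F a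
    by (rule l2norm_metaplectic_sum[OF meta psi(1) that])
  have psi_nz: "l2norm \<psi> \<noteq> 0"
  proof
    assume "l2norm \<psi> = 0"
    moreover have U\<psi>: "U \<psi> \<in> L2" "l2norm (U \<psi>) = l2norm \<psi>"
      using meta psi(1) unfolding metaplectic_op_def by blast+
    ultimately have "l2norm \<phi> = 0"
      using l2norm_ae_cong[OF U\<psi>(1) phi_L2 psi(2)] by simp
    then show False
      using l2norm_eq_0_iff[OF phi_L2] phi_nz by simp
  qed
  \<comment> \<open>Both cases end alike; what is left to each is independence for the coefficients
    \<open>c l - \<nu> * cnj (c l)\<close>.\<close>
  have conclude: "\<forall>fx. l2_has_sum (\<lambda>l t. cnj (c l) * ?e l t) ?L fx \<longrightarrow> (\<not> phase_equiv f fx \<longleftrightarrow> l2_O ?L c)"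
    if "\<And>\<nu>. (\<And>\<epsilon>. \<epsilon> > 0 \<Longrightarrow> \<exists>F0. finite F0 \<and> F0 \<subseteq> ?L \<and> (\<forall>F. finite F \<and> F0 \<subseteq> F \<and> F \<subseteq> ?L \<longrightarrow>
         l2norm (\<lambda>t. \<Sum>l\<in>F. (c l - \<nu> * cnj (c l)) * ?e l t) < \<epsilon>)) \<Longrightarrow> \<forall>l\<in>?L. c l - \<nu> * cnj (c l) = 0"
  proof (intro allI impI)
    fix fx assume fx: "l2_has_sum (\<lambda>l t. cnj (c l) * ?e l t) ?L fx"
    have "phase_equiv f fx \<longleftrightarrow> (\<exists>\<nu>. cmod \<nu> = 1 \<and> (\<forall>l\<in>?L. c l = \<nu> * cnj (c l)))"
      by (rule phase_equiv_iff_coefficients[where e = ?e, OF eL f_sum fx that])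
    then show "\<not> phase_equiv f fx \<longleftrightarrow> l2_O ?L c"
      unfolding l2_O_def unimodular_conjugate_iff using c_l2 by blast
  qed
  {
    assume "c00 ?L c"
    define T where "T = {l \<in> ?L. c l \<noteq> 0}"
    have T: "finite T" "T \<subseteq> ?L"
      using \<open>c00 ?L c\<close> by (auto simp: T_def c00_def)
    \<comment> \<open>Serves both \<open>cnj (c l)\<close> and
      \<open>c l - \<nu> * cnj (c l)\<close>, which vanish wherever \<open>c l\<close> does.\<close>
    have restrict: "(\<Sum>l\<in>F. a l * g l t) = (\<Sum>l\<in>T. a l * g l t)"
      if "finite F" "T \<subseteq> F" "F \<subseteq> ?L" "\<And>l. c l = 0 \<Longrightarrow> a l = 0"
      for F and a :: "(real, 'd) vec \<Rightarrow> complex" and g :: "(real, 'd) vec \<Rightarrow> (real, 'd) vec \<Rightarrow> complex" and t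
      using that by (intro sum.mono_neutral_right) (auto simp: T_def)
    have "l2_has_sum (\<lambda>l t. cnj (c l) * ?e l t) ?L (\<lambda>t. \<Sum>l\<in>T. cnj (c l) * ?e l t)"
      unfolding l2_has_sum_def
    proof (intro conjI allI impI exI[of _ T] T)
      show "(\<lambda>t. \<Sum>l\<in>T. cnj (c l) * ?e l t) \<in> L2"
        by (intro L2_sum L2_scale eL)
      fix \<epsilon> :: real and F assume "\<epsilon> > 0" "finite F \<and> T \<subseteq> F \<and> F \<subseteq> ?L"
      then show "l2norm (\<lambda>t. (\<Sum>l\<in>T. cnj (c l) * ?e l t) - (\<Sum>l\<in>F. cnj (c l) * ?e l t)) < \<epsilon>"
        using restrict[of F "\<lambda>l. cnj (c l)" ?e] by (simp add: l2norm_def)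
    qed
    then show "\<exists>fx. l2_has_sum (\<lambda>l t. cnj (c l) * ?e l t) ?L fx"
      by blast
    show "\<forall>fx. l2_has_sum (\<lambda>l t. cnj (c l) * ?e l t) ?L fx \<longrightarrow> (\<not> phase_equiv f fx \<longleftrightarrow> l2_O ?L c)"
    proof (rule conclude)
      fix \<nu>
      let ?a = "\<lambda>l. c l - \<nu> * cnj (c l)"
      assume small: "\<And>\<epsilon>. \<epsilon> > 0 \<Longrightarrow> \<exists>F0. finite F0 \<and> F0 \<subseteq> ?L \<and> (\<forall>F. finite F \<and> F0 \<subseteq> F \<and> F \<subseteq> ?L \<longrightarrow>
         l2norm (\<lambda>t. \<Sum>l\<in>F. ?a l * ?e l t) < \<epsilon>)"
      have "l2norm (\<lambda>t. \<Sum>l\<in>T. ?a l * ?e l t) < \<epsilon>" if \<epsilon>: "\<epsilon> > 0" for \<epsilon>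
      proof -
        obtain F0 where F0: "finite F0" "F0 \<subseteq> ?L"
          "\<forall>F. finite F \<and> F0 \<subseteq> F \<and> F \<subseteq> ?L \<longrightarrow> l2norm (\<lambda>t. \<Sum>l\<in>F. ?a l * ?e l t) < \<epsilon>"
          using small[OF \<epsilon>] by (elim exE conjE)
        then have "l2norm (\<lambda>t. \<Sum>l\<in>F0 \<union> T. ?a l * ?e l t) < \<epsilon>"
          using T by (intro F0(3)[rule_format]) auto
        moreover have "(\<Sum>l\<in>F0 \<union> T. ?a l * ?e l t) = (\<Sum>l\<in>T. ?a l * ?e l t)" for t
          using F0(1,2) T by (intro restrict) auto
        ultimately show ?thesis
          by simp
      qed
      then have "l2norm (\<lambda>t. \<Sum>l\<in>T. ?a l * ?e l t) = 0"
        by (rule l2norm_eq_0I)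
      then have "\<forall>l\<in>T. ?a l = 0"
        unfolding norm_eq[OF T(1)] by (rule finite_translates_independent[OF psi(1) psi_nz T(1)])
      then show "\<forall>l\<in>?L. ?a l = 0"
        by (auto simp: T_def)
    qed
  }
  {
    assume "\<exists>A B g. 0 < A \<and> A \<le> B \<and> is_L2_fourier \<psi> g \<and>
          (AE t in lborel. t \<in> dual_cell M \<longrightarrow>
             (\<lambda>\<gamma>. (cmod (g (t + \<gamma>)))\<^sup>2) summable_on dual_lattice M \<and>
             A \<le> periodization M g t \<and> periodization M g t \<le> B)"
    then obtain A B g where A: "0 < A" and g: "is_L2_fourier \<psi> g"
      and per: "AE t in lborel. t \<in> dual_cell M \<longrightarrow>
             (\<lambda>\<gamma>. (cmod (g (t + \<gamma>)))\<^sup>2) summable_on dual_lattice M \<and>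
             A \<le> periodization M g t \<and> periodization M g t \<le> B"
      by blast
    let ?V = "measure lborel (half_open_cell M)"
    note riesz = periodization_Riesz_bounds[OF lat psi(1) g A per]
    show "\<exists>fx. l2_has_sum (\<lambda>l t. cnj (c l) * ?e l t) ?L fx"
    proof (rule l2_has_sum_exists[where K = "\<bar>B\<bar> * ?V"])
      show "(l2norm (\<lambda>t. \<Sum>l\<in>F. cnj (c l) * ?e l t))\<^sup>2 \<le> \<bar>B\<bar> * ?V * (\<Sum>l\<in>F. (cmod (cnj (c l)))\<^sup>2)"
        if "finite F" "F \<subseteq> ?L" for F
        unfolding norm_eq[OF that(1)] by (rule riesz(2)[OF that])
      show "(\<lambda>l. (cmod (cnj (c l)))\<^sup>2) summable_on ?L"
        using c_l2 by (simp add: l2seq_def)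
    qed (auto intro: eL)
    show "\<forall>fx. l2_has_sum (\<lambda>l t. cnj (c l) * ?e l t) ?L fx \<longrightarrow> (\<not> phase_equiv f fx \<longleftrightarrow> l2_O ?L c)"
    proof (rule conclude, rule ballI)
      fix \<nu> l
      let ?a = "\<lambda>l. c l - \<nu> * cnj (c l)"
      assume small: "\<And>\<epsilon>. \<epsilon> > 0 \<Longrightarrow> \<exists>F0. finite F0 \<and> F0 \<subseteq> ?L \<and> (\<forall>F. finite F \<and> F0 \<subseteq> F \<and> F \<subseteq> ?L \<longrightarrow>
         l2norm (\<lambda>t. \<Sum>l\<in>F. ?a l * ?e l t) < \<epsilon>)" and l: "l \<in> ?L"
      have AV: "A * ?V > 0"
        using A half_open_cell_pos[OF lat] by simp
      have "A * ?V * (cmod (?a l))\<^sup>2 \<le> \<epsilon>\<^sup>2" if \<epsilon>: "\<epsilon> > 0" for \<epsilon>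
      proof -
        obtain F0 where F0: "finite F0" "F0 \<subseteq> ?L"
          "\<forall>F. finite F \<and> F0 \<subseteq> F \<and> F \<subseteq> ?L \<longrightarrow> l2norm (\<lambda>t. \<Sum>l\<in>F. ?a l * ?e l t) < \<epsilon>"
          using small[OF \<epsilon>] by (elim exE conjE)
        \<comment> \<open>Large enough for the sum to be small, and containing \<open>l\<close>, so
          that the lower Riesz bound reaches the coefficient at \<open>l\<close>.\<close>
        let ?F = "insert l F0"
        have F: "finite ?F" "?F \<subseteq> ?L"
          using F0 l by auto
        have "(cmod (?a l))\<^sup>2 \<le> (\<Sum>l\<in>?F. (cmod (?a l))\<^sup>2)"
          using F(1) by (intro member_le_sum[where f = "\<lambda>l. (cmod (?a l))\<^sup>2"]) auto
        then have "A * ?V * (cmod (?a l))\<^sup>2 \<le> A * ?V * (\<Sum>l\<in>?F. (cmod (?a l))\<^sup>2)"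
          using AV by (intro mult_left_mono) auto
        also have "\<dots> \<le> (l2norm (\<lambda>t. \<Sum>l\<in>?F. ?a l * ?e l t))\<^sup>2"
          unfolding norm_eq[OF F(1)] by (rule riesz(1)[OF F])
        also have "\<dots> \<le> \<epsilon>\<^sup>2"
          using F by (intro power_mono less_imp_le[OF F0(3)[rule_format]]) auto
        finally show ?thesis .
      qed
      note le = this
      show "?a l = 0"
      proof (rule ccontr)
        assume "?a l \<noteq> 0"
        then have pos: "A * ?V * (cmod (?a l))\<^sup>2 > 0"
          using AV by simp
        \<comment> \<open>Taking half of the positive quantity as \<epsilon>^2 contradicts the
          bound.\<close>
        have "A * ?V * (cmod (?a l))\<^sup>2 \<le> (sqrt (A * ?V * (cmod (?a l))\<^sup>2 / 2))\<^sup>2"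
          using pos by (intro le real_sqrt_gt_zero) linarith
        also have "\<dots> = A * ?V * (cmod (?a l))\<^sup>2 / 2"
          using pos by (intro real_sqrt_pow2) linarith
        finally show False
          using pos by linarith
      qed
    qed
  }
qed

end
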